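(* Let $A, B_1,\dots,B_M, F_1,\dots,F_N \in \mathbb{R}^{L\times L}$ and $e_1,\dots,e_M \in \mathbb{R}_+$ be such that (a) each $F_n$ is a diagonal matrix, and (b) $A-\sum_{m=1}^M e_m|B_m|$ is Metzler. Consider the Itô stochastic differential equation $$dx(t)=\Big(Ax(t)+\sum_{m=1}^M B_m u_m(t)\Big)dt+\sum_{n=1}^N F_n x(t)\,dw_n(t),\qquad x(0)=x_0,$$ with time horizon $[0,T]$, $T>0$ arbitrary, where $w=(w_1,\dots,w_N)$ is an $N$-dimensional standard Brownian motion. Suppose that for each $m=1,\dots,M$ the control input has the form $u_m(t)=K_m(t)x(t)$, where $K_m(t)$ is a diagonal $L\times L$ matrix with $|K_m(t)|\le e_m I_L$ for all $t$, and that the admissibility (regularity) conditions stated in the context are satisfied, so that the equation has a unique strong solution $x(t)$. If $x_0\in\mathbb{R}^L_+$, then, almost surely, $x(t)$ is component-wise nonnegative for all $t>0$ in the horizon.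
   Context: $\mathbb{R}_+$ is the set of nonnegative reals. For matrices, $|X|$ is the elementwise absolute value and $X\ge Y$ means every entry of $X-Y$ is nonnegative. A square matrix is Metzler if all its off-diagonal entries are nonnegative. $I_L$ is the $L\times L$ identity. Everything is defined on a probability space $(\Omega,\mathcal F,P)$ with a nondecreasing family of $\sigma$-algebras $\mathcal F_t\subseteq\mathcal F$; $w(t)\in\mathbb{R}^N$, $w(0)=0$, is an $\mathcal F_t$-adapted $N$-dimensional Brownian motion with $\mathbb{E}[(w(t)-w(s))(w(t)-w(s))^\top]=(t-s)I_N$ for $0\le s\le t$. The initial state $x_0$ is deterministic. Admissibility (regularity) conditions (the standard existence/uniqueness hypotheses for SDEs): the controls $u_m(t)=K_m(t)x(t)$ are such that the drift and diffusion coefficients $(t,x)\mapsto (A+\sum_m B_mK_m(t))x$ and $(t,x)\mapsto F_nx$ are measurable, of at most linear growth in $x$ and Lipschitz in $x$ (uniformly in $t$), and the processes $Ax(t)+\sum_m B_mu_m(t)$ and $F_nx(t)$ are jointly measurable, $\mathcal F_t$-adapted and square integrable over $\Omega\times[0,T]$. ($K_m$ may be random as long as it is jointly measurable and $\mathcal F_t$-adapted.) Then $x(t)$ denotes the unique $t$-continuous, $\mathcal F_t$-adapted strong solution. *)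

theory Defs
  imports "HOL-Probability.Probability"
begin

section \<open>Matrices\<close>

text \<open>
  On \<^typ>\<open>real^'n\<close> and \<^typ>\<open>real^'n^'m\<close> the library order \<open>\<le>\<close> and the absolute value
  \<open>\<bar>_\<bar>\<close> are entrywise (instance of \<^class>\<open>ordered_euclidean_space\<close>), so they are used
  directly for matrix inequalities and for \<open>\<bar>X\<bar>\<close>.
\<close>

definition diagonal_matrix :: "real^'l^'l \<Rightarrow> bool" where
  "diagonal_matrix X \<longleftrightarrow> (\<forall>i j. i \<noteq> j \<longrightarrow> X $ i $ j = 0)"

definition metzler :: "real^'l^'l \<Rightarrow> bool" where
  "metzler X \<longleftrightarrow> (\<forall>i j. i \<noteq> j \<longrightarrow> 0 \<le> X $ i $ j)"

lemma abs_matrix_component: "\<bar>X :: real^'l^'k\<bar> $ i $ j = \<bar>X $ i $ j\<bar>"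
  by (simp add: abs_vec_def)

lemma le_matrix_iff: "(X :: real^'l^'k) \<le> Y \<longleftrightarrow> (\<forall>i j. X $ i $ j \<le> Y $ i $ j)"
  by (simp add: less_eq_vec_def)


section \<open>Filtrations, processes and Brownian motion\<close>

text \<open>Time is \<open>[0, \<infinity>)\<close>; the values of a family \<open>\<F>\<close> at negative times are irrelevant.\<close>

definition filtration_on :: "'a measure \<Rightarrow> (real \<Rightarrow> 'a measure) \<Rightarrow> bool" where
  "filtration_on M \<F> \<longleftrightarrow>
     (\<forall>t\<ge>0. subalgebra M (\<F> t)) \<and> (\<forall>s t. 0 \<le> s \<and> s \<le> t \<longrightarrow> subalgebra (\<F> t) (\<F> s))"

definition time_space :: "'a measure \<Rightarrow> real \<Rightarrow> (real \<times> 'a) measure" where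
  "time_space M T = restrict_space lborel {0..T} \<Otimes>\<^sub>M M"

definition measurable_adapted ::
    "'a measure \<Rightarrow> (real \<Rightarrow> 'a measure) \<Rightarrow> real \<Rightarrow> (real \<Rightarrow> 'a \<Rightarrow> 'b::topological_space) \<Rightarrow> bool" where
  "measurable_adapted M \<F> T X \<longleftrightarrow>
     (\<lambda>(t, \<omega>). X t \<omega>) \<in> borel_measurable (time_space M T) \<and>
     (\<forall>t\<in>{0..T}. X t \<in> borel_measurable (\<F> t))"

definition square_integrable_process ::
    "'a measure \<Rightarrow> (real \<Rightarrow> 'a measure) \<Rightarrow> real \<Rightarrow> (real \<Rightarrow> 'a \<Rightarrow> 'b::euclidean_space) \<Rightarrow> bool" where
  "square_integrable_process M \<F> T X \<longleftrightarrow>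
     measurable_adapted M \<F> T X \<and>
     integrable (time_space M T) (\<lambda>(t, \<omega>). (norm (X t \<omega>))\<^sup>2)"

text \<open>
  Standard Brownian motion relative to \<open>\<F>\<close>: the increment over \<open>[s, t]\<close> has independent
  \<open>N(0, t - s)\<close> components (so its covariance matrix is \<open>(t - s) I\<close>) and, as a vector, is
  independent of \<open>\<F> s\<close>.
\<close>

definition brownian_motion ::
    "'a measure \<Rightarrow> (real \<Rightarrow> 'a measure) \<Rightarrow> (real \<Rightarrow> 'a \<Rightarrow> real^'n) \<Rightarrow> bool" where
  "brownian_motion M \<F> w \<longleftrightarrow>
     (\<forall>t\<ge>0. w t \<in> borel_measurable (\<F> t)) \<and>
     (AE \<omega> in M. w 0 \<omega> = 0) \<and>
     (AE \<omega> in M. continuous_on {0..} (\<lambda>t. w t \<omega>)) \<and>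
     (\<forall>s t. 0 \<le> s \<and> s < t \<longrightarrow>
        (\<forall>n. distributed M lborel (\<lambda>\<omega>. (w t \<omega> - w s \<omega>) $ n) (normal_density 0 (sqrt (t - s)))) \<and>
        prob_space.indep_vars M (\<lambda>_. borel) (\<lambda>n \<omega>. (w t \<omega> - w s \<omega>) $ n) UNIV \<and>
        prob_space.indep_set M (sets (\<F> s))
          {(\<lambda>\<omega>. w t \<omega> - w s \<omega>) -` S \<inter> space M | S. S \<in> sets borel})"


section \<open>The It\^o integral\<close>

text \<open>
  A simple integrand on \<open>[0, T]\<close> is given by a partition \<open>0 = \<tau> 0 < \<dots> < \<tau> k = T\<close> and square
  integrable values \<open>\<xi> j\<close>, known at time \<open>\<tau> j\<close> and held on \<open>[\<tau> j, \<tau> (j + 1))\<close>. The values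
  may be vectors; the integrator is scalar.
\<close>

definition simple_integrand ::
    "'a measure \<Rightarrow> (real \<Rightarrow> 'a measure) \<Rightarrow> real \<Rightarrow>
     nat \<Rightarrow> (nat \<Rightarrow> real) \<Rightarrow> (nat \<Rightarrow> 'a \<Rightarrow> 'b::euclidean_space) \<Rightarrow> bool" where
  "simple_integrand M \<F> T k \<tau> \<xi> \<longleftrightarrow>
     \<tau> 0 = 0 \<and> \<tau> k = T \<and> (\<forall>j<k. \<tau> j < \<tau> (Suc j)) \<and>
     (\<forall>j<k. \<xi> j \<in> borel_measurable (\<F> (\<tau> j)) \<and> integrable M (\<lambda>\<omega>. (norm (\<xi> j \<omega>))\<^sup>2))"

definition simple_process ::
    "nat \<Rightarrow> (nat \<Rightarrow> real) \<Rightarrow> (nat \<Rightarrow> 'a \<Rightarrow> 'b::euclidean_space) \<Rightarrow> real \<Rightarrow> 'a \<Rightarrow> 'b" where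
  "simple_process k \<tau> \<xi> t \<omega> = (\<Sum>j<k. indicator {\<tau> j..<\<tau> (Suc j)} t *\<^sub>R \<xi> j \<omega>)"

definition simple_integral ::
    "nat \<Rightarrow> (nat \<Rightarrow> real) \<Rightarrow> (nat \<Rightarrow> 'a \<Rightarrow> 'b::euclidean_space) \<Rightarrow>
     (real \<Rightarrow> 'a \<Rightarrow> real) \<Rightarrow> real \<Rightarrow> 'a \<Rightarrow> 'b" where
  "simple_integral k \<tau> \<xi> W t \<omega> =
     (\<Sum>j<k. (W (min t (\<tau> (Suc j))) \<omega> - W (min t (\<tau> j)) \<omega>) *\<^sub>R \<xi> j \<omega>)"

text \<open>
  \<open>I t\<close> is a version of \<open>\<integral>\<^sub>0\<^sup>t H s dW s\<close> for every \<open>t \<in> [0, T]\<close>: the mean square limit of the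
  integrals of simple integrands that converge to \<open>H\<close> in mean square on \<open>[0, T] \<times> \<Omega>\<close>. For a
  Brownian motion \<open>W\<close>, such sequences exist for every square integrable \<open>H\<close>, and by the It\^o
  isometry \<open>I t\<close> is determined up to null sets, whichever sequence is used.
\<close>

definition has_ito_integral ::
    "'a measure \<Rightarrow> (real \<Rightarrow> 'a measure) \<Rightarrow> real \<Rightarrow> (real \<Rightarrow> 'a \<Rightarrow> real) \<Rightarrow>
     (real \<Rightarrow> 'a \<Rightarrow> 'b::euclidean_space) \<Rightarrow> (real \<Rightarrow> 'a \<Rightarrow> 'b) \<Rightarrow> bool" where
  "has_ito_integral M \<F> T W H I \<longleftrightarrow>
     square_integrable_process M \<F> T H \<and>
     (\<forall>t\<in>{0..T}. I t \<in> borel_measurable M) \<and>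
     (\<exists>k \<tau> \<xi>.
        (\<forall>p::nat. simple_integrand M \<F> T (k p) (\<tau> p) (\<xi> p)) \<and>
        (\<lambda>p. \<integral>\<^sup>+(t, \<omega>). ennreal ((norm (H t \<omega> - simple_process (k p) (\<tau> p) (\<xi> p) t \<omega>))\<^sup>2)
               \<partial>time_space M T) \<longlonglongrightarrow> 0 \<and>
        (\<forall>t\<in>{0..T}.
           (\<lambda>p. \<integral>\<^sup>+\<omega>. ennreal ((norm (I t \<omega> - simple_integral (k p) (\<tau> p) (\<xi> p) W t \<omega>))\<^sup>2)
                  \<partial>M) \<longlonglongrightarrow> 0))"


section \<open>Stochastic differential equations\<close>

text \<open>
  \<open>dx = b dt + \<Sum>n. \<sigma> n dw\<^sub>n\<close> on \<open>[0, T]\<close> with \<open>x 0 = x0\<close>, in integrated form, for a \<open>t\<close>-continuous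
  adapted \<open>x\<close>. For a state dependent equation, \<open>b\<close> and \<open>\<sigma> n\<close> are the drift and diffusion
  coefficients evaluated along \<open>x\<close>.
\<close>

definition ito_equation ::
    "'a measure \<Rightarrow> (real \<Rightarrow> 'a measure) \<Rightarrow> real \<Rightarrow> (real \<Rightarrow> 'a \<Rightarrow> real^'n) \<Rightarrow>
     (real \<Rightarrow> 'a \<Rightarrow> real^'l) \<Rightarrow> ('n \<Rightarrow> real \<Rightarrow> 'a \<Rightarrow> real^'l) \<Rightarrow> real^'l \<Rightarrow>
     (real \<Rightarrow> 'a \<Rightarrow> real^'l) \<Rightarrow> bool" where
  "ito_equation M \<F> T w b \<sigma> x0 x \<longleftrightarrow>
     (\<forall>t\<in>{0..T}. x t \<in> borel_measurable (\<F> t)) \<and>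
     (AE \<omega> in M. continuous_on {0..T} (\<lambda>t. x t \<omega>)) \<and>
     (\<exists>I. (\<forall>n. has_ito_integral M \<F> T (\<lambda>t \<omega>. w t \<omega> $ n) (\<sigma> n) (I n)) \<and>
          (\<forall>t\<in>{0..T}. AE \<omega> in M.
             x t \<omega> = x0 + (LINT s:{0..t}|lborel. b s \<omega>) + (\<Sum>n\<in>UNIV. I n t \<omega>)))"

text \<open>
  The standard existence and uniqueness hypotheses on a (possibly random) coefficient
  \<open>f t \<omega> y\<close>: measurability, and linear growth and Lipschitz continuity in \<open>y\<close> with constants
  that depend neither on \<open>t\<close> nor on \<open>\<omega>\<close>.
\<close>

definition regular_coefficient ::
    "'a measure \<Rightarrow> real \<Rightarrow> (real \<Rightarrow> 'a \<Rightarrow> real^'l \<Rightarrow> real^'l) \<Rightarrow> bool" where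
  "regular_coefficient M T f \<longleftrightarrow>
     (\<lambda>((t, \<omega>), y). f t \<omega> y) \<in> borel_measurable (time_space M T \<Otimes>\<^sub>M borel) \<and>
     (\<exists>C. \<forall>t\<in>{0..T}. \<forall>\<omega>\<in>space M. \<forall>y. norm (f t \<omega> y) \<le> C * (1 + norm y)) \<and>
     (\<exists>C. \<forall>t\<in>{0..T}. \<forall>\<omega>\<in>space M. C-lipschitz_on UNIV (f t \<omega>))"

end

theory Submission
  imports Defs
begin

text \<open>
  No It\^o formula is used. Put \<open>q t = (\<Sum>i. E (min (x\<^sub>i t) 0)\<^sup>2)\<close>. Over a step of length \<open>h\<close> the
  component \<open>a = x\<^sub>i s\<close> becomes \<open>a (1 + \<eta>) + g + d + \<epsilon>\<close>: the noise enters multiplicatively because the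
  \<open>F n\<close> are diagonal, with \<open>\<eta>\<close> Gaussian, of variance \<open>O(h)\<close> and independent of the past, so a sign change
  of \<open>a (1 + \<eta>)\<close> needs \<open>\<bar>\<eta>\<bar> \<ge> 1\<close> and contributes only \<open>O(h\<^sup>2)\<close>; \<open>g\<close> is the drift with \<open>x\<close> frozen at
  \<open>s\<close>, which pushes inward up to \<open>O(h) q s\<close> because \<open>A + (\<Sum>m. B m ** K m)\<close> is Metzler; the freezing
  error \<open>d\<close> of the drift has size \<open>O(h\<^bsup>3/2\<^esup>)\<close> in mean square norm; and the freezing error \<open>\<epsilon>\<close> of the
  It\^o integral is \<open>O(h)\<close> but orthogonal to the past. Hence
  \<open>q (s + h) \<le> (1 + O(h)) q s + O(h\<^bsup>3/2\<^esup>)\<close>, and iterating over ever finer partitions gives \<open>q = 0\<close>.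
  Continuity of the paths extends the conclusion from rational to all times.
\<close>

section \<open>The discrete It\^o isometry\<close>

text \<open>The function \<open>(min a 0)\<^sup>2\<close> is not twice differentiable at 0, and the
  stochastic integrals are given only as mean square limits at each fixed time; both suit one-step
  comparisons better than a pathwise expansion. The budget is set by the number of steps, about
  \<open>1 / h\<close>: a term of order \<open>h\<close> is harmless only if it is weighted by the
  negative part itself, and every other term must be of smaller order. The delicate term is the
  product of \<open>\<epsilon>\<close> with the negative part of \<open>a * (1 + \<eta>)\<close>,
  which is not known at the start of the step. Passing to \<open>min a 0\<close>, which is known,
  costs a factor of at most \<open>\<bar>a * \<eta>\<bar>\<close>, of mean square size
  \<open>O(sqrt h)\<close>; times \<open>\<epsilon>\<close> this is again of order
  \<open>h * sqrt h\<close>. Nor is \<open>g\<close> known at the start, since the control varies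
  randomly during the step. Its sign is therefore used pointwise, through the feedback matrix
  integrated over the step, and never through orthogonality. All constants rest on a time-uniform
  second moment of \<open>x\<close>, which is read off from the equation.\<close>

lemma integrable_mult_square:
  fixes f g :: "'a \<Rightarrow> real"
  assumes "f \<in> borel_measurable M" "g \<in> borel_measurable M"
    and "integrable M (\<lambda>x. (f x)\<^sup>2)" "integrable M (\<lambda>x. (g x)\<^sup>2)"
  shows "integrable M (\<lambda>x. f x * g x)"
proof (rule Bochner_Integration.integrable_bound)
  show "integrable M (\<lambda>x. (f x)\<^sup>2 + (g x)\<^sup>2)"
    using assms by auto
  show "(\<lambda>x. f x * g x) \<in> borel_measurable M"
    using assms by measurable
  have "\<bar>a * b\<bar> \<le> a\<^sup>2 + b\<^sup>2" for a b :: real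
  proof -
    have "0 \<le> (\<bar>a\<bar> - \<bar>b\<bar>)\<^sup>2" by simp
    then have "2 * (\<bar>a\<bar> * \<bar>b\<bar>) \<le> a\<^sup>2 + b\<^sup>2" by (simp add: power2_diff)
    moreover have "0 \<le> \<bar>a\<bar> * \<bar>b\<bar>" by simp
    ultimately show ?thesis unfolding abs_mult by linarith
  qed
  then show "AE x in M. norm (f x * g x) \<le> norm ((f x)\<^sup>2 + (g x)\<^sup>2)"
    by auto
qed

lemma power2_add_le: "(a + b)\<^sup>2 \<le> 2 * a\<^sup>2 + 2 * b\<^sup>2" for a b :: real
  using zero_le_power2[of "a - b"] unfolding power2_sum power2_diff by linarith

lemma integrable_power2_add:
  fixes f g :: "'a \<Rightarrow> real"
  assumes "f \<in> borel_measurable M" "g \<in> borel_measurable M"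
    and "integrable M (\<lambda>x. (f x)\<^sup>2)" "integrable M (\<lambda>x. (g x)\<^sup>2)"
  shows "integrable M (\<lambda>x. (f x + g x)\<^sup>2)"
  using integrable_mult_square[OF assms] assms
  by (simp add: power2_sum mult.assoc)

lemma integrable_power2_diff:
  fixes f g :: "'a \<Rightarrow> real"
  assumes "f \<in> borel_measurable M" "g \<in> borel_measurable M"
    and "integrable M (\<lambda>x. (f x)\<^sup>2)" "integrable M (\<lambda>x. (g x)\<^sup>2)"
  shows "integrable M (\<lambda>x. (f x - g x)\<^sup>2)"
  using integrable_mult_square[OF assms] assms
  by (simp add: power2_diff mult.assoc)

text \<open>One coordinate of \<open>w\<close>, but relative to the filtration of the whole vector,
  so that an integrand may depend on the past of every coordinate. Independence is stated for real
  random variables \<open>V\<close>, the form in which expectations of products factor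
  directly.\<close>

locale scalar_brownian = prob_space M for M :: "'a measure" +
  fixes \<F> :: "real \<Rightarrow> 'a measure" and W :: "real \<Rightarrow> 'a \<Rightarrow> real"
  assumes filtration: "filtration_on M \<F>"
    and W_adapted: "0 \<le> t \<Longrightarrow> W t \<in> borel_measurable (\<F> t)"
    and increment_normal: "0 \<le> s \<Longrightarrow> s < t \<Longrightarrow>
      distributed M lborel (\<lambda>\<omega>. W t \<omega> - W s \<omega>) (normal_density 0 (sqrt (t - s)))"
    and increment_indep: "0 \<le> s \<Longrightarrow> s < t \<Longrightarrow> V \<in> borel_measurable (\<F> s) \<Longrightarrow>
      indep_var borel (V :: 'a \<Rightarrow> real) borel (\<lambda>\<omega>. W t \<omega> - W s \<omega>)"
begin

lemma adapted_measurable: "0 \<le> t \<Longrightarrow> V \<in> borel_measurable (\<F> t) \<Longrightarrow> V \<in> borel_measurable M"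
  using filtration measurable_from_subalg unfolding filtration_on_def by blast

lemma adapted_mono: "0 \<le> s \<Longrightarrow> s \<le> t \<Longrightarrow> V \<in> borel_measurable (\<F> s) \<Longrightarrow> V \<in> borel_measurable (\<F> t)"
  using filtration measurable_from_subalg unfolding filtration_on_def by blast

lemma W_measurable: "0 \<le> t \<Longrightarrow> W t \<in> borel_measurable M"
  by (rule adapted_measurable[OF _ W_adapted])

text \<open>Independence factors the expectation. With the Gaussian moment \<open>c\<close> as a
  parameter, one argument serves the powers 1, 2 and 4.\<close>

lemma increment_power_integral:
  assumes st: "0 \<le> s" "s < t"
    and V: "V \<in> borel_measurable (\<F> s)" "integrable M V"
    and c: "has_bochner_integral lborel (\<lambda>x. normal_density 0 (sqrt (t - s)) x * x ^ k) c"
  shows "has_bochner_integral M (\<lambda>\<omega>. V \<omega> * (W t \<omega> - W s \<omega>) ^ k) (expectation V * c)"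
proof -
  let ?D = "\<lambda>\<omega>. W t \<omega> - W s \<omega>"
  have D: "integrable M (\<lambda>\<omega>. ?D \<omega> ^ k)"
    using distributed_integrable[OF increment_normal[OF st], of "\<lambda>x. x ^ k"] c
    by (auto simp: has_bochner_integral_iff)
  have Dc: "expectation (\<lambda>\<omega>. ?D \<omega> ^ k) = c"
    using distributed_integral[OF increment_normal[OF st], of "\<lambda>x. x ^ k"] c
    by (auto simp: has_bochner_integral_iff)
  have "indep_var borel (id \<circ> V) borel ((\<lambda>x. x ^ k) \<circ> ?D)"
    by (intro indep_var_compose[OF increment_indep[OF st V(1)]]) auto
  then have "indep_var borel V borel (\<lambda>\<omega>. ?D \<omega> ^ k)"
    by (simp add: comp_def)
  from indep_var_integrable[OF this V(2) D] indep_var_lebesgue_integral[OF this V(2) D] Dc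
  show ?thesis
    by (simp add: has_bochner_integral_iff)
qed

lemma
  assumes st: "0 \<le> s" "s \<le> t"
    and V: "V \<in> borel_measurable (\<F> s)" "integrable M V"
  shows increment_mean: "has_bochner_integral M (\<lambda>\<omega>. V \<omega> * (W t \<omega> - W s \<omega>)) 0"
    and increment_square: "has_bochner_integral M (\<lambda>\<omega>. V \<omega> * (W t \<omega> - W s \<omega>)\<^sup>2) (expectation V * (t - s))"
    and increment_fourth: "has_bochner_integral M (\<lambda>\<omega>. V \<omega> * (W t \<omega> - W s \<omega>) ^ 4) (expectation V * (3 * (t - s)\<^sup>2))"
proof -
  have "has_bochner_integral M (\<lambda>\<omega>. V \<omega> * (W t \<omega> - W s \<omega>)) 0 \<and>
    has_bochner_integral M (\<lambda>\<omega>. V \<omega> * (W t \<omega> - W s \<omega>)\<^sup>2) (expectation V * (t - s)) \<and>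
    has_bochner_integral M (\<lambda>\<omega>. V \<omega> * (W t \<omega> - W s \<omega>) ^ 4) (expectation V * (3 * (t - s)\<^sup>2))"
  \<comment> \<open>A zero increment has no normal density. The case matters because the clamped
    partitions used later contain empty cells.\<close>
  proof (cases "s = t")
    case True
    then show ?thesis by (simp add: has_bochner_integral_zero)
  next
    case False
    then have lt: "s < t" and pos: "0 < sqrt (t - s)" using st by auto
    have sq: "(sqrt (t - s))\<^sup>2 = t - s" using lt by simp
    have 1: "has_bochner_integral lborel (\<lambda>x. normal_density 0 (sqrt (t - s)) x * x ^ 1) 0"
      using normal_moment_odd[OF pos, of 0 0] by simp
    have 2: "has_bochner_integral lborel (\<lambda>x. normal_density 0 (sqrt (t - s)) x * x ^ 2) (t - s)"
      using normal_moment_even[OF pos, of 0 1] lt unfolding sq by (simp add: diff_divide_distrib)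
    have "fact (2 * 2) / ((2 / (sqrt (t - s))\<^sup>2) ^ 2 * fact 2) = 3 * (t - s)\<^sup>2"
      using lt unfolding sq by (simp add: fact_numeral field_simps power2_eq_square)
    then have 4: "has_bochner_integral lborel (\<lambda>x. normal_density 0 (sqrt (t - s)) x * x ^ 4) (3 * (t - s)\<^sup>2)"
      using normal_moment_even[OF pos, of 0 2] by simp
    show ?thesis
      using increment_power_integral[OF st(1) lt V 1] increment_power_integral[OF st(1) lt V 2]
        increment_power_integral[OF st(1) lt V 4] by simp
  qed
  then show "has_bochner_integral M (\<lambda>\<omega>. V \<omega> * (W t \<omega> - W s \<omega>)) 0"
    "has_bochner_integral M (\<lambda>\<omega>. V \<omega> * (W t \<omega> - W s \<omega>)\<^sup>2) (expectation V * (t - s))"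
    "has_bochner_integral M (\<lambda>\<omega>. V \<omega> * (W t \<omega> - W s \<omega>) ^ 4) (expectation V * (3 * (t - s)\<^sup>2))"
    by auto
qed

text \<open>Martingale argument: at step \<open>k\<close> the mixed term pairs the partial sum times
  \<open>\<zeta> k\<close>, both known at \<open>\<sigma> k\<close>, with a later increment of mean
  zero. The claims are bundled because the induction step for the square uses the measurability and
  the ordering of the times.\<close>

lemma discrete_integral:
  assumes "0 \<le> \<sigma> 0" and "\<And>j. j < k \<Longrightarrow> \<sigma> j \<le> \<sigma> (Suc j)"
    and "\<And>j. j < k \<Longrightarrow> \<zeta> j \<in> borel_measurable (\<F> (\<sigma> j))"
    and "\<And>j. j < k \<Longrightarrow> integrable M (\<lambda>\<omega>. (\<zeta> j \<omega>)\<^sup>2)"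
  defines "S \<equiv> \<lambda>\<omega>. \<Sum>j<k. (W (\<sigma> (Suc j)) \<omega> - W (\<sigma> j) \<omega>) * \<zeta> j \<omega>"
  shows "\<sigma> 0 \<le> \<sigma> k \<and> S \<in> borel_measurable (\<F> (\<sigma> k)) \<and>
    has_bochner_integral M (\<lambda>\<omega>. (S \<omega>)\<^sup>2)
      (\<Sum>j<k. expectation (\<lambda>\<omega>. (\<zeta> j \<omega>)\<^sup>2) * (\<sigma> (Suc j) - \<sigma> j)) \<and>
    (\<forall>Y \<in> borel_measurable (\<F> (\<sigma> 0)). integrable M (\<lambda>\<omega>. (Y \<omega>)\<^sup>2) \<longrightarrow>
      has_bochner_integral M (\<lambda>\<omega>. Y \<omega> * S \<omega>) 0)"
  using assms(2-4) unfolding S_def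
proof (induction k)
  case 0
  then show ?case by (auto simp: has_bochner_integral_zero)
next
  case (Suc k)
  let ?S = "\<lambda>\<omega>. \<Sum>j<k. (W (\<sigma> (Suc j)) \<omega> - W (\<sigma> j) \<omega>) * \<zeta> j \<omega>"
  let ?D = "\<lambda>\<omega>. W (\<sigma> (Suc k)) \<omega> - W (\<sigma> k) \<omega>"
  have IH: "\<sigma> 0 \<le> \<sigma> k" "?S \<in> borel_measurable (\<F> (\<sigma> k))"
    "has_bochner_integral M (\<lambda>\<omega>. (?S \<omega>)\<^sup>2)
      (\<Sum>j<k. expectation (\<lambda>\<omega>. (\<zeta> j \<omega>)\<^sup>2) * (\<sigma> (Suc j) - \<sigma> j))"
    "\<And>Y. Y \<in> borel_measurable (\<F> (\<sigma> 0)) \<Longrightarrow> integrable M (\<lambda>\<omega>. (Y \<omega>)\<^sup>2) \<Longrightarrow>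
      has_bochner_integral M (\<lambda>\<omega>. Y \<omega> * ?S \<omega>) 0"
    using Suc by auto
  have k: "0 \<le> \<sigma> k" "\<sigma> k \<le> \<sigma> (Suc k)" "0 \<le> \<sigma> (Suc k)"
    using IH(1) assms(1) Suc.prems(1)[of k] by auto
  have z: "\<zeta> k \<in> borel_measurable (\<F> (\<sigma> k))" "integrable M (\<lambda>\<omega>. (\<zeta> k \<omega>)\<^sup>2)"
    using Suc.prems by auto
  note meas = adapted_measurable[OF k(1)]
  have W[measurable]: "W (\<sigma> k) \<in> borel_measurable (\<F> (\<sigma> (Suc k)))" "W (\<sigma> (Suc k)) \<in> borel_measurable (\<F> (\<sigma> (Suc k)))"
    using k by (auto intro: W_adapted adapted_mono)
  have ord: "\<sigma> 0 \<le> \<sigma> (Suc k)" using IH k by simp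
  have m: "(\<lambda>\<omega>. \<Sum>j<Suc k. (W (\<sigma> (Suc j)) \<omega> - W (\<sigma> j) \<omega>) * \<zeta> j \<omega>) \<in> borel_measurable (\<F> (\<sigma> (Suc k)))"
  proof -
    have [measurable]: "?S \<in> borel_measurable (\<F> (\<sigma> (Suc k)))" "\<zeta> k \<in> borel_measurable (\<F> (\<sigma> (Suc k)))"
      using adapted_mono[OF k(1,2)] IH(2) z(1) by auto
    have "(\<lambda>\<omega>. ?S \<omega> + ?D \<omega> * \<zeta> k \<omega>) \<in> borel_measurable (\<F> (\<sigma> (Suc k)))"
      by measurable
    then show ?thesis by simp
  qed
  have z2m: "(\<lambda>\<omega>. (\<zeta> k \<omega>)\<^sup>2) \<in> borel_measurable (\<F> (\<sigma> k))"
    using z(1) by measurable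
  note sq = increment_square[OF k(1,2) z2m z(2)]
  have cross: "has_bochner_integral M (\<lambda>\<omega>. (Y \<omega> * \<zeta> k \<omega>) * ?D \<omega>) 0"
    if Y: "Y \<in> borel_measurable (\<F> (\<sigma> k))" "integrable M (\<lambda>\<omega>. (Y \<omega>)\<^sup>2)" for Y
  proof (rule increment_mean[OF k(1,2)])
    show "(\<lambda>\<omega>. Y \<omega> * \<zeta> k \<omega>) \<in> borel_measurable (\<F> (\<sigma> k))"
      using Y z by measurable
    show "integrable M (\<lambda>\<omega>. Y \<omega> * \<zeta> k \<omega>)"
      by (intro integrable_mult_square meas Y z)
  qed
  have S2: "integrable M (\<lambda>\<omega>. (?S \<omega>)\<^sup>2)"
    using IH(3) by (simp add: has_bochner_integral_iff)
  have "has_bochner_integral M (\<lambda>\<omega>. (?S \<omega>)\<^sup>2 + 2 * ((?S \<omega> * \<zeta> k \<omega>) * ?D \<omega>) + (\<zeta> k \<omega>)\<^sup>2 * (?D \<omega>)\<^sup>2)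
    ((\<Sum>j<k. expectation (\<lambda>\<omega>. (\<zeta> j \<omega>)\<^sup>2) * (\<sigma> (Suc j) - \<sigma> j)) + 2 * 0
      + expectation (\<lambda>\<omega>. (\<zeta> k \<omega>)\<^sup>2) * (\<sigma> (Suc k) - \<sigma> k))"
    by (intro has_bochner_integral_add has_bochner_integral_mult_right IH(3) sq cross IH(2) S2)
  also have "(\<lambda>\<omega>. (?S \<omega>)\<^sup>2 + 2 * ((?S \<omega> * \<zeta> k \<omega>) * ?D \<omega>) + (\<zeta> k \<omega>)\<^sup>2 * (?D \<omega>)\<^sup>2) =
    (\<lambda>\<omega>. (?S \<omega> + ?D \<omega> * \<zeta> k \<omega>)\<^sup>2)"
    by (simp add: fun_eq_iff power2_sum power_mult_distrib mult_ac)
  finally have "has_bochner_integral M (\<lambda>\<omega>. (\<Sum>j<Suc k. (W (\<sigma> (Suc j)) \<omega> - W (\<sigma> j) \<omega>) * \<zeta> j \<omega>)\<^sup>2)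
      (\<Sum>j<Suc k. expectation (\<lambda>\<omega>. (\<zeta> j \<omega>)\<^sup>2) * (\<sigma> (Suc j) - \<sigma> j))"
    by simp
  moreover have "has_bochner_integral M (\<lambda>\<omega>. Y \<omega> * (\<Sum>j<Suc k. (W (\<sigma> (Suc j)) \<omega> - W (\<sigma> j) \<omega>) * \<zeta> j \<omega>)) 0"
    if Y: "Y \<in> borel_measurable (\<F> (\<sigma> 0))" "integrable M (\<lambda>\<omega>. (Y \<omega>)\<^sup>2)" for Y
  proof -
    have "Y \<in> borel_measurable (\<F> (\<sigma> k))"
      using adapted_mono[OF assms(1) IH(1) Y(1)] .
    from has_bochner_integral_add[OF IH(4)[OF Y] cross[OF this Y(2)]]
    show ?thesis by (simp add: algebra_simps)
  qed
  ultimately show ?case using ord m by blast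
qed

end

section \<open>Increments of the It\^o integral\<close>

lemma fst_time_space[measurable]: "fst \<in> borel_measurable (time_space M T)"
  unfolding time_space_def
  by (intro measurable_compose[OF measurable_fst] measurable_restrict_space1) simp

lemma snd_time_space[measurable]: "snd \<in> measurable (time_space M T) M"
  unfolding time_space_def by (rule measurable_snd)

text \<open>Stated with nonnegative integrals so that it applies before either side is known to be
  finite.\<close>

lemma nn_integral_power2_add:
  fixes f g :: "'a \<Rightarrow> real"
  assumes [measurable]: "f \<in> borel_measurable M" "g \<in> borel_measurable M"
  shows "(\<integral>\<^sup>+x. ennreal ((f x + g x)\<^sup>2) \<partial>M) \<le>
    2 * (\<integral>\<^sup>+x. ennreal ((f x)\<^sup>2) \<partial>M) + 2 * (\<integral>\<^sup>+x. ennreal ((g x)\<^sup>2) \<partial>M)"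
proof -
  have "(\<integral>\<^sup>+x. ennreal ((f x + g x)\<^sup>2) \<partial>M) \<le> (\<integral>\<^sup>+x. 2 * ennreal ((f x)\<^sup>2) + 2 * ennreal ((g x)\<^sup>2) \<partial>M)"
  proof (rule nn_integral_mono)
    fix x
    have "ennreal ((f x + g x)\<^sup>2) \<le> ennreal (2 * (f x)\<^sup>2 + 2 * (g x)\<^sup>2)"
      by (intro ennreal_leI power2_add_le)
    also have "\<dots> = 2 * ennreal ((f x)\<^sup>2) + 2 * ennreal ((g x)\<^sup>2)"
      by (simp add: ennreal_plus ennreal_mult)
    finally show "ennreal ((f x + g x)\<^sup>2) \<le> 2 * ennreal ((f x)\<^sup>2) + 2 * ennreal ((g x)\<^sup>2)" .
  qed
  also have "\<dots> = 2 * (\<integral>\<^sup>+x. ennreal ((f x)\<^sup>2) \<partial>M) + 2 * (\<integral>\<^sup>+x. ennreal ((g x)\<^sup>2) \<partial>M)"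
    by (subst nn_integral_add) (auto simp: nn_integral_cmult)
  finally show ?thesis .
qed

lemma integrable_power2_iff:
  fixes f :: "'a \<Rightarrow> real"
  assumes [measurable]: "f \<in> borel_measurable M"
  shows "integrable M (\<lambda>x. (f x)\<^sup>2) \<longleftrightarrow> (\<integral>\<^sup>+x. ennreal ((f x)\<^sup>2) \<partial>M) < \<infinity>"
  by (subst integrable_iff_bounded) auto

lemma simple_integrand_mono:
  assumes "simple_integrand M \<F> T k \<tau> \<xi>" "i \<le> j" "j \<le> k"
  shows "\<tau> i \<le> \<tau> j"
  using assms(2,3)
proof (induction j rule: dec_induct)
  case base
  then show ?case by simp
next
  case (step n)
  then show ?case using assms(1) unfolding simple_integrand_def
    by (meson Suc_le_lessD Suc_leD less_eq_real_def order_trans)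
qed

lemma simple_process_eq:
  assumes si: "simple_integrand M \<F> T k \<tau> \<xi>" and j: "j < k" and r: "\<tau> j \<le> r" "r < \<tau> (Suc j)"
  shows "simple_process k \<tau> \<xi> r \<omega> = \<xi> j \<omega>"
proof -
  have "indicator {\<tau> i..<\<tau> (Suc i)} r *\<^sub>R \<xi> i \<omega> = (if i = j then \<xi> j \<omega> else 0)" if i: "i < k" for i
  proof (cases i j rule: linorder_cases)
    case less
    then show ?thesis using simple_integrand_mono[OF si, of "Suc i" j] j r by (auto simp: indicator_def)
  next
    case equal
    then show ?thesis using r by auto
  next
    case greater
    then show ?thesis using simple_integrand_mono[OF si, of "Suc j" i] i r by (auto simp: indicator_def)
  qed
  then have "simple_process k \<tau> \<xi> r \<omega> = (\<Sum>i<k. if i = j then \<xi> j \<omega> else 0)"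
    unfolding simple_process_def by (intro sum.cong) auto
  then show ?thesis using j by simp
qed

text \<open>The right-hand side is one summand of the isometry, cell length times second moment.
  Read as an integral over \<open>time_space\<close>, the sum over cells becomes a single integral
  that can pass to the limit.\<close>

lemma (in prob_space) nn_integral_time_space_product:
  assumes [measurable]: "g \<in> borel_measurable M" and "0 \<le> a" "a \<le> b" "b \<le> T"
  shows "(\<integral>\<^sup>+z. indicator {a..<b} (fst z) * g (snd z) \<partial>time_space M T) =
    ennreal (b - a) * (\<integral>\<^sup>+\<omega>. g \<omega> \<partial>M)"
proof -
  let ?R = "restrict_space lborel {0..T} :: real measure"
  have [measurable]: "{a..<b} \<in> sets ?R"
    using assms by (subst sets_restrict_space_iff) auto
  have "(\<integral>\<^sup>+z. indicator {a..<b} (fst z) * g (snd z) \<partial>time_space M T) =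
      (\<integral>\<^sup>+r. \<integral>\<^sup>+\<omega>. indicator {a..<b} r * g \<omega> \<partial>M \<partial>?R)"
  proof -
    have "(\<lambda>z. indicator {a..<b} (fst z) * g (snd z)) \<in> borel_measurable (time_space M T)"
      by measurable
    then show ?thesis
      unfolding time_space_def by (subst nn_integral_fst[symmetric]) simp_all
  qed
  also have "\<dots> = (\<integral>\<^sup>+r. (\<integral>\<^sup>+\<omega>. g \<omega> \<partial>M) * indicator {a..<b} r \<partial>?R)"
    by (intro nn_integral_cong, simp only: nn_integral_cmult[OF assms(1)], simp only: mult.commute)
  also have "\<dots> = (\<integral>\<^sup>+\<omega>. g \<omega> \<partial>M) * emeasure ?R {a..<b}"
    by (rule nn_integral_cmult_indicator) simp
  also have "emeasure ?R {a..<b} = ennreal (b - a)"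
    using assms by (subst emeasure_restrict_space) auto
  finally show ?thesis by (simp add: mult.commute)
qed

context scalar_brownian
begin

text \<open>\<open>Y\<close> is a frozen value of the integrand, so \<open>J\<close> is the integral
  over \<open>[s, t]\<close> of the simple process minus \<open>Y\<close>; isometry and
  orthogonality then come from \<open>discrete_integral\<close>. The last claim is an inequality
  because the half-open cells miss the endpoint \<open>t\<close>, which spares a discussion of null
  sets.\<close>

lemma simple_integral_increment:
  fixes \<xi> :: "nat \<Rightarrow> 'a \<Rightarrow> real"
  assumes si: "simple_integrand M \<F> T k \<tau> \<xi>" and st: "0 \<le> s" "s \<le> t" "t \<le> T"
    and Y: "Y \<in> borel_measurable (\<F> s)" "integrable M (\<lambda>\<omega>. (Y \<omega>)\<^sup>2)"
  defines "J \<equiv> \<lambda>\<omega>. Defs.simple_integral k \<tau> \<xi> W t \<omega> - Defs.simple_integral k \<tau> \<xi> W s \<omega> - Y \<omega> * (W t \<omega> - W s \<omega>)"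
  shows "J \<in> borel_measurable M"
    and "integrable M (\<lambda>\<omega>. (J \<omega>)\<^sup>2)"
    and "\<And>V. V \<in> borel_measurable (\<F> s) \<Longrightarrow> integrable M (\<lambda>\<omega>. (V \<omega>)\<^sup>2) \<Longrightarrow>
      has_bochner_integral M (\<lambda>\<omega>. V \<omega> * J \<omega>) 0"
    and "(\<integral>\<^sup>+\<omega>. ennreal ((J \<omega>)\<^sup>2) \<partial>M) \<le>
      (\<integral>\<^sup>+(r, \<omega>). indicator {s..t} r * ennreal ((simple_process k \<tau> \<xi> r \<omega> - Y \<omega>)\<^sup>2) \<partial>time_space M T)"
proof -
  \<comment> \<open>Clamping the partition to \<open>[s, t]\<close> makes the increment a single discrete integral. Cells that
    become empty get coefficient \<open>0\<close>, because their \<open>\<xi> j\<close> may not be known at the clamped time.\<close>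
  define c where "c r = max s (min t r)" for r
  define \<zeta> where "\<zeta> j = (\<lambda>\<omega>. if c (\<tau> j) < c (\<tau> (Suc j)) then \<xi> j \<omega> - Y \<omega> else 0)" for j
  have \<tau>: "\<tau> 0 = 0" "\<tau> k = T" "\<And>j. j < k \<Longrightarrow> \<tau> j < \<tau> (Suc j)"
    "\<And>j. j < k \<Longrightarrow> \<xi> j \<in> borel_measurable (\<F> (\<tau> j))"
    "\<And>j. j < k \<Longrightarrow> integrable M (\<lambda>\<omega>. (\<xi> j \<omega>)\<^sup>2)"
    using si unfolding simple_integrand_def by auto
  have \<tau>0: "0 \<le> \<tau> j" if "j \<le> k" for j
    using simple_integrand_mono[OF si, of 0 j] that \<tau>(1) by simp
  have c0: "c (\<tau> 0) = s" "c (\<tau> k) = t" using \<tau>(1,2) st by (auto simp: c_def)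
  have c_mono: "c (\<tau> j) \<le> c (\<tau> (Suc j))" if "j < k" for j
    using \<tau>(3)[OF that] by (auto simp: c_def)
  have c_pos: "0 \<le> c r" "s \<le> c r" "c r \<le> t" for r using st by (auto simp: c_def)
  have J_eq: "J = (\<lambda>\<omega>. \<Sum>j<k. (W (c (\<tau> (Suc j))) \<omega> - W (c (\<tau> j)) \<omega>) * \<zeta> j \<omega>)"
  proof
    fix \<omega>
    have 1: "(W (min t (\<tau> (Suc j))) \<omega> - W (min t (\<tau> j)) \<omega>) - (W (min s (\<tau> (Suc j))) \<omega> - W (min s (\<tau> j)) \<omega>)
      = W (c (\<tau> (Suc j))) \<omega> - W (c (\<tau> j)) \<omega>" if "j < k" for j
      using \<tau>(3)[OF that] st unfolding c_def
      by (auto simp: min_def max_def)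
    have "(\<Sum>j<k. (W (c (\<tau> (Suc j))) \<omega> - W (c (\<tau> j)) \<omega>) * Y \<omega>) = Y \<omega> * (W t \<omega> - W s \<omega>)"
      unfolding sum_distrib_right[symmetric]
      using sum_lessThan_telescope[of "\<lambda>j. W (c (\<tau> j)) \<omega>" k] c0 by simp
    moreover have "Defs.simple_integral k \<tau> \<xi> W t \<omega> - Defs.simple_integral k \<tau> \<xi> W s \<omega>
      = (\<Sum>j<k. (W (c (\<tau> (Suc j))) \<omega> - W (c (\<tau> j)) \<omega>) * \<xi> j \<omega>)"
      unfolding simple_integral_def sum_subtractf[symmetric]
      by (intro sum.cong) (auto simp: 1[symmetric] algebra_simps)
    ultimately have "J \<omega> = (\<Sum>j<k. (W (c (\<tau> (Suc j))) \<omega> - W (c (\<tau> j)) \<omega>) * (\<xi> j \<omega> - Y \<omega>))"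
      unfolding J_def by (simp add: sum_subtractf right_diff_distrib)
    \<comment> \<open>On an empty cell both clamped times agree, so the increment of
      \<open>W\<close> vanishes and its coefficient is immaterial.\<close>
    also have "\<dots> = (\<Sum>j<k. (W (c (\<tau> (Suc j))) \<omega> - W (c (\<tau> j)) \<omega>) * \<zeta> j \<omega>)"
      using c_mono by (intro sum.cong) (auto simp: \<zeta>_def less_le)
    finally show "J \<omega> = (\<Sum>j<k. (W (c (\<tau> (Suc j))) \<omega> - W (c (\<tau> j)) \<omega>) * \<zeta> j \<omega>)" .
  qed
  note adm = adapted_measurable
  have \<xi>m: "\<xi> j \<in> borel_measurable M" if "j < k" for j
    using \<tau>(4)[OF that] \<tau>0[of j] that by (auto intro: adm)
  have Ym: "Y \<in> borel_measurable M" using Y st adm by blast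
  have \<zeta>_meas: "\<zeta> j \<in> borel_measurable (\<F> (c (\<tau> j)))" if j: "j < k" for j
  proof (cases "c (\<tau> j) < c (\<tau> (Suc j))")
    case True
    then have "\<tau> j \<le> c (\<tau> j)" using st by (auto simp: c_def)
    then have [measurable]: "\<xi> j \<in> borel_measurable (\<F> (c (\<tau> j)))"
      using \<tau>(4)[OF j] \<tau>0[of j] j by (auto intro: adapted_mono)
    have [measurable]: "Y \<in> borel_measurable (\<F> (c (\<tau> j)))"
      using Y(1) st c_pos by (auto intro: adapted_mono)
    show ?thesis unfolding \<zeta>_def using True by simp
  qed (simp add: \<zeta>_def)
  have \<zeta>_sq: "integrable M (\<lambda>\<omega>. (\<zeta> j \<omega>)\<^sup>2)" if j: "j < k" for j
    using integrable_power2_diff[OF \<xi>m[OF j] Ym \<tau>(5)[OF j] Y(2)]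
    unfolding \<zeta>_def by (cases "c (\<tau> j) < c (\<tau> (Suc j))") simp_all
  have \<zeta>m: "\<zeta> j \<in> borel_measurable M" if "j < k" for j
    using adm[OF c_pos(1) \<zeta>_meas[OF that]] .
  have "c (\<tau> 0) \<le> c (\<tau> k) \<and> J \<in> borel_measurable (\<F> (c (\<tau> k))) \<and>
    has_bochner_integral M (\<lambda>\<omega>. (J \<omega>)\<^sup>2)
      (\<Sum>j<k. expectation (\<lambda>\<omega>. (\<zeta> j \<omega>)\<^sup>2) * (c (\<tau> (Suc j)) - c (\<tau> j))) \<and>
    (\<forall>Y \<in> borel_measurable (\<F> (c (\<tau> 0))). integrable M (\<lambda>\<omega>. (Y \<omega>)\<^sup>2) \<longrightarrow>
      has_bochner_integral M (\<lambda>\<omega>. Y \<omega> * J \<omega>) 0)"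
    unfolding J_eq
    by (rule discrete_integral[where \<sigma> = "\<lambda>j. c (\<tau> j)" and \<zeta> = \<zeta>])
      (auto simp: c_pos c_mono \<zeta>_meas \<zeta>_sq)
  then have J: "J \<in> borel_measurable (\<F> t)"
    "has_bochner_integral M (\<lambda>\<omega>. (J \<omega>)\<^sup>2)
      (\<Sum>j<k. expectation (\<lambda>\<omega>. (\<zeta> j \<omega>)\<^sup>2) * (c (\<tau> (Suc j)) - c (\<tau> j)))"
    "\<And>Y. Y \<in> borel_measurable (\<F> s) \<Longrightarrow> integrable M (\<lambda>\<omega>. (Y \<omega>)\<^sup>2) \<Longrightarrow>
      has_bochner_integral M (\<lambda>\<omega>. Y \<omega> * J \<omega>) 0"
    by (auto simp: c0)
  show Jm: "J \<in> borel_measurable M" using adm[OF order_trans[OF st(1,2)] J(1)] .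
  show J2: "integrable M (\<lambda>\<omega>. (J \<omega>)\<^sup>2)" using J(2) by (simp add: has_bochner_integral_iff)
  show "has_bochner_integral M (\<lambda>\<omega>. V \<omega> * J \<omega>) 0"
    if "V \<in> borel_measurable (\<F> s)" "integrable M (\<lambda>\<omega>. (V \<omega>)\<^sup>2)" for V
    using J(3) that .
  \<comment> \<open>Clamped cells are disjoint, so at a given \<open>r\<close> at most one summand
    is nonzero. There \<open>r\<close> lies in the original cell as well, where the simple process
    equals \<open>\<xi> j\<close>.\<close>
  have pointwise: "(\<Sum>j<k. indicator {c (\<tau> j)..<c (\<tau> (Suc j))} r * ennreal ((\<zeta> j \<omega>)\<^sup>2)) \<le>
    indicator {s..t} r * ennreal ((simple_process k \<tau> \<xi> r \<omega> - Y \<omega>)\<^sup>2)" for r \<omega>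
  proof (cases "\<exists>j<k. c (\<tau> j) \<le> r \<and> r < c (\<tau> (Suc j))")
    case True
    then obtain j where j: "j < k" "c (\<tau> j) \<le> r" "r < c (\<tau> (Suc j))" by blast
    have in_\<tau>: "\<tau> i \<le> r \<and> r < \<tau> (Suc i)" if "c (\<tau> i) \<le> r" "r < c (\<tau> (Suc i))" for i
      using that st by (auto simp: c_def)
    have r: "\<tau> j \<le> r" "r < \<tau> (Suc j)" "r \<in> {s..t}"
      using in_\<tau>[OF j(2,3)] order.trans[OF c_pos(2) j(2)] order.strict_trans2[OF j(3) c_pos(3)] by auto
    have uniq: "i = j" if i: "i < k" "c (\<tau> i) \<le> r" "r < c (\<tau> (Suc i))" for i
    proof (rule linorder_cases[of i j])
      assume "i < j"
      then show ?thesis using simple_integrand_mono[OF si, of "Suc i" j] j(1) r in_\<tau>[OF i(2,3)] by auto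
    next
      assume "j < i"
      then show ?thesis using simple_integrand_mono[OF si, of "Suc j" i] i(1) r in_\<tau>[OF i(2,3)] by auto
    qed
    have "(\<Sum>i<k. indicator {c (\<tau> i)..<c (\<tau> (Suc i))} r * ennreal ((\<zeta> i \<omega>)\<^sup>2)) =
      (\<Sum>i<k. if i = j then ennreal ((\<zeta> j \<omega>)\<^sup>2) else 0)"
    proof (rule sum.cong[OF refl])
      fix i assume "i \<in> {..<k}"
      then have "i \<noteq> j \<Longrightarrow> \<not> (c (\<tau> i) \<le> r \<and> r < c (\<tau> (Suc i)))"
        using uniq by blast
      then show "indicator {c (\<tau> i)..<c (\<tau> (Suc i))} r * ennreal ((\<zeta> i \<omega>)\<^sup>2) =
          (if i = j then ennreal ((\<zeta> j \<omega>)\<^sup>2) else 0)"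
        using j by (cases "i = j") (simp_all add: indicator_def)
    qed
    also have "\<dots> = ennreal ((\<zeta> j \<omega>)\<^sup>2)" using j(1) by simp
    also have "\<dots> = indicator {s..t} r * ennreal ((simple_process k \<tau> \<xi> r \<omega> - Y \<omega>)\<^sup>2)"
      using simple_process_eq[OF si j(1) r(1,2)] r(3) j by (auto simp: \<zeta>_def)
    finally show ?thesis by simp
  next
    case False
    then have "(\<Sum>j<k. indicator {c (\<tau> j)..<c (\<tau> (Suc j))} r * ennreal ((\<zeta> j \<omega>)\<^sup>2)) = 0"
      by (intro sum.neutral) (auto simp: indicator_def)
    then show ?thesis by simp
  qed
  have "(\<integral>\<^sup>+\<omega>. ennreal ((J \<omega>)\<^sup>2) \<partial>M) =
    ennreal (\<Sum>j<k. expectation (\<lambda>\<omega>. (\<zeta> j \<omega>)\<^sup>2) * (c (\<tau> (Suc j)) - c (\<tau> j)))"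
    using J(2) by (subst nn_integral_eq_integral) (auto simp: has_bochner_integral_iff)
  also have "\<dots> = (\<Sum>j<k. ennreal (c (\<tau> (Suc j)) - c (\<tau> j)) * ennreal (expectation (\<lambda>\<omega>. (\<zeta> j \<omega>)\<^sup>2)))"
    using c_mono by (subst sum_ennreal[symmetric])
      (auto intro!: sum.cong simp: mult.commute ennreal_mult')
  also have "\<dots> = (\<Sum>j<k. \<integral>\<^sup>+z. indicator {c (\<tau> j)..<c (\<tau> (Suc j))} (fst z) * ennreal ((\<zeta> j (snd z))\<^sup>2) \<partial>time_space M T)"
  proof (rule sum.cong[OF refl])
    fix j assume "j \<in> {..<k}"
    then have j: "j < k" by simp
    have "ennreal (expectation (\<lambda>\<omega>. (\<zeta> j \<omega>)\<^sup>2)) = (\<integral>\<^sup>+\<omega>. ennreal ((\<zeta> j \<omega>)\<^sup>2) \<partial>M)"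
      using \<zeta>_sq[OF j] by (subst nn_integral_eq_integral) auto
    moreover have "(\<lambda>\<omega>. ennreal ((\<zeta> j \<omega>)\<^sup>2)) \<in> borel_measurable M"
      using \<zeta>m[OF j] by measurable
    ultimately show "ennreal (c (\<tau> (Suc j)) - c (\<tau> j)) * ennreal (expectation (\<lambda>\<omega>. (\<zeta> j \<omega>)\<^sup>2)) =
      (\<integral>\<^sup>+z. indicator {c (\<tau> j)..<c (\<tau> (Suc j))} (fst z) * ennreal ((\<zeta> j (snd z))\<^sup>2) \<partial>time_space M T)"
      using c_mono[OF j] c_pos order_trans[OF c_pos(3) st(3)]
      by (subst nn_integral_time_space_product) auto
  qed
  also have "\<dots> = (\<integral>\<^sup>+z. (\<Sum>j<k. indicator {c (\<tau> j)..<c (\<tau> (Suc j))} (fst z) * ennreal ((\<zeta> j (snd z))\<^sup>2)) \<partial>time_space M T)"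
  proof (rule nn_integral_sum[symmetric])
    fix j assume "j \<in> {..<k}"
    then have [measurable]: "\<zeta> j \<in> borel_measurable M" using \<zeta>m by simp
    show "(\<lambda>z. indicator {c (\<tau> j)..<c (\<tau> (Suc j))} (fst z) * ennreal ((\<zeta> j (snd z))\<^sup>2)) \<in> borel_measurable (time_space M T)"
      by measurable
  qed
  also have "\<dots> \<le> (\<integral>\<^sup>+(r, \<omega>). indicator {s..t} r * ennreal ((simple_process k \<tau> \<xi> r \<omega> - Y \<omega>)\<^sup>2) \<partial>time_space M T)"
    unfolding case_prod_beta by (intro nn_integral_mono pointwise)
  finally show "(\<integral>\<^sup>+\<omega>. ennreal ((J \<omega>)\<^sup>2) \<partial>M) \<le>
      (\<integral>\<^sup>+(r, \<omega>). indicator {s..t} r * ennreal ((simple_process k \<tau> \<xi> r \<omega> - Y \<omega>)\<^sup>2) \<partial>time_space M T)" .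
qed

end

section \<open>Passage from simple integrals to the mean square limit\<close>

lemma ennreal_tendsto_cmult_0:
  fixes f :: "nat \<Rightarrow> ennreal"
  assumes "f \<longlonglongrightarrow> 0" "c < top"
  shows "(\<lambda>p. c * f p) \<longlonglongrightarrow> 0"
  using ennreal_tendsto_cmult[OF assms(2,1)] by simp

lemma measurable_adapted_time_space:
  "measurable_adapted M \<F> T X \<Longrightarrow> (\<lambda>z. X (fst z) (snd z)) \<in> borel_measurable (time_space M T)"
  by (simp add: measurable_adapted_def split_beta')

context scalar_brownian
begin

lemma has_ito_integral_measurable:
  assumes "has_ito_integral M \<F> T W H I"
  shows "(\<lambda>z. H (fst z) (snd z)) \<in> borel_measurable (time_space M T)"
    and "0 \<le> t \<Longrightarrow> t \<le> T \<Longrightarrow> I t \<in> borel_measurable M"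
  using assms unfolding has_ito_integral_def square_integrable_process_def
  by (auto intro: measurable_adapted_time_space)

text \<open>\<open>D p\<close> collects the approximation errors at the two times \<open>s\<close>
  and \<open>t\<close>. A property of simple integrals reaches \<open>I\<close> through an exact
  identity plus an error that tends to 0 in mean square.\<close>

lemma ito_integral_approx:
  fixes H I :: "real \<Rightarrow> 'a \<Rightarrow> real"
  assumes I: "has_ito_integral M \<F> T W H I" and st: "0 \<le> s" "s \<le> t" "t \<le> T"
  obtains k \<tau> \<xi> D where "\<And>p::nat. simple_integrand M \<F> T (k p) (\<tau> p) (\<xi> p)"
    and "\<And>p. (\<lambda>z. simple_process (k p) (\<tau> p) (\<xi> p) (fst z) (snd z)) \<in> borel_measurable (time_space M T)"
    and "(\<lambda>p. \<integral>\<^sup>+z. ennreal ((H (fst z) (snd z) - simple_process (k p) (\<tau> p) (\<xi> p) (fst z) (snd z))\<^sup>2)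
               \<partial>time_space M T) \<longlonglongrightarrow> 0"
    and "\<And>p. D p \<in> borel_measurable M"
    and "(\<lambda>p. \<integral>\<^sup>+\<omega>. ennreal ((D p \<omega>)\<^sup>2) \<partial>M) \<longlonglongrightarrow> 0"
    and "\<And>p \<omega>. I t \<omega> - I s \<omega> = D p \<omega> +
      (Defs.simple_integral (k p) (\<tau> p) (\<xi> p) W t \<omega> - Defs.simple_integral (k p) (\<tau> p) (\<xi> p) W s \<omega>)"
proof -
  from I[unfolded has_ito_integral_def]
  obtain k \<tau> \<xi> where si: "\<And>p::nat. simple_integrand M \<F> T (k p) (\<tau> p) (\<xi> p)"
    and H: "(\<lambda>p. \<integral>\<^sup>+(t, \<omega>). ennreal ((norm (H t \<omega> - simple_process (k p) (\<tau> p) (\<xi> p) t \<omega>))\<^sup>2)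
               \<partial>time_space M T) \<longlonglongrightarrow> 0"
    and It: "\<And>t. t \<in> {0..T} \<Longrightarrow> (\<lambda>p. \<integral>\<^sup>+\<omega>. ennreal ((norm (I t \<omega> - Defs.simple_integral (k p) (\<tau> p) (\<xi> p) W t \<omega>))\<^sup>2)
                  \<partial>M) \<longlonglongrightarrow> 0"
    by blast
  have \<xi>m: "\<xi> p j \<in> borel_measurable M" if "j < k p" for p j
  proof (rule adapted_measurable)
    show "\<xi> p j \<in> borel_measurable (\<F> (\<tau> p j))"
      using si[of p] that unfolding simple_integrand_def by auto
    show "0 \<le> \<tau> p j"
      using simple_integrand_mono[OF si[of p], of 0 j] si[of p] that unfolding simple_integrand_def by auto
  qed
  have spm: "(\<lambda>z. simple_process (k p) (\<tau> p) (\<xi> p) (fst z) (snd z)) \<in> borel_measurable (time_space M T)" for p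
    unfolding simple_process_def
  proof (rule borel_measurable_sum)
    fix j assume "j \<in> {..<k p}"
    then have [measurable]: "\<xi> p j \<in> borel_measurable M" using \<xi>m by simp
    show "(\<lambda>z. indicator {\<tau> p j..<\<tau> p (Suc j)} (fst z) *\<^sub>R \<xi> p j (snd z)) \<in> borel_measurable (time_space M T)"
      by measurable
  qed
  let ?S = "\<lambda>p. Defs.simple_integral (k p) (\<tau> p) (\<xi> p) W"
  have Sm: "?S p r \<in> borel_measurable M" if r: "0 \<le> r" for p r
    unfolding simple_integral_def[abs_def]
  proof (rule borel_measurable_sum)
    fix j assume j: "j \<in> {..<k p}"
    then have [measurable]: "\<xi> p j \<in> borel_measurable M" using \<xi>m by simp
    have "0 \<le> \<tau> p j" "0 \<le> \<tau> p (Suc j)"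
      using simple_integrand_mono[OF si[of p], of 0 j] simple_integrand_mono[OF si[of p], of 0 "Suc j"]
        si[of p] j unfolding simple_integrand_def by auto
    with r have [measurable]: "W (min r (\<tau> p j)) \<in> borel_measurable M" "W (min r (\<tau> p (Suc j))) \<in> borel_measurable M"
      by (auto intro!: W_measurable)
    show "(\<lambda>\<omega>. (W (min r (\<tau> p (Suc j))) \<omega> - W (min r (\<tau> p j)) \<omega>) *\<^sub>R \<xi> p j \<omega>) \<in> borel_measurable M"
      by measurable
  qed
  have Im: "I r \<in> borel_measurable M" if "0 \<le> r" "r \<le> T" for r
    using has_ito_integral_measurable(2)[OF I that] .
  define D where "D p \<omega> = (I t \<omega> - ?S p t \<omega>) - (I s \<omega> - ?S p s \<omega>)" for p \<omega>
  have st': "0 \<le> t" "s \<le> T" using st by auto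
  have Dm: "D p \<in> borel_measurable M" for p
    unfolding D_def[abs_def] using Sm[OF st(1)] Sm[OF st'(1)] Im[OF st(1) st'(2)] Im[OF st'(1) st(3)] by measurable
  let ?u = "\<lambda>p. 2 * (\<integral>\<^sup>+\<omega>. ennreal ((norm (I t \<omega> - ?S p t \<omega>))\<^sup>2) \<partial>M) + 2 * (\<integral>\<^sup>+\<omega>. ennreal ((norm (I s \<omega> - ?S p s \<omega>))\<^sup>2) \<partial>M)"
  have D0: "(\<lambda>p. \<integral>\<^sup>+\<omega>. ennreal ((D p \<omega>)\<^sup>2) \<partial>M) \<longlonglongrightarrow> 0"
  proof (rule tendsto_sandwich[where f = "\<lambda>_. 0" and h = ?u])
    show "\<forall>\<^sub>F p in sequentially. (\<integral>\<^sup>+\<omega>. ennreal ((D p \<omega>)\<^sup>2) \<partial>M) \<le> ?u p"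
    proof (rule always_eventually, rule allI)
      fix p
      have eq: "D p \<omega> = (I t \<omega> - ?S p t \<omega>) + (?S p s \<omega> - I s \<omega>)"
        "(norm (I s \<omega> - ?S p s \<omega>))\<^sup>2 = (?S p s \<omega> - I s \<omega>)\<^sup>2"
        "(norm (I t \<omega> - ?S p t \<omega>))\<^sup>2 = (I t \<omega> - ?S p t \<omega>)\<^sup>2" for \<omega>
        by (auto simp: D_def power2_commute)
      have "(\<lambda>\<omega>. I t \<omega> - ?S p t \<omega>) \<in> borel_measurable M" "(\<lambda>\<omega>. ?S p s \<omega> - I s \<omega>) \<in> borel_measurable M"
        using Sm[OF st(1)] Sm[OF st'(1)] Im[OF st(1) st'(2)] Im[OF st'(1) st(3)] by measurable
      from nn_integral_power2_add[OF this]
      show "(\<integral>\<^sup>+\<omega>. ennreal ((D p \<omega>)\<^sup>2) \<partial>M) \<le> ?u p"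
        unfolding eq .
    qed
    have "(\<lambda>p. ?u p) \<longlonglongrightarrow> 0 + 0"
      using st by (intro tendsto_add ennreal_tendsto_cmult_0 It) auto
    then show "?u \<longlonglongrightarrow> 0" by simp
  qed auto
  show ?thesis
    by (rule that[of k \<tau> \<xi> D]) (use si spm H Dm D0 in \<open>auto simp: D_def split_beta'\<close>)
qed

text \<open>
  The isometry holds with constant \<open>1\<close>; the factor \<open>4\<close> comes from passing to the limit with
  \<open>(a + b)\<^sup>2 \<le> 2 a\<^sup>2 + 2 b\<^sup>2\<close> twice, and is good enough here.
\<close>

lemma ito_integral_increment_bound:
  fixes H I :: "real \<Rightarrow> 'a \<Rightarrow> real"
  assumes I: "has_ito_integral M \<F> T W H I" and st: "0 \<le> s" "s \<le> t" "t \<le> T"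
    and Y: "Y \<in> borel_measurable (\<F> s)" "integrable M (\<lambda>\<omega>. (Y \<omega>)\<^sup>2)"
  shows "(\<integral>\<^sup>+\<omega>. ennreal ((I t \<omega> - I s \<omega> - Y \<omega> * (W t \<omega> - W s \<omega>))\<^sup>2) \<partial>M) \<le>
    4 * (\<integral>\<^sup>+z. indicator {s..t} (fst z) * ennreal ((H (fst z) (snd z) - Y (snd z))\<^sup>2) \<partial>time_space M T)"
    (is "?L \<le> 4 * ?R")
proof -
  obtain k \<tau> \<xi> D where si: "\<And>p::nat. simple_integrand M \<F> T (k p) (\<tau> p) (\<xi> p)"
    and spm[measurable]: "\<And>p. (\<lambda>z. simple_process (k p) (\<tau> p) (\<xi> p) (fst z) (snd z)) \<in> borel_measurable (time_space M T)"
    and H: "(\<lambda>p. \<integral>\<^sup>+z. ennreal ((H (fst z) (snd z) - simple_process (k p) (\<tau> p) (\<xi> p) (fst z) (snd z))\<^sup>2)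
               \<partial>time_space M T) \<longlonglongrightarrow> 0"
    and D[measurable]: "\<And>p. D p \<in> borel_measurable M"
    and D0: "(\<lambda>p. \<integral>\<^sup>+\<omega>. ennreal ((D p \<omega>)\<^sup>2) \<partial>M) \<longlonglongrightarrow> 0"
    and Deq: "\<And>p \<omega>. I t \<omega> - I s \<omega> = D p \<omega> +
      (Defs.simple_integral (k p) (\<tau> p) (\<xi> p) W t \<omega> - Defs.simple_integral (k p) (\<tau> p) (\<xi> p) W s \<omega>)"
    by (rule ito_integral_approx[OF I st]) blast
  let ?S = "\<lambda>p z. simple_process (k p) (\<tau> p) (\<xi> p) (fst z) (snd z)"
  let ?e = "\<lambda>p. \<integral>\<^sup>+z. ennreal ((H (fst z) (snd z) - ?S p z)\<^sup>2) \<partial>time_space M T"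
  let ?d = "\<lambda>p. \<integral>\<^sup>+\<omega>. ennreal ((D p \<omega>)\<^sup>2) \<partial>M"
  have [measurable]: "(\<lambda>z. H (fst z) (snd z)) \<in> borel_measurable (time_space M T)"
    using has_ito_integral_measurable(1)[OF I] .
  have [measurable]: "Y \<in> borel_measurable M" using Y st adapted_measurable by blast
  have bound: "?L \<le> 2 * ?d p + (4 * ?e p + 4 * ?R)" for p
  proof -
    define J where "J \<omega> = Defs.simple_integral (k p) (\<tau> p) (\<xi> p) W t \<omega> - Defs.simple_integral (k p) (\<tau> p) (\<xi> p) W s \<omega>
      - Y \<omega> * (W t \<omega> - W s \<omega>)" for \<omega>
    note J = simple_integral_increment[OF si[of p] st Y, folded J_def]
    have [measurable]: "J \<in> borel_measurable M" using J(1) .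
    have "?L = (\<integral>\<^sup>+\<omega>. ennreal ((D p \<omega> + J \<omega>)\<^sup>2) \<partial>M)"
      by (simp add: Deq[of _ p] J_def algebra_simps)
    also have "\<dots> \<le> 2 * ?d p + 2 * (\<integral>\<^sup>+\<omega>. ennreal ((J \<omega>)\<^sup>2) \<partial>M)"
      by (rule nn_integral_power2_add) measurable
    also have "(\<integral>\<^sup>+\<omega>. ennreal ((J \<omega>)\<^sup>2) \<partial>M) \<le>
      (\<integral>\<^sup>+z. indicator {s..t} (fst z) * ennreal ((?S p z - Y (snd z))\<^sup>2) \<partial>time_space M T)"
      using J(4) by (simp add: split_beta')
    \<comment> \<open>The integrand \<open>H\<close> is inserted between the simple process and
      \<open>Y\<close>; the two differences become \<open>?e p\<close> and
      \<open>?R\<close>.\<close>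
    also have "\<dots> = (\<integral>\<^sup>+z. ennreal ((indicator {s..t} (fst z) * (?S p z - H (fst z) (snd z)) +
        indicator {s..t} (fst z) * (H (fst z) (snd z) - Y (snd z)))\<^sup>2) \<partial>time_space M T)"
      by (intro nn_integral_cong) (auto simp: indicator_def)
    also have "\<dots> \<le> 2 * (\<integral>\<^sup>+z. ennreal ((indicator {s..t} (fst z) * (?S p z - H (fst z) (snd z)))\<^sup>2) \<partial>time_space M T)
      + 2 * (\<integral>\<^sup>+z. ennreal ((indicator {s..t} (fst z) * (H (fst z) (snd z) - Y (snd z)))\<^sup>2) \<partial>time_space M T)"
      by (rule nn_integral_power2_add) measurable
    also have "(\<integral>\<^sup>+z. ennreal ((indicator {s..t} (fst z) * (?S p z - H (fst z) (snd z)))\<^sup>2) \<partial>time_space M T) \<le> ?e p"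
      by (intro nn_integral_mono) (auto simp: indicator_def power2_commute)
    also have "(\<integral>\<^sup>+z. ennreal ((indicator {s..t} (fst z) * (H (fst z) (snd z) - Y (snd z)))\<^sup>2) \<partial>time_space M T) = ?R"
      by (intro nn_integral_cong) (auto simp: indicator_def)
    finally have "?L \<le> 2 * ?d p + 2 * (2 * ?e p + 2 * ?R)"
      by (simp add: mult_left_mono add_left_mono)
    also have "\<dots> = 2 * ?d p + (4 * ?e p + 4 * ?R)"
      by (simp add: distrib_left mult.assoc[symmetric])
    finally show ?thesis .
  qed
  \<comment> \<open>The left-hand side of \<open>bound\<close> does not depend on \<open>p\<close>,
    so it stays below the limit of the right-hand side.\<close>
  have "(\<lambda>p. 2 * ?d p + (4 * ?e p + 4 * ?R)) \<longlonglongrightarrow> 0 + (0 + 4 * ?R)"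
    by (intro tendsto_add ennreal_tendsto_cmult_0 D0 H tendsto_const) auto
  from LIMSEQ_le_const[OF this] bound show ?thesis by auto
qed

text \<open>For simple integrands the mean is exactly 0, so the mean of \<open>Y\<close> times the
  increment equals that of \<open>Y\<close> times \<open>D p\<close>. By Cauchy-Schwarz its square
  is at most a fixed constant times the second moment of \<open>D p\<close>, which tends to
  0.\<close>

lemma ito_integral_increment_mean:
  fixes H I :: "real \<Rightarrow> 'a \<Rightarrow> real"
  assumes I: "has_ito_integral M \<F> T W H I" and st: "0 \<le> s" "s \<le> t" "t \<le> T"
    and Y: "Y \<in> borel_measurable (\<F> s)" "integrable M (\<lambda>\<omega>. (Y \<omega>)\<^sup>2)"
    and int: "integrable M (\<lambda>\<omega>. (I t \<omega> - I s \<omega>)\<^sup>2)"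
  shows "has_bochner_integral M (\<lambda>\<omega>. Y \<omega> * (I t \<omega> - I s \<omega>)) 0"
proof -
  obtain k \<tau> \<xi> D where si: "\<And>p::nat. simple_integrand M \<F> T (k p) (\<tau> p) (\<xi> p)"
    and D[measurable]: "\<And>p. D p \<in> borel_measurable M"
    and D0: "(\<lambda>p. \<integral>\<^sup>+\<omega>. ennreal ((D p \<omega>)\<^sup>2) \<partial>M) \<longlonglongrightarrow> 0"
    and Deq: "\<And>p \<omega>. I t \<omega> - I s \<omega> = D p \<omega> +
      (Defs.simple_integral (k p) (\<tau> p) (\<xi> p) W t \<omega> - Defs.simple_integral (k p) (\<tau> p) (\<xi> p) W s \<omega>)"
    by (rule ito_integral_approx[OF I st]) blast
  have Ym[measurable]: "Y \<in> borel_measurable M" using Y st adapted_measurable by blast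
  have Im[measurable]: "I s \<in> borel_measurable M" "I t \<in> borel_measurable M"
    using has_ito_integral_measurable(2)[OF I] st by auto
  have iY: "integrable M (\<lambda>\<omega>. Y \<omega> * (I t \<omega> - I s \<omega>))"
    by (intro integrable_mult_square Y int) measurable
  let ?c = "\<integral>\<^sup>+\<omega>. ennreal ((Y \<omega>)\<^sup>2) \<partial>M" and ?m = "expectation (\<lambda>\<omega>. Y \<omega> * (I t \<omega> - I s \<omega>))"
  have cfin: "?c < \<infinity>"
    using Y(2) by (simp add: integrable_power2_iff)
  have bound: "ennreal (?m\<^sup>2) \<le> ?c * (\<integral>\<^sup>+\<omega>. ennreal ((D p \<omega>)\<^sup>2) \<partial>M)" for p
  proof -
    \<comment> \<open>\<open>simple_integral_increment\<close> is used with frozen value 0; the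
      vanishing product is kept so that \<open>J\<close> has the shape required there.\<close>
    define J where "J \<omega> = Defs.simple_integral (k p) (\<tau> p) (\<xi> p) W t \<omega> - Defs.simple_integral (k p) (\<tau> p) (\<xi> p) W s \<omega>
      - (0::real) * (W t \<omega> - W s \<omega>)" for \<omega>
    have 0: "(\<lambda>_. 0::real) \<in> borel_measurable (\<F> s)" "integrable M (\<lambda>_. 0\<^sup>2::real)" by auto
    have J: "has_bochner_integral M (\<lambda>\<omega>. Y \<omega> * J \<omega>) 0"
      using simple_integral_increment(3)[OF si[of p] st 0 Y, folded J_def] .
    have YD_eq: "Y \<omega> * D p \<omega> = Y \<omega> * (I t \<omega> - I s \<omega>) - Y \<omega> * J \<omega>" for \<omega>
      by (simp add: Deq[of _ p] J_def algebra_simps)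
    have YD: "has_bochner_integral M (\<lambda>\<omega>. Y \<omega> * D p \<omega>) (?m - 0)"
      unfolding YD_eq by (intro has_bochner_integral_diff J has_bochner_integral_integrable iY)
    then have "ennreal \<bar>?m\<bar> \<le> (\<integral>\<^sup>+\<omega>. ennreal \<bar>Y \<omega> * D p \<omega>\<bar> \<partial>M)"
      using integral_norm_bound_ennreal[of M "\<lambda>\<omega>. Y \<omega> * D p \<omega>"] by (auto simp: has_bochner_integral_iff)
    also have "\<dots> = (\<integral>\<^sup>+\<omega>. ennreal \<bar>Y \<omega>\<bar> * ennreal \<bar>D p \<omega>\<bar> \<partial>M)"
      by (simp add: abs_mult ennreal_mult)
    finally have "(ennreal \<bar>?m\<bar>)\<^sup>2 \<le> (\<integral>\<^sup>+\<omega>. ennreal \<bar>Y \<omega>\<bar> * ennreal \<bar>D p \<omega>\<bar> \<partial>M)\<^sup>2"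
      by (intro power_mono) auto
    also have "\<dots> \<le> (\<integral>\<^sup>+\<omega>. (ennreal \<bar>Y \<omega>\<bar>)\<^sup>2 \<partial>M) * (\<integral>\<^sup>+\<omega>. (ennreal \<bar>D p \<omega>\<bar>)\<^sup>2 \<partial>M)"
      by (rule Cauchy_Schwarz_nn_integral) measurable
    finally show ?thesis by (simp add: ennreal_power)
  qed
  have "(\<lambda>p. ?c * (\<integral>\<^sup>+\<omega>. ennreal ((D p \<omega>)\<^sup>2) \<partial>M)) \<longlonglongrightarrow> 0"
    by (intro ennreal_tendsto_cmult_0 D0) (use cfin in simp)
  from LIMSEQ_le_const[OF this] bound have "ennreal (?m\<^sup>2) \<le> 0" by auto
  then have "?m = 0" by (simp add: ennreal_eq_0_iff)
  with iY show ?thesis by (simp add: has_bochner_integral_iff)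
qed

text \<open>Every simple integral vanishes at time 0 because all partition times are nonnegative.
  The mean square limit inherits this only almost surely.\<close>

lemma ito_integral_0:
  fixes H I :: "real \<Rightarrow> 'a \<Rightarrow> real"
  assumes I: "has_ito_integral M \<F> T W H I" and T: "0 \<le> T"
  shows "AE \<omega> in M. I 0 \<omega> = 0"
proof -
  from I[unfolded has_ito_integral_def] T
  obtain k \<tau> \<xi> where si: "\<And>p::nat. simple_integrand M \<F> T (k p) (\<tau> p) (\<xi> p)"
    and It: "(\<lambda>p. \<integral>\<^sup>+\<omega>. ennreal ((norm (I 0 \<omega> - Defs.simple_integral (k p) (\<tau> p) (\<xi> p) W 0 \<omega>))\<^sup>2)
                  \<partial>M) \<longlonglongrightarrow> 0"
    by force
  have "Defs.simple_integral (k p) (\<tau> p) (\<xi> p) W 0 \<omega> = 0" for p \<omega>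
    unfolding simple_integral_def
  proof (rule sum.neutral, rule ballI)
    fix j assume j: "j \<in> {..<k p}"
    have "0 \<le> \<tau> p j" "0 \<le> \<tau> p (Suc j)"
      using simple_integrand_mono[OF si[of p], of 0 j] simple_integrand_mono[OF si[of p], of 0 "Suc j"]
        si[of p] j unfolding simple_integrand_def by auto
    then show "(W (min 0 (\<tau> p (Suc j))) \<omega> - W (min 0 (\<tau> p j)) \<omega>) *\<^sub>R \<xi> p j \<omega> = 0"
      by simp
  qed
  with It have "(\<lambda>p::nat. \<integral>\<^sup>+\<omega>. ennreal ((I 0 \<omega>)\<^sup>2) \<partial>M) \<longlonglongrightarrow> 0" by simp
  then have "(\<integral>\<^sup>+\<omega>. ennreal ((I 0 \<omega>)\<^sup>2) \<partial>M) = 0"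
    using LIMSEQ_unique tendsto_const by blast
  moreover have [measurable]: "I 0 \<in> borel_measurable M"
    using has_ito_integral_measurable(2)[OF I] T by auto
  ultimately show ?thesis
    by (subst (asm) nn_integral_0_iff_AE) (auto simp: ennreal_eq_0_iff)
qed

end

section \<open>Time integrals and components\<close>

lemma (in prob_space) nn_integral_time_space_le:
  assumes [measurable]: "f \<in> borel_measurable (time_space M T)"
    and st: "0 \<le> s" "s \<le> t" "t \<le> T"
    and c: "\<And>r. s \<le> r \<Longrightarrow> r \<le> t \<Longrightarrow> (\<integral>\<^sup>+\<omega>. f (r, \<omega>) \<partial>M) \<le> c"
  shows "(\<integral>\<^sup>+z. indicator {s..t} (fst z) * f z \<partial>time_space M T) \<le> c * ennreal (t - s)"
proof -
  let ?R = "restrict_space lborel {0..T} :: real measure"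
  have f[measurable]: "f \<in> borel_measurable (?R \<Otimes>\<^sub>M M)" using assms(1) by (simp add: time_space_def)
  have m: "(\<lambda>z. indicator {s..t} (fst z) * f z) \<in> borel_measurable (time_space M T)"
    by measurable
  have st_R[measurable]: "{s..t} \<in> sets ?R" using st by (subst sets_restrict_space_iff) auto
  have "(\<integral>\<^sup>+z. indicator {s..t} (fst z) * f z \<partial>time_space M T) = (\<integral>\<^sup>+r. \<integral>\<^sup>+\<omega>. indicator {s..t} r * f (r, \<omega>) \<partial>M \<partial>?R)"
    using m unfolding time_space_def by (subst nn_integral_fst[symmetric]) simp_all
  also have "\<dots> \<le> (\<integral>\<^sup>+r. c * indicator {s..t} r \<partial>?R)"
  proof (rule nn_integral_mono)
    fix r assume r: "r \<in> space ?R"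
    have "(\<integral>\<^sup>+\<omega>. indicator {s..t} r * f (r, \<omega>) \<partial>M) = indicator {s..t} r * (\<integral>\<^sup>+\<omega>. f (r, \<omega>) \<partial>M)"
      by (rule nn_integral_cmult, rule measurable_Pair2[OF f r])
    also have "\<dots> \<le> c * indicator {s..t} r" using c by (auto simp: indicator_def)
    finally show "(\<integral>\<^sup>+\<omega>. indicator {s..t} r * f (r, \<omega>) \<partial>M) \<le> c * indicator {s..t} r" .
  qed
  also have "\<dots> = c * emeasure ?R {s..t}" by (rule nn_integral_cmult_indicator[OF st_R])
  also have "emeasure ?R {s..t} = ennreal (t - s)"
    using st by (subst emeasure_restrict_space) auto
  finally show ?thesis .
qed

text \<open>Bridge between two ways of writing time: \<open>ito_equation\<close> integrates over a
  subset of \<open>lborel\<close>, while \<open>time_space\<close> is built on the restricted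
  measure.\<close>

lemma set_lebesgue_integral_restrict:
  fixes g :: "real \<Rightarrow> real"
  assumes "0 \<le> s" "t \<le> T"
  shows "(LINT r:{s..t}|lborel. g r) = (\<integral>r. indicator {s..t} r * g r \<partial>restrict_space lborel {0..T})"
  using assms unfolding set_lebesgue_integral_def
  by (subst integral_restrict_space) (auto intro!: Bochner_Integration.integral_cong simp: indicator_def)

lemma set_lebesgue_integral_power2_le:
  fixes g :: "real \<Rightarrow> real"
  assumes g: "g \<in> borel_measurable (restrict_space lborel {0..T})" and st: "0 \<le> s" "s \<le> t" "t \<le> T"
  shows "ennreal ((LINT r:{s..t}|lborel. g r)\<^sup>2) \<le>
    ennreal (t - s) * (\<integral>\<^sup>+r. indicator {s..t} r * ennreal ((g r)\<^sup>2) \<partial>restrict_space lborel {0..T})"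
proof -
  let ?R = "restrict_space lborel {0..T} :: real measure"
  have [measurable]: "{s..t} \<in> sets ?R" using st by (subst sets_restrict_space_iff) auto
  note g[measurable]
  let ?I = "LINT r:{s..t}|lborel. g r"
  have "ennreal \<bar>?I\<bar> \<le> (\<integral>\<^sup>+r. indicator {s..t} r * ennreal \<bar>indicator {s..t} r * g r\<bar> \<partial>?R)"
  proof (cases "integrable ?R (\<lambda>r. indicator {s..t} r * g r)")
    case True
    then have "ennreal \<bar>?I\<bar> \<le> (\<integral>\<^sup>+r. ennreal \<bar>indicator {s..t} r * g r\<bar> \<partial>?R)"
      using integral_norm_bound_ennreal[OF True] set_lebesgue_integral_restrict[OF st(1,3)] by simp
    also have "\<dots> = (\<integral>\<^sup>+r. indicator {s..t} r * ennreal \<bar>indicator {s..t} r * g r\<bar> \<partial>?R)"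
      by (intro nn_integral_cong) (auto simp: indicator_def)
    finally show ?thesis .
  next
    \<comment> \<open>A function that is not integrable has integral 0 by convention, and the bound
      is trivial.\<close>
    case False
    then have "?I = 0" using set_lebesgue_integral_restrict[OF st(1,3)] not_integrable_integral_eq by metis
    then show ?thesis by simp
  qed
  then have "(ennreal \<bar>?I\<bar>)\<^sup>2 \<le> (\<integral>\<^sup>+r. indicator {s..t} r * ennreal \<bar>indicator {s..t} r * g r\<bar> \<partial>?R)\<^sup>2"
    by (intro power_mono) auto
  also have "\<dots> \<le> (\<integral>\<^sup>+r. (indicator {s..t} r)\<^sup>2 \<partial>?R) * (\<integral>\<^sup>+r. (ennreal \<bar>indicator {s..t} r * g r\<bar>)\<^sup>2 \<partial>?R)"
    by (rule Cauchy_Schwarz_nn_integral) measurable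
  also have "(\<integral>\<^sup>+r. (indicator {s..t} r)\<^sup>2 \<partial>?R) = (\<integral>\<^sup>+r. indicator {s..t} r \<partial>?R)"
    by (intro nn_integral_cong) (auto simp: indicator_def)
  also have "\<dots> = emeasure ?R {s..t}" by simp
  also have "emeasure ?R {s..t} = ennreal (t - s)"
    using st by (subst emeasure_restrict_space) auto
  also have "(\<integral>\<^sup>+r. (ennreal \<bar>indicator {s..t} r * g r\<bar>)\<^sup>2 \<partial>?R) = (\<integral>\<^sup>+r. indicator {s..t} r * ennreal ((g r)\<^sup>2) \<partial>?R)"
    by (intro nn_integral_cong) (auto simp: indicator_def ennreal_power)
  finally show ?thesis by (simp add: ennreal_power)
qed

lemma sigma_finite_restrict_lborel: "sigma_finite_measure (restrict_space lborel {0..T::real})"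
  by (rule sigma_finite_measure_restrict_space) (auto intro: sigma_finite_lborel)

lemma (in prob_space) pair_sigma_finite_time_space:
  "pair_sigma_finite (restrict_space lborel {0..T::real}) M"
  using sigma_finite_restrict_lborel sigma_finite_measure_axioms by (rule pair_sigma_finite.intro)

lemma measurable_time_section:
  assumes "Z \<in> measurable (time_space M T) N" "\<omega> \<in> space M"
  shows "(\<lambda>r. Z (r, \<omega>)) \<in> measurable (restrict_space lborel {0..T}) N"
  using measurable_Pair1[OF assms(1)[unfolded time_space_def] assms(2)] .

lemma (in prob_space) time_integral_measurable:
  fixes Z :: "real \<times> 'a \<Rightarrow> real"
  assumes Z[measurable]: "Z \<in> borel_measurable (time_space M T)" and st: "0 \<le> s" "t \<le> T"
  shows "(\<lambda>\<omega>. LINT r:{s..t}|lborel. Z (r, \<omega>)) \<in> borel_measurable M"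
proof -
  let ?R = "restrict_space lborel {0..T} :: real measure"
  interpret R: sigma_finite_measure ?R by (rule sigma_finite_restrict_lborel)
  have "(\<lambda>z. indicator {s..t} (fst z) * Z z) \<in> borel_measurable (time_space M T)" by measurable
  then have "(\<lambda>(\<omega>, r). indicator {s..t} r * Z (r, \<omega>)) \<in> borel_measurable (M \<Otimes>\<^sub>M ?R)"
    unfolding time_space_def by (subst measurable_pair_swap_iff) (simp add: split_beta')
  then have "(\<lambda>\<omega>. \<integral>r. indicator {s..t} r * Z (r, \<omega>) \<partial>?R) \<in> borel_measurable M"
    by (rule R.borel_measurable_lebesgue_integral)
  then show ?thesis using set_lebesgue_integral_restrict[OF st] by simp
qed

text \<open>Cauchy-Schwarz in time for each fixed \<open>\<omega>\<close>, followed by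
  Tonelli.\<close>

lemma (in prob_space) time_integral_power2_le:
  fixes Z :: "real \<times> 'a \<Rightarrow> real"
  assumes Z[measurable]: "Z \<in> borel_measurable (time_space M T)" and st: "0 \<le> s" "s \<le> t" "t \<le> T"
  shows "(\<integral>\<^sup>+\<omega>. ennreal ((LINT r:{s..t}|lborel. Z (r, \<omega>))\<^sup>2) \<partial>M) \<le>
    ennreal (t - s) * (\<integral>\<^sup>+z. indicator {s..t} (fst z) * ennreal ((Z z)\<^sup>2) \<partial>time_space M T)"
proof -
  let ?R = "restrict_space lborel {0..T} :: real measure"
  interpret P: pair_sigma_finite ?R M by (rule pair_sigma_finite_time_space)
  have m: "(\<lambda>z. indicator {s..t} (fst z) * ennreal ((Z z)\<^sup>2)) \<in> borel_measurable (time_space M T)"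
    by measurable
  then have m': "(\<lambda>(r, \<omega>). indicator {s..t} r * ennreal ((Z (r, \<omega>))\<^sup>2)) \<in> borel_measurable (?R \<Otimes>\<^sub>M M)"
    by (simp add: split_beta' time_space_def)
  have m'': "(\<lambda>\<omega>. \<integral>\<^sup>+r. indicator {s..t} r * ennreal ((Z (r, \<omega>))\<^sup>2) \<partial>?R) \<in> borel_measurable M"
    by (rule P.M1.borel_measurable_nn_integral) (use m in \<open>subst measurable_pair_swap_iff, simp add: split_beta' time_space_def\<close>)
  have "(\<integral>\<^sup>+\<omega>. ennreal ((LINT r:{s..t}|lborel. Z (r, \<omega>))\<^sup>2) \<partial>M) \<le>
    (\<integral>\<^sup>+\<omega>. ennreal (t - s) * (\<integral>\<^sup>+r. indicator {s..t} r * ennreal ((Z (r, \<omega>))\<^sup>2) \<partial>?R) \<partial>M)"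
    by (intro nn_integral_mono set_lebesgue_integral_power2_le measurable_time_section[OF Z] st)
  also have "\<dots> = ennreal (t - s) * (\<integral>\<^sup>+\<omega>. \<integral>\<^sup>+r. indicator {s..t} r * ennreal ((Z (r, \<omega>))\<^sup>2) \<partial>?R \<partial>M)"
    by (rule nn_integral_cmult[OF m''])
  also have "(\<integral>\<^sup>+\<omega>. \<integral>\<^sup>+r. indicator {s..t} r * ennreal ((Z (r, \<omega>))\<^sup>2) \<partial>?R \<partial>M) =
    (\<integral>\<^sup>+z. indicator {s..t} (fst z) * ennreal ((Z z)\<^sup>2) \<partial>time_space M T)"
    using P.nn_integral_snd[OF m'] by (simp add: split_beta' time_space_def)
  finally show ?thesis .
qed

section \<open>Coordinates of processes, of integrals and of Brownian motion\<close>

lemma component_borel_measurable: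
  "X \<in> borel_measurable N \<Longrightarrow> (\<lambda>z. (X z :: 'b::topological_space^'l) $ i) \<in> borel_measurable N"
  by (rule measurable_compose[where N=borel, OF _ borel_measurable_continuous_onI])
    (auto intro!: continuous_intros)

lemma component_power2_le_norm: "((x :: real^'l) $ i)\<^sup>2 \<le> (norm x)\<^sup>2"
  using component_le_norm_cart[of x i] by (metis abs_norm_cancel abs_le_square_iff)

lemma square_integrable_process_component:
  assumes X: "square_integrable_process M \<F> T (X :: real \<Rightarrow> 'a \<Rightarrow> real^'l)"
  shows "square_integrable_process M \<F> T (\<lambda>t \<omega>. X t \<omega> $ i)"
proof -
  have m: "(\<lambda>z. X (fst z) (snd z)) \<in> borel_measurable (time_space M T)"
    and int: "integrable (time_space M T) (\<lambda>z. (norm (X (fst z) (snd z)))\<^sup>2)"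
    using X unfolding square_integrable_process_def by (auto intro: measurable_adapted_time_space simp: split_beta')
  have m': "(\<lambda>z. X (fst z) (snd z) $ i) \<in> borel_measurable (time_space M T)"
    by (rule component_borel_measurable[OF m])
  have "integrable (time_space M T) (\<lambda>z. (X (fst z) (snd z) $ i)\<^sup>2)"
    by (rule Bochner_Integration.integrable_bound[OF int])
      (use m' component_power2_le_norm in auto)
  then show ?thesis
    using X m' unfolding square_integrable_process_def measurable_adapted_def
    by (auto simp: split_beta' component_borel_measurable)
qed

text \<open>A coordinate is bounded by the norm, so the coordinates of an approximating sequence
  again approximate. This makes all later estimates of stochastic integrals scalar.\<close>

lemma has_ito_integral_component:
  fixes H I :: "real \<Rightarrow> 'a \<Rightarrow> real^'l"
  assumes F: "filtration_on M \<F>" and I: "has_ito_integral M \<F> T W H I"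
  shows "has_ito_integral M \<F> T W (\<lambda>t \<omega>. H t \<omega> $ i) (\<lambda>t \<omega>. I t \<omega> $ i)"
proof -
  from I[unfolded has_ito_integral_def]
  obtain k \<tau> \<xi> where H2: "square_integrable_process M \<F> T H"
    and Im: "\<And>t. t \<in> {0..T} \<Longrightarrow> I t \<in> borel_measurable M"
    and si: "\<And>p::nat. simple_integrand M \<F> T (k p) (\<tau> p) (\<xi> p)"
    and H: "(\<lambda>p. \<integral>\<^sup>+(t, \<omega>). ennreal ((norm (H t \<omega> - simple_process (k p) (\<tau> p) (\<xi> p) t \<omega>))\<^sup>2)
               \<partial>time_space M T) \<longlonglongrightarrow> 0"
    and It: "\<And>t. t \<in> {0..T} \<Longrightarrow> (\<lambda>p. \<integral>\<^sup>+\<omega>. ennreal ((norm (I t \<omega> - Defs.simple_integral (k p) (\<tau> p) (\<xi> p) W t \<omega>))\<^sup>2)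
                  \<partial>M) \<longlonglongrightarrow> 0"
    by blast
  let ?\<xi> = "\<lambda>p j \<omega>. \<xi> p j \<omega> $ i"
  have le: "ennreal ((norm (x $ i - y $ i))\<^sup>2) \<le> ennreal ((norm (x - y))\<^sup>2)" for x y :: "real^'l"
    using component_power2_le_norm[of "x - y" i] by (intro ennreal_leI) simp
  have sp: "simple_process (k p) (\<tau> p) (?\<xi> p) t \<omega> = simple_process (k p) (\<tau> p) (\<xi> p) t \<omega> $ i" for p t \<omega>
    by (simp add: simple_process_def)
  have sI: "Defs.simple_integral (k p) (\<tau> p) (?\<xi> p) W t \<omega> = Defs.simple_integral (k p) (\<tau> p) (\<xi> p) W t \<omega> $ i" for p t \<omega>
    by (simp add: simple_integral_def)
  have "simple_integrand M \<F> T (k p) (\<tau> p) (?\<xi> p)" for p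
  proof -
    have "?\<xi> p j \<in> borel_measurable (\<F> (\<tau> p j)) \<and> integrable M (\<lambda>\<omega>. (norm (?\<xi> p j \<omega>))\<^sup>2)" if j: "j < k p" for j
    proof
      have \<xi>: "\<xi> p j \<in> borel_measurable (\<F> (\<tau> p j))" "integrable M (\<lambda>\<omega>. (norm (\<xi> p j \<omega>))\<^sup>2)"
        using si[of p] j unfolding simple_integrand_def by auto
      show m: "?\<xi> p j \<in> borel_measurable (\<F> (\<tau> p j))"
        by (rule component_borel_measurable[OF \<xi>(1)])
      have "0 \<le> \<tau> p j"
        using simple_integrand_mono[OF si[of p], of 0 j] si[of p] j unfolding simple_integrand_def by auto
      then have "?\<xi> p j \<in> borel_measurable M"
        using F m by (auto simp: filtration_on_def intro: measurable_from_subalg)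
      then show "integrable M (\<lambda>\<omega>. (norm (?\<xi> p j \<omega>))\<^sup>2)"
        by (intro Bochner_Integration.integrable_bound[OF \<xi>(2)]) (auto simp: component_power2_le_norm)
    qed
    then show ?thesis using si[of p] unfolding simple_integrand_def by auto
  qed
  moreover have "(\<lambda>p. \<integral>\<^sup>+(t, \<omega>). ennreal ((norm (H t \<omega> $ i - simple_process (k p) (\<tau> p) (?\<xi> p) t \<omega>))\<^sup>2)
               \<partial>time_space M T) \<longlonglongrightarrow> 0"
    by (rule tendsto_sandwich[OF _ _ tendsto_const H])
      (auto intro!: always_eventually nn_integral_mono simp: sp le simp del: real_norm_def)
  moreover have "(\<lambda>p. \<integral>\<^sup>+\<omega>. ennreal ((norm (I t \<omega> $ i - Defs.simple_integral (k p) (\<tau> p) (?\<xi> p) W t \<omega>))\<^sup>2)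
                  \<partial>M) \<longlonglongrightarrow> 0" if "t \<in> {0..T}" for t
    by (rule tendsto_sandwich[OF _ _ tendsto_const It[OF that]])
      (auto intro!: always_eventually nn_integral_mono simp: sI le simp del: real_norm_def)
  ultimately have "(\<forall>p. simple_integrand M \<F> T (k p) (\<tau> p) (?\<xi> p)) \<and>
      (\<lambda>p. \<integral>\<^sup>+(t, \<omega>). ennreal ((norm (H t \<omega> $ i - simple_process (k p) (\<tau> p) (?\<xi> p) t \<omega>))\<^sup>2)
        \<partial>time_space M T) \<longlonglongrightarrow> 0 \<and>
      (\<forall>t\<in>{0..T}. (\<lambda>p. \<integral>\<^sup>+\<omega>. ennreal ((norm (I t \<omega> $ i - Defs.simple_integral (k p) (\<tau> p) (?\<xi> p) W t \<omega>))\<^sup>2)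
        \<partial>M) \<longlonglongrightarrow> 0)"
    by blast
  then show ?thesis
    unfolding has_ito_integral_def
    using square_integrable_process_component[OF H2, of i] component_borel_measurable[OF Im, of _ i]
    by (intro conjI ballI exI[of _ k] exI[of _ \<tau>] exI[of _ ?\<xi>]) simp_all
qed

lemma scalar_brownian_component:
  fixes w :: "real \<Rightarrow> 'a \<Rightarrow> real^'n"
  assumes "prob_space M" and F: "filtration_on M \<F>" and w: "brownian_motion M \<F> w"
  shows "scalar_brownian M \<F> (\<lambda>t \<omega>. w t \<omega> $ n)"
proof -
  interpret prob_space M by fact
  show ?thesis
  proof (unfold_locales)
    show "filtration_on M \<F>" by fact
    show "(\<lambda>\<omega>. w t \<omega> $ n) \<in> borel_measurable (\<F> t)" if "0 \<le> t" for t
      using w that unfolding brownian_motion_def by (auto intro: component_borel_measurable)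
    show "distributed M lborel (\<lambda>\<omega>. w t \<omega> $ n - w s \<omega> $ n) (normal_density 0 (sqrt (t - s)))" if "0 \<le> s" "s < t" for s t
      using w that unfolding brownian_motion_def by auto
    show "indep_var borel V borel (\<lambda>\<omega>. w t \<omega> $ n - w s \<omega> $ n)"
      if st: "0 \<le> s" "s < t" and V: "V \<in> borel_measurable (\<F> s)" for s t and V :: "'a \<Rightarrow> real"
    proof -
      let ?d = "\<lambda>\<omega>. w t \<omega> - w s \<omega>" and ?D = "\<lambda>\<omega>. w t \<omega> $ n - w s \<omega> $ n"
      let ?B = "{?d -` S \<inter> space M | S. S \<in> sets borel}"
      have sub: "subalgebra M (\<F> s)" "subalgebra M (\<F> t)" using F st unfolding filtration_on_def by auto
      have [measurable]: "w s \<in> borel_measurable M" "w t \<in> borel_measurable M"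
        using w st sub by (auto simp: brownian_motion_def intro: measurable_from_subalg)
      have ind: "indep_set (sets (\<F> s)) ?B"
        using w st unfolding brownian_motion_def by auto
      \<comment> \<open>Independence passes to smaller families: \<open>V\<close> generates a
        subalgebra of \<open>\<F> s\<close>, and the events described by one coordinate of the
        increment are described by the whole increment.\<close>
      have 1: "sigma_sets (space M) {V -` A \<inter> space M | A. A \<in> sets borel} \<subseteq> sets (\<F> s)"
      proof -
        have sp: "space (\<F> s) = space M" using sub(1) by (simp add: subalgebra_def)
        have "{V -` A \<inter> space M | A. A \<in> sets borel} \<subseteq> sets (\<F> s)"
          using V unfolding sp[symmetric] by (auto intro: measurable_sets)
        from sets.sigma_sets_subset[OF this] show ?thesis by (simp add: sp)
      qed
      have 2: "sigma_sets (space M) {?D -` A \<inter> space M | A. A \<in> sets borel} \<subseteq> ?B"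
      proof -
        have B: "?B = sets (vimage_algebra (space M) ?d borel)"
          by (subst sets_vimage_algebra2) auto
        have "{?D -` A \<inter> space M | A. A \<in> sets borel} \<subseteq> ?B"
        proof safe
          fix A :: "real set" assume A: "A \<in> sets borel"
          have "(\<lambda>y :: real^'n. y $ n) -` A \<inter> space borel \<in> sets borel"
            by (rule measurable_sets[OF component_borel_measurable[of "\<lambda>y. y"] A]) simp
          moreover have "?D -` A \<inter> space M = ?d -` ((\<lambda>y :: real^'n. y $ n) -` A \<inter> space borel) \<inter> space M"
            by auto
          ultimately show "\<exists>S. ?D -` A \<inter> space M = ?d -` S \<inter> space M \<and> S \<in> sets borel" by blast
        qed
        then show ?thesis
          unfolding B using sets.sigma_sets_subset[of _ "vimage_algebra (space M) ?d borel"] by simp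
      qed
      have "indep_set (sigma_sets (space M) {V -` A \<inter> space M | A. A \<in> sets borel})
        (sigma_sets (space M) {?D -` A \<inter> space M | A. A \<in> sets borel})"
        using ind 1 2 unfolding indep_sets2_eq by (meson subset_eq)
      moreover have "V \<in> borel_measurable M" using measurable_from_subalg[OF sub(1) V] .
      moreover have "?D \<in> borel_measurable M"
        using component_borel_measurable[of ?d M n] by simp
      ultimately show ?thesis unfolding indep_var_eq by simp
    qed
  qed
qed

section \<open>Negative parts and Gronwall's inequality\<close>

text \<open>Nonpositive, that is, minus the usual negative part. With this sign
  \<open>2 * npart a\<close> is the derivative of \<open>(npart a)\<^sup>2\<close>, and the product
  with a nonnegative number is nonpositive.\<close>

abbreviation npart :: "real \<Rightarrow> real" where
  "npart a \<equiv> min a 0"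

text \<open>Substitute for a second order Taylor expansion: \<open>2 * npart z\<close> is the
  derivative, and the curvature never exceeds that of the square.\<close>

lemma npart_power2_add_le: "(npart (z + r))\<^sup>2 \<le> (npart z)\<^sup>2 + 2 * npart z * r + r\<^sup>2"
proof -
  have "(npart z)\<^sup>2 + 2 * npart z * r + r\<^sup>2 = (npart z + r)\<^sup>2"
    by (simp add: power2_sum)
  moreover have "(npart (z + r))\<^sup>2 \<le> (npart z + r)\<^sup>2"
    by (rule abs_le_square_iff[THEN iffD1]) linarith
  ultimately show ?thesis by simp
qed

lemma npart_diff_le: "\<bar>npart y - npart z\<bar> \<le> \<bar>y - z\<bar>"
  by linarith

text \<open>For \<open>a < 0\<close> a change of sign only helps. For \<open>a \<ge> 0\<close> the
  left-hand side is nonzero only if \<open>\<eta> < -1\<close>, where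
  \<open>(1 + \<eta>)\<^sup>2 \<le> \<eta>\<^sup>2 \<le> \<eta> ^ 4\<close>. This is a Chebyshev
  bound made pointwise: a fourth moment replaces the probability of a rare event.\<close>

lemma npart_mult_power2_le: "(npart (a * (1 + \<eta>)))\<^sup>2 \<le> (npart a)\<^sup>2 * (1 + \<eta>)\<^sup>2 + a\<^sup>2 * \<eta> ^ 4"
proof (cases "a < 0")
  case True
  have "(npart (a * (1 + \<eta>)))\<^sup>2 \<le> (a * (1 + \<eta>))\<^sup>2"
    by (rule abs_le_square_iff[THEN iffD1]) linarith
  also have "\<dots> = (npart a)\<^sup>2 * (1 + \<eta>)\<^sup>2" using True by (simp add: power_mult_distrib min_def)
  finally show ?thesis by (simp add: add_increasing2)
next
  case False
  show ?thesis
  proof (cases "1 + \<eta> \<ge> 0")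
    case True
    then have "0 \<le> a * (1 + \<eta>)" using False by simp
    then have "npart (a * (1 + \<eta>)) = 0" by simp
    then show ?thesis by simp
  next
    case neg: False
    have "(npart (a * (1 + \<eta>)))\<^sup>2 \<le> (a * (1 + \<eta>))\<^sup>2"
      by (rule abs_le_square_iff[THEN iffD1]) linarith
    also have "\<dots> = a\<^sup>2 * (1 + \<eta>)\<^sup>2" by (simp add: power_mult_distrib)
    also have "(1 + \<eta>)\<^sup>2 \<le> \<eta>\<^sup>2" using neg by (intro abs_le_square_iff[THEN iffD1]) linarith
    also have "\<eta>\<^sup>2 \<le> \<eta>\<^sup>2 * \<eta>\<^sup>2"
      using neg one_le_power[of "\<bar>\<eta>\<bar>" 2] mult_left_mono[of 1 "\<eta>\<^sup>2" "\<eta>\<^sup>2"] by simp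
    also have "\<eta>\<^sup>2 * \<eta>\<^sup>2 = \<eta> ^ 4" by (simp add: power_add[symmetric])
    finally show ?thesis by (simp add: add_increasing mult_left_mono)
  qed
qed

section \<open>The one-step inequality and its error budget\<close>

lemma young_scaled:
  fixes a b \<delta> :: real
  assumes "0 < \<delta>"
  shows "2 * (a * b) \<le> \<delta> * a\<^sup>2 + b\<^sup>2 / \<delta>"
proof -
  have "0 \<le> (\<delta> * a - b)\<^sup>2 / \<delta>" using assms by simp
  also have "\<dots> = \<delta> * a\<^sup>2 + b\<^sup>2 / \<delta> - 2 * (a * b)"
    using assms by (simp add: power2_diff field_simps power2_eq_square)
  finally show ?thesis by simp
qed

lemma power2_add3_le: "(a + b + c)\<^sup>2 \<le> 3 * (a\<^sup>2 + b\<^sup>2 + c\<^sup>2)" for a b c :: real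
  using zero_le_power2[of "a - b"] zero_le_power2[of "a - c"] zero_le_power2[of "b - c"]
  unfolding power2_diff power2_sum by (simp add: algebra_simps)

text \<open>Here \<open>\<delta>\<close> will be the square root of the step length. With
  \<open>z = a * (1 + \<eta>)\<close> and \<open>r = g + d + \<epsilon>\<close>, the factor
  \<open>npart z\<close> of \<open>r\<close> is replaced by \<open>npart a\<close> at the cost of a
  difference of at most \<open>\<bar>a * \<eta>\<bar>\<close>. The Young weights balance the
  expected sizes: \<open>a\<^sup>2 * \<eta>\<^sup>2\<close> has order 2 in \<open>\<delta>\<close>
  and \<open>r\<^sup>2\<close> order 4, so weight \<open>\<delta>\<close> gives order 3 on both
  sides; \<open>d\<^sup>2\<close> has order 6, so weight \<open>\<delta> ^ 3\<close> does the same.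
  The product of \<open>npart a\<close> and \<open>\<epsilon>\<close> is left alone because its mean
  will vanish.\<close>

lemma npart_one_step:
  fixes a \<eta> g d \<epsilon> \<delta> :: real
  assumes \<delta>: "0 < \<delta>" and g: "2 * (npart a * g) \<le> P" "g\<^sup>2 \<le> Q"
  shows "(npart (a + a * \<eta> + (g + d + \<epsilon>)))\<^sup>2 \<le>
    (npart a)\<^sup>2 * (1 + \<eta>)\<^sup>2 + a\<^sup>2 * \<eta> ^ 4 + P + 2 * (npart a * \<epsilon>)
      + (\<delta> ^ 3 * a\<^sup>2 + d\<^sup>2 / \<delta> ^ 3) + \<delta> * (a\<^sup>2 * \<eta>\<^sup>2) + (1 + 1 / \<delta>) * (3 * (Q + d\<^sup>2 + \<epsilon>\<^sup>2))"
proof -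
  define z where "z = a * (1 + \<eta>)"
  define r where "r = g + d + \<epsilon>"
  have eq: "a + a * \<eta> + (g + d + \<epsilon>) = z + r" by (simp add: z_def r_def algebra_simps)
  have "2 * npart z * r = 2 * (npart a * r) + 2 * ((npart z - npart a) * r)"
    by (simp add: algebra_simps)
  also have "2 * ((npart z - npart a) * r) \<le> \<delta> * (npart z - npart a)\<^sup>2 + r\<^sup>2 / \<delta>"
    by (rule young_scaled[OF \<delta>])
  also have "(npart z - npart a)\<^sup>2 \<le> a\<^sup>2 * \<eta>\<^sup>2"
    using npart_diff_le[of z a] abs_le_square_iff[of "npart z - npart a" "z - a"]
    by (simp add: z_def algebra_simps power_mult_distrib)
  also have "2 * (npart a * r) = 2 * (npart a * g) + 2 * (npart a * d) + 2 * (npart a * \<epsilon>)"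
    by (simp add: r_def algebra_simps)
  also have "2 * (npart a * d) \<le> \<delta> ^ 3 * (npart a)\<^sup>2 + d\<^sup>2 / \<delta> ^ 3"
    by (rule young_scaled) (use \<delta> in simp)
  also have "(npart a)\<^sup>2 \<le> a\<^sup>2" by (simp add: min_def)
  finally have 1: "2 * npart z * r \<le> P + (\<delta> ^ 3 * a\<^sup>2 + d\<^sup>2 / \<delta> ^ 3) + 2 * (npart a * \<epsilon>) + (\<delta> * (a\<^sup>2 * \<eta>\<^sup>2) + r\<^sup>2 / \<delta>)"
    using \<delta> g(1) by (simp add: mult_left_mono)
  have 2: "r\<^sup>2 \<le> 3 * (Q + d\<^sup>2 + \<epsilon>\<^sup>2)"
    unfolding r_def by (rule order_trans[OF power2_add3_le]) (use g(2) in simp)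
  have "r\<^sup>2 / \<delta> + r\<^sup>2 = (1 + 1 / \<delta>) * r\<^sup>2" by (simp add: algebra_simps)
  also have "\<dots> \<le> (1 + 1 / \<delta>) * (3 * (Q + d\<^sup>2 + \<epsilon>\<^sup>2))"
    by (rule mult_left_mono[OF 2]) (use \<delta> in simp)
  finally show ?thesis
    using npart_power2_add_le[of z r] npart_mult_power2_le[of a \<eta>] 1 unfolding eq z_def[symmetric]
    by linarith
qed

text \<open>The left-hand side is the remainder of \<open>npart_one_step\<close> with mean sizes
  filled in. Every product has order at least 3, and \<open>\<delta> \<le> 1\<close> absorbs higher
  orders; the 6 comes from bounding \<open>1 + 1 / \<delta>\<close> by
  \<open>2 / \<delta>\<close>.\<close>

lemma one_step_remainder:
  fixes \<delta> :: real
  assumes \<delta>: "0 < \<delta>" "\<delta> \<le> 1" and nonneg: "0 \<le> \<sigma>" "0 \<le> \<gamma>" "0 \<le> \<rho>" "0 \<le> \<theta>"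
  shows "\<sigma> * \<delta> ^ 4 + \<delta> ^ 3 * K + (1 / \<delta> ^ 3) * (\<gamma> * \<delta> ^ 6) + \<delta> * (\<tau> * \<delta>\<^sup>2)
      + 3 * (1 + 1 / \<delta>) * (\<rho> * \<delta> ^ 4 + \<gamma> * \<delta> ^ 6 + \<theta> * \<delta> ^ 4)
    \<le> (\<sigma> + K + \<gamma> + \<tau> + 6 * (\<rho> + \<gamma> + \<theta>)) * \<delta> ^ 3"
proof -
  have 1: "(1 / \<delta> ^ 3) * (\<gamma> * \<delta> ^ 6) = \<gamma> * \<delta> ^ 3"
  proof -
    have "(1 / y) * (\<gamma> * (y * y)) = \<gamma> * y" if "0 < y" for y :: real
      using that by simp
    from this[of "\<delta> ^ 3"] show ?thesis using \<delta>(1) by simp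
  qed
  have 2: "\<delta> * (\<tau> * \<delta>\<^sup>2) = \<tau> * \<delta> ^ 3"
    by (simp add: power3_eq_cube power2_eq_square)
  have 3: "\<sigma> * \<delta> ^ 4 \<le> \<sigma> * \<delta> ^ 3"
    using \<delta> nonneg by (intro mult_left_mono power_decreasing) auto
  have "\<gamma> * \<delta> ^ 6 \<le> \<gamma> * \<delta> ^ 4"
    using \<delta> nonneg by (intro mult_left_mono power_decreasing) auto
  then have "\<rho> * \<delta> ^ 4 + \<gamma> * \<delta> ^ 6 + \<theta> * \<delta> ^ 4 \<le> (\<rho> + \<gamma> + \<theta>) * \<delta> ^ 4"
    by (simp add: algebra_simps)
  moreover have "3 * (1 + 1 / \<delta>) \<le> 6 / \<delta>" using \<delta> by (simp add: field_simps)
  ultimately have "3 * (1 + 1 / \<delta>) * (\<rho> * \<delta> ^ 4 + \<gamma> * \<delta> ^ 6 + \<theta> * \<delta> ^ 4) \<le> 6 / \<delta> * ((\<rho> + \<gamma> + \<theta>) * \<delta> ^ 4)"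
    using \<delta> nonneg by (intro mult_mono) auto
  also have "\<dots> = 6 * (\<rho> + \<gamma> + \<theta>) * \<delta> ^ 3"
    using \<delta>(1) by (simp add: power4_eq_xxxx power3_eq_cube)
  finally have 4: "3 * (1 + 1 / \<delta>) * (\<rho> * \<delta> ^ 4 + \<gamma> * \<delta> ^ 6 + \<theta> * \<delta> ^ 4) \<le> 6 * (\<rho> + \<gamma> + \<theta>) * \<delta> ^ 3" .
  have "(\<sigma> + K + \<gamma> + \<tau> + 6 * (\<rho> + \<gamma> + \<theta>)) * \<delta> ^ 3 =
    \<sigma> * \<delta> ^ 3 + \<delta> ^ 3 * K + \<gamma> * \<delta> ^ 3 + \<tau> * \<delta> ^ 3 + 6 * (\<rho> + \<gamma> + \<theta>) * \<delta> ^ 3"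
    by (simp add: algebra_simps)
  with 3 4 show ?thesis unfolding 1 2 by linarith
qed

text \<open>With \<open>n\<close> steps of length \<open>h = t / n\<close> the errors
  \<open>C * h * sqrt h\<close> add up to \<open>C * t * sqrt h\<close>, amplified by at most
  \<open>exp (C * t)\<close>, and this tends to 0 as \<open>n\<close> grows.\<close>

lemma gronwall_discrete:
  fixes q :: "real \<Rightarrow> real"
  assumes C: "0 \<le> C" and q0: "q 0 = 0" and t: "0 \<le> t" "t \<le> T"
    and step: "\<And>r h. 0 \<le> r \<Longrightarrow> 0 < h \<Longrightarrow> h \<le> 1 \<Longrightarrow> r + h \<le> T \<Longrightarrow>
      q (r + h) \<le> (1 + C * h) * q r + C * h * sqrt h"
  shows "q t \<le> 0"
proof (cases "t = 0")
  case False
  then have tpos: "0 < t" using t by simp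
  have bound: "q t \<le> t * C * exp (C * t) * sqrt (t / real n)" if n: "t \<le> real n" for n :: nat
  proof -
    define h where "h = t / real n"
    have npos: "0 < real n" using n tpos by linarith
    have h: "0 < h" "h \<le> 1" "real n * h = t" using n tpos npos by (auto simp: h_def)
    have "q (real k * h) \<le> real k * C * h * sqrt h * exp (C * (real k * h))" if "k \<le> n" for k
      using that
    proof (induction k)
      case 0
      then show ?case using q0 by simp
    next
      case (Suc k)
      define E where "E = exp (C * (real k * h))"
      have E1: "1 \<le> E" using C h by (simp add: E_def)
      have le: "real k * h + h \<le> T"
        using mult_right_mono[of "real (Suc k)" "real n" h] Suc.prems h t by (simp add: algebra_simps)
      have "q (real (Suc k) * h) = q (real k * h + h)" by (simp add: algebra_simps)
      also have "\<dots> \<le> (1 + C * h) * q (real k * h) + C * h * sqrt h"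
        using h le by (intro step) auto
      also have "\<dots> \<le> (1 + C * h) * (real k * C * h * sqrt h * E) + C * h * sqrt h"
        using Suc C h by (intro add_right_mono mult_left_mono) (auto simp: E_def)
      \<comment> \<open>The new error is inflated by the factor that the old ones carry. The factor
        is at least 1, and with it the terms combine into \<open>Suc k\<close> equal ones.\<close>
      also have "\<dots> \<le> exp (C * h) * (real k * C * h * sqrt h * E) + C * h * sqrt h * (exp (C * h) * E)"
      proof (intro add_mono mult_right_mono)
        show "1 + C * h \<le> exp (C * h)" by (rule exp_ge_add_one_self)
        have "1 \<le> exp (C * h)" using C h by simp
        then have "1 \<le> exp (C * h) * E" using E1 by (metis mult_mono mult.left_neutral zero_le_one order_trans)
        then show "C * h * sqrt h \<le> C * h * sqrt h * (exp (C * h) * E)"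
          using C h mult_left_mono[of 1 "exp (C * h) * E" "C * h * sqrt h"] by simp
      qed (use C h E1 in auto)
      also have "\<dots> = real (Suc k) * C * h * sqrt h * (exp (C * h) * E)"
        by (simp add: algebra_simps)
      also have "exp (C * h) * E = exp (C * (real (Suc k) * h))"
        unfolding E_def exp_add[symmetric] by (simp add: algebra_simps)
      finally show ?case .
    qed
    from this[of n] have "q t \<le> (real n * h) * C * sqrt h * exp (C * t)"
      unfolding h(3) by (simp add: h(3)[symmetric] mult_ac)
    then show ?thesis unfolding h(3) by (simp add: h_def mult_ac)
  qed
  have "(\<lambda>n. t * C * exp (C * t) * sqrt (t / real n)) \<longlonglongrightarrow> t * C * exp (C * t) * sqrt 0"
    by (intro tendsto_intros lim_const_over_n)
  then have "(\<lambda>n. t * C * exp (C * t) * sqrt (t / real n)) \<longlonglongrightarrow> 0" by simp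
  moreover have "\<exists>N. \<forall>n\<ge>N. q t \<le> t * C * exp (C * t) * sqrt (t / real n)"
  proof (intro exI allI impI)
    fix n :: nat assume "nat \<lceil>t\<rceil> \<le> n"
    then have "t \<le> real n" by linarith
    then show "q t \<le> t * C * exp (C * t) * sqrt (t / real n)" by (rule bound)
  qed
  ultimately show ?thesis by (rule LIMSEQ_le_const)
qed (use q0 in simp)

lemma continuous_nonneg_from_rationals:
  fixes f :: "real \<Rightarrow> real"
  assumes f: "continuous_on {0..T} f" and Q: "\<And>r. r \<in> \<rat> \<Longrightarrow> 0 \<le> r \<Longrightarrow> r \<le> T \<Longrightarrow> 0 \<le> f r"
    and t: "0 < t" "t \<le> T"
  shows "0 \<le> f t"
proof (rule ccontr)
  assume "\<not> 0 \<le> f t"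
  then have "0 < - f t" by simp
  then obtain d where d: "0 < d" "\<And>r. r \<in> {0..T} \<Longrightarrow> dist r t < d \<Longrightarrow> dist (f r) (f t) < - f t"
    using f t unfolding continuous_on_iff by (metis atLeastAtMost_iff less_imp_le)
  \<comment> \<open>A rational to the left of \<open>t\<close> stays in the interval even when
    \<open>t = T\<close>.\<close>
  obtain r where r: "r \<in> \<rat>" "max 0 (t - d) < r" "r < t"
    using Rats_dense_in_real[of "max 0 (t - d)" t] d(1) t by auto
  then have "dist (f r) (f t) < - f t" using t by (intro d(2)) (auto simp: dist_real_def)
  moreover have "0 \<le> f r" using r t by (intro Q) auto
  ultimately show False by (simp add: dist_real_def)
qed

section \<open>Mean square bounds along the equation\<close>

text \<open>A nonnegative integral is not 0 by convention when it diverges, unlike a Bochner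
  integral, so the bound itself proves square integrability. The conjunct \<open>0 \<le> c\<close>
  is there because \<open>ennreal c\<close> turns a negative \<open>c\<close> into 0.\<close>

definition mean_square_le :: "'a measure \<Rightarrow> ('a \<Rightarrow> real) \<Rightarrow> real \<Rightarrow> bool" where
  "mean_square_le M f c \<longleftrightarrow>
     f \<in> borel_measurable M \<and> 0 \<le> c \<and> (\<integral>\<^sup>+\<omega>. ennreal ((f \<omega>)\<^sup>2) \<partial>M) \<le> ennreal c"

lemma mean_square_leD:
  assumes "mean_square_le M f c"
  shows "f \<in> borel_measurable M" "0 \<le> c" "integrable M (\<lambda>\<omega>. (f \<omega>)\<^sup>2)" "(\<integral>\<omega>. (f \<omega>)\<^sup>2 \<partial>M) \<le> c"
proof -
  show m: "f \<in> borel_measurable M" and c: "0 \<le> c" using assms by (auto simp: mean_square_le_def)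
  have le: "(\<integral>\<^sup>+\<omega>. ennreal ((f \<omega>)\<^sup>2) \<partial>M) \<le> ennreal c" using assms by (simp add: mean_square_le_def)
  then show i: "integrable M (\<lambda>\<omega>. (f \<omega>)\<^sup>2)"
    using m by (simp add: integrable_power2_iff) (metis ennreal_less_top le_less_trans)
  show "(\<integral>\<omega>. (f \<omega>)\<^sup>2 \<partial>M) \<le> c"
    using le c i by (simp add: nn_integral_eq_integral)
qed

lemma mean_square_leI:
  assumes "f \<in> borel_measurable M" "integrable M (\<lambda>\<omega>. (f \<omega>)\<^sup>2)" "(\<integral>\<omega>. (f \<omega>)\<^sup>2 \<partial>M) \<le> c"
  shows "mean_square_le M f c"
proof -
  have "0 \<le> (\<integral>\<omega>. (f \<omega>)\<^sup>2 \<partial>M)" by simp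
  then have "0 \<le> c" using assms(3) by linarith
  then show ?thesis
    using assms by (simp add: mean_square_le_def nn_integral_eq_integral ennreal_leI)
qed

lemma mean_square_le_mono: "mean_square_le M f c \<Longrightarrow> c \<le> c' \<Longrightarrow> mean_square_le M f c'"
  unfolding mean_square_le_def by (auto intro: order_trans ennreal_leI)

lemma mean_square_le_cong_AE:
  assumes "mean_square_le M g c" "f \<in> borel_measurable M" "AE \<omega> in M. f \<omega> = g \<omega>"
  shows "mean_square_le M f c"
proof -
  have "(\<integral>\<^sup>+\<omega>. ennreal ((f \<omega>)\<^sup>2) \<partial>M) = (\<integral>\<^sup>+\<omega>. ennreal ((g \<omega>)\<^sup>2) \<partial>M)"
    using assms(3) by (intro nn_integral_cong_AE) auto
  then show ?thesis using assms unfolding mean_square_le_def by simp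
qed

lemma mean_square_le_add:
  assumes f: "mean_square_le M f a" and g: "mean_square_le M g b"
  shows "mean_square_le M (\<lambda>\<omega>. f \<omega> + g \<omega>) (2 * a + 2 * b)"
proof (rule mean_square_leI)
  note f = mean_square_leD[OF f] and g = mean_square_leD[OF g]
  show "(\<lambda>\<omega>. f \<omega> + g \<omega>) \<in> borel_measurable M" using f g by measurable
  show i: "integrable M (\<lambda>\<omega>. (f \<omega> + g \<omega>)\<^sup>2)" by (intro integrable_power2_add f g)
  have "(\<integral>\<omega>. (f \<omega> + g \<omega>)\<^sup>2 \<partial>M) \<le> (\<integral>\<omega>. 2 * (f \<omega>)\<^sup>2 + 2 * (g \<omega>)\<^sup>2 \<partial>M)"
    using f g i by (intro integral_mono power2_add_le) auto
  also have "\<dots> \<le> 2 * a + 2 * b" using f g by simp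
  finally show "(\<integral>\<omega>. (f \<omega> + g \<omega>)\<^sup>2 \<partial>M) \<le> 2 * a + 2 * b" .
qed

lemma mean_square_le_cmult:
  assumes f: "mean_square_le M f a"
  shows "mean_square_le M (\<lambda>\<omega>. k * f \<omega>) (k\<^sup>2 * a)"
  by (rule mean_square_leI) (use mean_square_leD[OF f] in \<open>auto simp: power_mult_distrib mult_left_mono\<close>)

text \<open>The weights \<open>g j\<close> may be random, as the entries of the feedback matrix are.
  One factor \<open>CARD('i)\<close> comes from squaring a sum, the other from adding equal bounds
  \<open>c\<close>.\<close>

lemma mean_square_le_sum_bounded:
  fixes f :: "'i::finite \<Rightarrow> 'a \<Rightarrow> real"
  assumes f: "\<And>j. mean_square_le M (f j) c"
    and g: "\<And>\<omega> j. \<omega> \<in> space M \<Longrightarrow> \<bar>g j \<omega>\<bar> \<le> k"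
    and m: "(\<lambda>\<omega>. \<Sum>j\<in>UNIV. g j \<omega> * f j \<omega>) \<in> borel_measurable M"
  shows "mean_square_le M (\<lambda>\<omega>. \<Sum>j\<in>UNIV. g j \<omega> * f j \<omega>) ((real CARD('i))\<^sup>2 * k\<^sup>2 * c)"
proof (rule mean_square_leI[OF m])
  note f = mean_square_leD[OF f]
  let ?N = "real CARD('i)"
  have le: "(\<Sum>j\<in>UNIV. g j \<omega> * f j \<omega>)\<^sup>2 \<le> ?N * k\<^sup>2 * (\<Sum>j\<in>UNIV. (f j \<omega>)\<^sup>2)" if "\<omega> \<in> space M" for \<omega>
  proof -
    have "(\<Sum>j\<in>UNIV. g j \<omega> * f j \<omega>)\<^sup>2 \<le> (\<Sum>j\<in>UNIV. (g j \<omega> * f j \<omega>)\<^sup>2) * ?N"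
      by (rule sum_squared_le_sum_of_squares)
    also have "\<dots> \<le> (\<Sum>j\<in>UNIV. k\<^sup>2 * (f j \<omega>)\<^sup>2) * ?N"
    proof (intro mult_right_mono sum_mono)
      fix j
      have "(g j \<omega>)\<^sup>2 \<le> k\<^sup>2" using g[OF that, of j] by (intro abs_le_square_iff[THEN iffD1]) linarith
      then show "(g j \<omega> * f j \<omega>)\<^sup>2 \<le> k\<^sup>2 * (f j \<omega>)\<^sup>2"
        by (simp add: power_mult_distrib mult_right_mono)
    qed simp
    finally show ?thesis by (simp add: sum_distrib_left[symmetric] mult_ac)
  qed
  have iR: "integrable M (\<lambda>\<omega>. ?N * k\<^sup>2 * (\<Sum>j\<in>UNIV. (f j \<omega>)\<^sup>2))" using f by auto
  show i: "integrable M (\<lambda>\<omega>. (\<Sum>j\<in>UNIV. g j \<omega> * f j \<omega>)\<^sup>2)"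
    by (rule Bochner_Integration.integrable_bound[OF iR])
      (use m le in \<open>auto simp: sum_nonneg intro!: AE_I2\<close>)
  have "(\<integral>\<omega>. (\<Sum>j\<in>UNIV. g j \<omega> * f j \<omega>)\<^sup>2 \<partial>M) \<le> (\<integral>\<omega>. ?N * k\<^sup>2 * (\<Sum>j\<in>UNIV. (f j \<omega>)\<^sup>2) \<partial>M)"
    by (rule integral_mono[OF i iR le])
  also have "\<dots> = ?N * k\<^sup>2 * (\<Sum>j\<in>UNIV. \<integral>\<omega>. (f j \<omega>)\<^sup>2 \<partial>M)" using f by simp
  also have "\<dots> \<le> ?N * k\<^sup>2 * (\<Sum>j\<in>(UNIV::'i set). c)" by (intro mult_left_mono sum_mono f) auto
  finally show "(\<integral>\<omega>. (\<Sum>j\<in>UNIV. g j \<omega> * f j \<omega>)\<^sup>2 \<partial>M) \<le> ?N\<^sup>2 * k\<^sup>2 * c"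
    by (simp add: power2_eq_square mult_ac)
qed

lemma mean_square_le_sum:
  fixes f :: "'i::finite \<Rightarrow> 'a \<Rightarrow> real"
  assumes f: "\<And>j. mean_square_le M (f j) c"
  shows "mean_square_le M (\<lambda>\<omega>. \<Sum>j\<in>UNIV. f j \<omega>) ((real CARD('i))\<^sup>2 * c)"
  using mean_square_le_sum_bounded[of M f c "\<lambda>_ _. 1" 1] mean_square_leD(1)[OF f] f by simp

text \<open>One factor \<open>t - s\<close> comes from Cauchy-Schwarz in time, the other from the
  length of the interval. A stochastic integral gains a single factor, which is why freezing the
  drift costs less than freezing the noise.\<close>

lemma (in prob_space) mean_square_le_time_integral:
  fixes Z :: "real \<times> 'a \<Rightarrow> real"
  assumes Z[measurable]: "Z \<in> borel_measurable (time_space M T)" and st: "0 \<le> s" "s \<le> t" "t \<le> T"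
    and c: "\<And>r. s \<le> r \<Longrightarrow> r \<le> t \<Longrightarrow> mean_square_le M (\<lambda>\<omega>. Z (r, \<omega>)) c"
  shows "mean_square_le M (\<lambda>\<omega>. LINT r:{s..t}|lborel. Z (r, \<omega>)) ((t - s)\<^sup>2 * c)"
  unfolding mean_square_le_def
proof (intro conjI)
  have c0: "0 \<le> c" using c[of s] st by (simp add: mean_square_le_def)
  show "(\<lambda>\<omega>. LINT r:{s..t}|lborel. Z (r, \<omega>)) \<in> borel_measurable M"
    by (rule time_integral_measurable[OF Z st(1,3)])
  show "0 \<le> (t - s)\<^sup>2 * c" using c0 by simp
  have "(\<integral>\<^sup>+\<omega>. ennreal ((LINT r:{s..t}|lborel. Z (r, \<omega>))\<^sup>2) \<partial>M) \<le>
    ennreal (t - s) * (\<integral>\<^sup>+z. indicator {s..t} (fst z) * ennreal ((Z z)\<^sup>2) \<partial>time_space M T)"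
    by (rule time_integral_power2_le[OF Z st])
  also have "(\<integral>\<^sup>+z. indicator {s..t} (fst z) * ennreal ((Z z)\<^sup>2) \<partial>time_space M T) \<le> ennreal c * ennreal (t - s)"
    using c by (intro nn_integral_time_space_le st) (auto simp: mean_square_le_def)
  also have "ennreal (t - s) * (ennreal c * ennreal (t - s)) = ennreal ((t - s)\<^sup>2 * c)"
    using st c0 by (simp add: ennreal_mult[symmetric] power2_eq_square mult_ac)
  finally show "(\<integral>\<^sup>+\<omega>. ennreal ((LINT r:{s..t}|lborel. Z (r, \<omega>))\<^sup>2) \<partial>M) \<le> ennreal ((t - s)\<^sup>2 * c)"
    by (simp add: mult_left_mono)
qed

lemma (in scalar_brownian) mean_square_le_ito:
  fixes H I :: "real \<Rightarrow> 'a \<Rightarrow> real"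
  assumes I: "has_ito_integral M \<F> T W H I" and st: "0 \<le> s" "s \<le> t" "t \<le> T"
    and Y: "Y \<in> borel_measurable (\<F> s)" "integrable M (\<lambda>\<omega>. (Y \<omega>)\<^sup>2)"
    and c: "\<And>r. s \<le> r \<Longrightarrow> r \<le> t \<Longrightarrow> mean_square_le M (\<lambda>\<omega>. H r \<omega> - Y \<omega>) c"
  shows "mean_square_le M (\<lambda>\<omega>. I t \<omega> - I s \<omega> - Y \<omega> * (W t \<omega> - W s \<omega>)) (4 * c * (t - s))"
  unfolding mean_square_le_def
proof (intro conjI)
  have c0: "0 \<le> c" using c[of s] st by (simp add: mean_square_le_def)
  have Ym[measurable]: "Y \<in> borel_measurable M" using adapted_measurable[OF st(1) Y(1)] .
  have [measurable]: "I s \<in> borel_measurable M" "I t \<in> borel_measurable M" "W s \<in> borel_measurable M" "W t \<in> borel_measurable M"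
    using has_ito_integral_measurable(2)[OF I] W_measurable st by auto
  have [measurable]: "(\<lambda>z. H (fst z) (snd z)) \<in> borel_measurable (time_space M T)"
    using has_ito_integral_measurable(1)[OF I] .
  show "(\<lambda>\<omega>. I t \<omega> - I s \<omega> - Y \<omega> * (W t \<omega> - W s \<omega>)) \<in> borel_measurable M" by measurable
  show "0 \<le> 4 * c * (t - s)" using c0 st by simp
  have "(\<integral>\<^sup>+\<omega>. ennreal ((I t \<omega> - I s \<omega> - Y \<omega> * (W t \<omega> - W s \<omega>))\<^sup>2) \<partial>M) \<le>
    4 * (\<integral>\<^sup>+z. indicator {s..t} (fst z) * ennreal ((H (fst z) (snd z) - Y (snd z))\<^sup>2) \<partial>time_space M T)"
    by (rule ito_integral_increment_bound[OF I st Y])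
  also have "(\<integral>\<^sup>+z. indicator {s..t} (fst z) * ennreal ((H (fst z) (snd z) - Y (snd z))\<^sup>2) \<partial>time_space M T) \<le> ennreal c * ennreal (t - s)"
  proof (rule nn_integral_time_space_le[OF _ st])
    show "(\<lambda>z. ennreal ((H (fst z) (snd z) - Y (snd z))\<^sup>2)) \<in> borel_measurable (time_space M T)" by measurable
  qed (use c in \<open>auto simp: mean_square_le_def\<close>)
  also have "4 * (ennreal c * ennreal (t - s)) = ennreal (4 * c * (t - s))"
    using st c0 by (simp add: ennreal_mult mult.assoc)
  finally show "(\<integral>\<^sup>+\<omega>. ennreal ((I t \<omega> - I s \<omega> - Y \<omega> * (W t \<omega> - W s \<omega>))\<^sup>2) \<partial>M) \<le> ennreal (4 * c * (t - s))"
    by (simp add: mult_left_mono)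
qed

text \<open>The closed loop: \<open>G\<close> is the feedback matrix and \<open>f n i\<close> are
  the diagonal entries of the noise matrices. The drift \<open>b\<close> is carried separately from
  its product form because joint measurability is given for \<open>b\<close> and \<open>G\<close>,
  while the product form holds at each time. A single \<open>C\<close> bounds both kinds of
  coefficients.\<close>

locale linear_sde = prob_space M for M :: "'a measure" +
  fixes \<F> :: "real \<Rightarrow> 'a measure" and w :: "real \<Rightarrow> 'a \<Rightarrow> real^'n" and T :: real
    and x b :: "real \<Rightarrow> 'a \<Rightarrow> real^'l" and G :: "real \<Rightarrow> 'a \<Rightarrow> real^'l^'l"
    and f :: "'n \<Rightarrow> 'l \<Rightarrow> real" and I :: "'n \<Rightarrow> real \<Rightarrow> 'a \<Rightarrow> real^'l" and x0 :: "real^'l" and C :: real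
  assumes filtration: "filtration_on M \<F>" and brownian: "brownian_motion M \<F> w" and T_pos: "0 < T"
    and x_adapted: "\<And>t. 0 \<le> t \<Longrightarrow> t \<le> T \<Longrightarrow> x t \<in> borel_measurable (\<F> t)"
    and b_square_integrable: "square_integrable_process M \<F> T b"
    and b_eq: "\<And>t \<omega>. 0 \<le> t \<Longrightarrow> t \<le> T \<Longrightarrow> \<omega> \<in> space M \<Longrightarrow> b t \<omega> = G t \<omega> *v x t \<omega>"
    and G_measurable: "\<And>i j. (\<lambda>z. G (fst z) (snd z) $ i $ j) \<in> borel_measurable (time_space M T)"
    and G_bound: "\<And>t \<omega> i j. 0 \<le> t \<Longrightarrow> t \<le> T \<Longrightarrow> \<omega> \<in> space M \<Longrightarrow> \<bar>G t \<omega> $ i $ j\<bar> \<le> C"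
    and G_metzler: "\<And>t \<omega> i j. 0 \<le> t \<Longrightarrow> t \<le> T \<Longrightarrow> \<omega> \<in> space M \<Longrightarrow> i \<noteq> j \<Longrightarrow> 0 \<le> G t \<omega> $ i $ j"
    and f_bound: "\<And>n i. \<bar>f n i\<bar> \<le> C"
    and ito: "\<And>n. has_ito_integral M \<F> T (\<lambda>t \<omega>. w t \<omega> $ n) (\<lambda>t \<omega>. \<chi> i. f n i * x t \<omega> $ i) (I n)"
    and equation: "\<And>t. 0 \<le> t \<Longrightarrow> t \<le> T \<Longrightarrow>
      AE \<omega> in M. x t \<omega> = x0 + (LINT s:{0..t}|lborel. b s \<omega>) + (\<Sum>n\<in>UNIV. I n t \<omega>)"
begin

section \<open>The equation in scalar, incremental form\<close>

lemma w_component: "scalar_brownian M \<F> (\<lambda>t \<omega>. w t \<omega> $ n)"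
  by (rule scalar_brownian_component[OF prob_space_axioms filtration brownian])

lemma ito_component:
  "has_ito_integral M \<F> T (\<lambda>t \<omega>. w t \<omega> $ n) (\<lambda>t \<omega>. f n i * x t \<omega> $ i) (\<lambda>t \<omega>. I n t \<omega> $ i)"
  using has_ito_integral_component[OF filtration ito, of n i] by simp

lemma x_component_adapted: "0 \<le> t \<Longrightarrow> t \<le> T \<Longrightarrow> (\<lambda>\<omega>. x t \<omega> $ i) \<in> borel_measurable (\<F> t)"
  by (rule component_borel_measurable[OF x_adapted])

lemma x_component_measurable: "0 \<le> t \<Longrightarrow> t \<le> T \<Longrightarrow> (\<lambda>\<omega>. x t \<omega> $ i) \<in> borel_measurable M"
  using scalar_brownian.adapted_measurable[OF w_component] x_component_adapted by blast

lemma b_component: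
  shows "(\<lambda>z. b (fst z) (snd z) $ i) \<in> borel_measurable (time_space M T)"
    and "integrable (time_space M T) (\<lambda>z. (b (fst z) (snd z) $ i)\<^sup>2)"
  using square_integrable_process_component[OF b_square_integrable, of i]
  unfolding square_integrable_process_def by (auto intro: measurable_adapted_time_space simp: split_beta')

lemma b_component_eq: "0 \<le> t \<Longrightarrow> t \<le> T \<Longrightarrow> \<omega> \<in> space M \<Longrightarrow> b t \<omega> $ i = (\<Sum>j\<in>UNIV. G t \<omega> $ i $ j * x t \<omega> $ j)"
  by (simp add: b_eq matrix_vector_mult_def)

lemma finite_measure_time: "finite_measure (restrict_space lborel {0..T})"
  using T_pos by (intro finite_measureI) (simp add: space_restrict_space emeasure_restrict_space)

text \<open>Square integrability on the product gives it in time for almost every path, and on a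
  bounded interval \<open>y \<le> 1 + y\<^sup>2\<close> turns it into integrability. Along such a
  path the time integral may be split and taken coordinatewise.\<close>

lemma AE_b_integrable: "AE \<omega> in M. integrable (restrict_space lborel {0..T}) (\<lambda>r. b r \<omega>)"
proof -
  let ?R = "restrict_space lborel {0..T} :: real measure"
  interpret P: pair_sigma_finite ?R M by (rule pair_sigma_finite_time_space)
  interpret R: finite_measure ?R by (rule finite_measure_time)
  have "integrable (?R \<Otimes>\<^sub>M M) (\<lambda>(r, \<omega>). (norm (b r \<omega>))\<^sup>2)"
    using b_square_integrable by (simp add: square_integrable_process_def time_space_def)
  then have "AE \<omega> in M. integrable ?R (\<lambda>r. (norm (b r \<omega>))\<^sup>2)"
    by (rule P.AE_integrable_snd)
  then show ?thesis
  proof (rule AE_mp, intro AE_I2 impI)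
    fix \<omega> assume \<omega>: "\<omega> \<in> space M" and int: "integrable ?R (\<lambda>r. (norm (b r \<omega>))\<^sup>2)"
    have "(\<lambda>z. b (fst z) (snd z)) \<in> borel_measurable (time_space M T)"
      using b_square_integrable by (auto simp: square_integrable_process_def intro: measurable_adapted_time_space)
    from measurable_time_section[OF this \<omega>] have m: "(\<lambda>r. b r \<omega>) \<in> borel_measurable ?R" by simp
    have i1: "integrable ?R (\<lambda>r. 1 + (norm (b r \<omega>))\<^sup>2)" using int by auto
    have "y \<le> 1 + y\<^sup>2" if "0 \<le> y" for y :: real
      using zero_le_power2[of "y - 1"] that unfolding power2_diff by simp
    then show "integrable ?R (\<lambda>r. b r \<omega>)"
      by (intro Bochner_Integration.integrable_bound[OF i1 m]) simp
  qed
qed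

lemma LINT_component:
  assumes int: "integrable (restrict_space lborel {0..T}) (g :: real \<Rightarrow> real^'l)" and t: "0 \<le> s" "t \<le> T"
  shows "(LINT r:{s..t}|lborel. g r) $ i = (LINT r:{s..t}|lborel. g r $ i)"
proof -
  have "set_integrable lborel {0..T} g"
    using int by (subst (asm) integrable_restrict_space) (auto simp: set_integrable_def)
  then have "set_integrable lborel {s..t} g"
    by (rule set_integrable_subset) (use t in auto)
  from integral_bounded_linear[OF bounded_linear_vec_nth[of i] this[unfolded set_integrable_def]]
  show ?thesis by (simp add: set_lebesgue_integral_def)
qed

lemma LINT_split:
  assumes int: "integrable (restrict_space lborel {0..T}) (g :: real \<Rightarrow> real)" and st: "0 \<le> s" "s \<le> t" "t \<le> T"
  shows "(LINT r:{0..t}|lborel. g r) = (LINT r:{0..s}|lborel. g r) + (LINT r:{s..t}|lborel. g r)"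
proof -
  have "set_integrable lborel {0..T} g"
    using int by (subst (asm) integrable_restrict_space) (auto simp: set_integrable_def)
  then have si: "set_integrable lborel {0..s} g" "set_integrable lborel {s..t} g" "set_integrable lborel {0..t} g"
    by (rule set_integrable_subset; use st in auto)+
  have "(LINT r:{0..t}|lborel. g r) = (\<integral>r. indicator {0..s} r *\<^sub>R g r + indicator {s..t} r *\<^sub>R g r \<partial>lborel)"
    unfolding set_lebesgue_integral_def
  proof (rule integral_cong_AE)
    show "AE r in lborel. indicator {0..t} r *\<^sub>R g r = indicator {0..s} r *\<^sub>R g r + indicator {s..t} r *\<^sub>R g r"
      using AE_lborel_singleton[of s] by eventually_elim (use st in \<open>auto simp: indicator_def\<close>)
  qed (use si in \<open>auto simp: set_integrable_def\<close>)
  also have "\<dots> = (LINT r:{0..s}|lborel. g r) + (LINT r:{s..t}|lborel. g r)"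
    using si unfolding set_lebesgue_integral_def set_integrable_def by simp
  finally show ?thesis .
qed

lemma x_increment:
  assumes st: "0 \<le> s" "s \<le> t" "t \<le> T"
  shows "AE \<omega> in M. x t \<omega> $ i - x s \<omega> $ i =
    (LINT r:{s..t}|lborel. b r \<omega> $ i) + (\<Sum>n\<in>UNIV. I n t \<omega> $ i - I n s \<omega> $ i)"
proof -
  have st': "0 \<le> t" "s \<le> T" using st by auto
  show ?thesis
    using AE_b_integrable equation[OF st(1) st'(2)] equation[OF st'(1) st(3)]
  proof eventually_elim
    case (elim \<omega>)
    have int: "integrable (restrict_space lborel {0..T}) (\<lambda>r. b r \<omega> $ i)"
      by (rule integrable_bounded_linear[OF bounded_linear_vec_nth elim(1)])
    show ?case
      using LINT_component[OF elim(1), of 0 t i] LINT_component[OF elim(1), of 0 s i] LINT_split[OF int st] st st'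
      by (simp add: elim(2,3) sum_subtractf)
  qed
qed

text \<open>\<open>x0\<close> enters \<open>ito_equation\<close> only through the integrated form,
  and at time 0 both integrals vanish up to a null set.\<close>

lemma x_initial: "AE \<omega> in M. x 0 \<omega> = x0"
proof -
  have "AE \<omega> in M. \<forall>i n. I n 0 \<omega> $ i = 0"
    unfolding AE_all_countable
    using scalar_brownian.ito_integral_0[OF w_component ito_component] T_pos by simp
  moreover have "AE \<omega> in M. x 0 \<omega> = x0 + (LINT s:{0..0}|lborel. b s \<omega>) + (\<Sum>n\<in>UNIV. I n 0 \<omega>)"
    using equation[of 0] T_pos by simp
  ultimately show ?thesis
  proof eventually_elim
    case (elim \<omega>)
    have "I n 0 \<omega> = 0" for n using elim(1) by (simp add: vec_eq_iff)
    moreover have "(LINT s:{0..0}|lborel. b s \<omega>) = 0"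
      unfolding set_lebesgue_integral_def
    proof (rule integral_eq_zero_AE)
      show "AE s in lborel. indicator {0..0} s *\<^sub>R b s \<omega> = 0"
        using AE_lborel_singleton[of 0] by eventually_elim simp
    qed
    ultimately show ?case using elim(2) by simp
  qed
qed

end

context linear_sde
begin

section \<open>Second moments of the solution and of the noise\<close>

lemma C_nonneg: "0 \<le> C"
  using f_bound abs_ge_zero order_trans by blast

text \<open>The equation writes \<open>x t\<close> as the initial value plus integrals of
  \<open>b\<close> and of \<open>f n i * x\<close>, which are square integrable over the whole
  horizon. Bounding the integrals up to \<open>t\<close> by those up to \<open>T\<close> makes the
  estimate uniform in time.\<close>

lemma x_mean_square: "\<exists>K. \<forall>t i. 0 \<le> t \<longrightarrow> t \<le> T \<longrightarrow> mean_square_le M (\<lambda>\<omega>. x t \<omega> $ i) K"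
proof -
  let ?N = "real CARD('n)"
  define \<beta> where "\<beta> i = enn2real (\<integral>\<^sup>+z. ennreal ((b (fst z) (snd z) $ i)\<^sup>2) \<partial>time_space M T)" for i
  define \<gamma> where "\<gamma> n i = enn2real (\<integral>\<^sup>+z. ennreal ((f n i * x (fst z) (snd z) $ i)\<^sup>2) \<partial>time_space M T)" for n i
  have \<beta>: "(\<integral>\<^sup>+z. ennreal ((b (fst z) (snd z) $ i)\<^sup>2) \<partial>time_space M T) = ennreal (\<beta> i)" "0 \<le> \<beta> i" for i
    unfolding \<beta>_def using b_component[of i] by (auto simp: integrable_power2_iff)
  have \<gamma>: "(\<integral>\<^sup>+z. ennreal ((f n i * x (fst z) (snd z) $ i)\<^sup>2) \<partial>time_space M T) = ennreal (\<gamma> n i)" "0 \<le> \<gamma> n i" for n i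
  proof -
    have "integrable (time_space M T) (\<lambda>z. (f n i * x (fst z) (snd z) $ i)\<^sup>2)"
      "(\<lambda>z. f n i * x (fst z) (snd z) $ i) \<in> borel_measurable (time_space M T)"
      using ito_component[of n i] unfolding has_ito_integral_def square_integrable_process_def
      by (auto intro: measurable_adapted_time_space simp: split_beta')
    then show "(\<integral>\<^sup>+z. ennreal ((f n i * x (fst z) (snd z) $ i)\<^sup>2) \<partial>time_space M T) = ennreal (\<gamma> n i)" "0 \<le> \<gamma> n i"
      unfolding \<gamma>_def by (auto simp: integrable_power2_iff)
  qed
  \<comment> \<open>The nested factors 2 follow the two additions in the decomposition below; 4 is
    the constant of \<open>ito_integral_increment_bound\<close>, and \<open>?N\<^sup>2\<close> that
    of a sum of \<open>?N\<close> terms.\<close>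
  define K where "K i = 2 * (2 * (T * \<beta> i) + 2 * (?N\<^sup>2 * (4 * (\<Sum>n\<in>UNIV. \<gamma> n i)))) + 2 * (x0 $ i)\<^sup>2" for i
  have K: "mean_square_le M (\<lambda>\<omega>. x t \<omega> $ i) (K i)" if t: "0 \<le> t" "t \<le> T" for t i
  proof -
    have D: "mean_square_le M (\<lambda>\<omega>. LINT r:{0..t}|lborel. b r \<omega> $ i) (T * \<beta> i)"
      unfolding mean_square_le_def
    proof (intro conjI)
      note bm = b_component(1)[of i]
      show "(\<lambda>\<omega>. LINT r:{0..t}|lborel. b r \<omega> $ i) \<in> borel_measurable M"
        using time_integral_measurable[OF bm _ t(2), of 0] by simp
      show "0 \<le> T * \<beta> i" using T_pos \<beta> by simp
      have "(\<integral>\<^sup>+\<omega>. ennreal ((LINT r:{0..t}|lborel. b r \<omega> $ i)\<^sup>2) \<partial>M) \<le>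
        ennreal (t - 0) * (\<integral>\<^sup>+z. indicator {0..t} (fst z) * ennreal ((b (fst z) (snd z) $ i)\<^sup>2) \<partial>time_space M T)"
        using time_integral_power2_le[OF bm order_refl t] by simp
      also have "\<dots> \<le> ennreal T * (\<integral>\<^sup>+z. ennreal ((b (fst z) (snd z) $ i)\<^sup>2) \<partial>time_space M T)"
        using t by (intro mult_mono nn_integral_mono ennreal_leI) (auto simp: indicator_def)
      finally show "(\<integral>\<^sup>+\<omega>. ennreal ((LINT r:{0..t}|lborel. b r \<omega> $ i)\<^sup>2) \<partial>M) \<le> ennreal (T * \<beta> i)"
        using T_pos \<beta> by (simp add: ennreal_mult)
    qed
    have J: "mean_square_le M (\<lambda>\<omega>. I n t \<omega> $ i - I n 0 \<omega> $ i) (4 * (\<Sum>n\<in>UNIV. \<gamma> n i))" for n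
    proof (rule mean_square_le_mono)
      show "4 * \<gamma> n i \<le> 4 * (\<Sum>n\<in>UNIV. \<gamma> n i)"
        using \<gamma>(2) by (intro mult_left_mono member_le_sum) auto
      interpret W: scalar_brownian M \<F> "\<lambda>t \<omega>. w t \<omega> $ n" by (rule w_component)
      show "mean_square_le M (\<lambda>\<omega>. I n t \<omega> $ i - I n 0 \<omega> $ i) (4 * \<gamma> n i)"
        unfolding mean_square_le_def
      proof (intro conjI)
        have "(\<lambda>\<omega>. I n t \<omega> $ i) \<in> borel_measurable M" "(\<lambda>\<omega>. I n 0 \<omega> $ i) \<in> borel_measurable M"
          using W.has_ito_integral_measurable(2)[OF ito_component] t T_pos by auto
        then show "(\<lambda>\<omega>. I n t \<omega> $ i - I n 0 \<omega> $ i) \<in> borel_measurable M" by measurable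
        show "0 \<le> 4 * \<gamma> n i" using \<gamma> by simp
        \<comment> \<open>Freezing at 0 turns the comparison with a frozen integrand into a bound on
          the increment itself.\<close>
        have "(\<integral>\<^sup>+\<omega>. ennreal ((I n t \<omega> $ i - I n 0 \<omega> $ i)\<^sup>2) \<partial>M) \<le>
          4 * (\<integral>\<^sup>+z. indicator {0..t} (fst z) * ennreal ((f n i * x (fst z) (snd z) $ i)\<^sup>2) \<partial>time_space M T)"
          using W.ito_integral_increment_bound[OF ito_component[of n i] order_refl t, of "\<lambda>_. 0"] by simp
        also have "\<dots> \<le> 4 * (\<integral>\<^sup>+z. ennreal ((f n i * x (fst z) (snd z) $ i)\<^sup>2) \<partial>time_space M T)"
          by (intro mult_left_mono nn_integral_mono) (auto simp: indicator_def)
        finally show "(\<integral>\<^sup>+\<omega>. ennreal ((I n t \<omega> $ i - I n 0 \<omega> $ i)\<^sup>2) \<partial>M) \<le> ennreal (4 * \<gamma> n i)"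
          using \<gamma> by (simp add: ennreal_mult)
      qed
    qed
    have c: "mean_square_le M (\<lambda>_. x0 $ i) ((x0 $ i)\<^sup>2)"
      by (rule mean_square_leI) (auto simp: prob_space)
    show ?thesis
    proof (rule mean_square_le_cong_AE)
      show "mean_square_le M (\<lambda>\<omega>. ((LINT r:{0..t}|lborel. b r \<omega> $ i) + (\<Sum>n\<in>UNIV. I n t \<omega> $ i - I n 0 \<omega> $ i)) + x0 $ i) (K i)"
        unfolding K_def by (intro mean_square_le_add D mean_square_le_sum J c)
      show "(\<lambda>\<omega>. x t \<omega> $ i) \<in> borel_measurable M" by (rule x_component_measurable[OF t])
      show "AE \<omega> in M. x t \<omega> $ i = ((LINT r:{0..t}|lborel. b r \<omega> $ i) + (\<Sum>n\<in>UNIV. I n t \<omega> $ i - I n 0 \<omega> $ i)) + x0 $ i"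
        using x_increment[OF order_refl t, of i] x_initial by eventually_elim simp
    qed
  qed
  have "mean_square_le M (\<lambda>\<omega>. x t \<omega> $ i) (\<Sum>i\<in>UNIV. K i)" if t: "0 \<le> t" "t \<le> T" for t i
  proof (rule mean_square_le_mono[OF K[OF t]])
    have "0 \<le> K j" for j using K[OF t, of j] by (rule mean_square_leD)
    then show "K i \<le> (\<Sum>i\<in>UNIV. K i)" by (intro member_le_sum) auto
  qed
  then show ?thesis by blast
qed

lemma G_component_measurable: "0 \<le> r \<Longrightarrow> r \<le> T \<Longrightarrow> (\<lambda>\<omega>. G r \<omega> $ i $ j) \<in> borel_measurable M"
  using measurable_Pair2[OF G_measurable[of i j, unfolded time_space_def], of r]
  by (simp add: space_restrict_space)

lemma b_component_measurable: "0 \<le> r \<Longrightarrow> r \<le> T \<Longrightarrow> (\<lambda>\<omega>. b r \<omega> $ i) \<in> borel_measurable M"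
  using measurable_Pair2[OF b_component(1)[of i, unfolded time_space_def], of r]
  by (simp add: space_restrict_space)

lemma mean_square_le_G:
  assumes r: "0 \<le> r" "r \<le> T" and y: "\<And>j. mean_square_le M (y j) c"
  shows "mean_square_le M (\<lambda>\<omega>. \<Sum>j\<in>UNIV. G r \<omega> $ i $ j * y j \<omega>) ((real CARD('l))\<^sup>2 * C\<^sup>2 * c)"
proof (rule mean_square_le_sum_bounded[OF y])
  show "(\<lambda>\<omega>. \<Sum>j\<in>UNIV. G r \<omega> $ i $ j * y j \<omega>) \<in> borel_measurable M"
    using G_component_measurable[OF r] mean_square_leD(1)[OF y] by measurable
qed (use G_bound r in auto)

text \<open>The weight \<open>V\<close> is known at \<open>s\<close>; it will be a squared component
  or its squared negative part. Bounding the square of a sum by the sum of squares, twice for the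
  fourth power, reduces to single increments and produces the powers of
  \<open>CARD('n)\<close>.\<close>

lemma noise_moments:
  fixes V :: "'a \<Rightarrow> real" and i :: 'l
  assumes st: "0 \<le> s" "s \<le> t" and V: "V \<in> borel_measurable (\<F> s)" "integrable M V" "\<And>\<omega>. 0 \<le> V \<omega>"
  defines "\<eta> \<equiv> \<lambda>\<omega>. \<Sum>n\<in>UNIV. f n i * (w t \<omega> $ n - w s \<omega> $ n)"
  shows "has_bochner_integral M (\<lambda>\<omega>. V \<omega> * \<eta> \<omega>) 0"
    and "integrable M (\<lambda>\<omega>. V \<omega> * (\<eta> \<omega>)\<^sup>2)"
    and "expectation (\<lambda>\<omega>. V \<omega> * (\<eta> \<omega>)\<^sup>2) \<le> (real CARD('n))\<^sup>2 * C\<^sup>2 * (t - s) * expectation V"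
    and "integrable M (\<lambda>\<omega>. V \<omega> * \<eta> \<omega> ^ 4)"
    and "expectation (\<lambda>\<omega>. V \<omega> * \<eta> \<omega> ^ 4) \<le> 3 * (real CARD('n)) ^ 4 * C ^ 4 * (t - s)\<^sup>2 * expectation V"
proof -
  let ?N = "real CARD('n)" and ?D = "\<lambda>n \<omega>. w t \<omega> $ n - w s \<omega> $ n"
  have st': "0 \<le> t" using st by simp
  have Vm[measurable]: "V \<in> borel_measurable M"
    using scalar_brownian.adapted_measurable[OF w_component st(1) V(1)] .
  have Dm[measurable]: "?D n \<in> borel_measurable M" for n
    using scalar_brownian.W_measurable[OF w_component st(1), of n] scalar_brownian.W_measurable[OF w_component st', of n]
    by measurable
  have \<eta>m[measurable]: "\<eta> \<in> borel_measurable M" unfolding \<eta>_def by measurable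
  note D1 = scalar_brownian.increment_mean[OF w_component st V(1,2)]
    and D2 = scalar_brownian.increment_square[OF w_component st V(1,2)]
    and D4 = scalar_brownian.increment_fourth[OF w_component st V(1,2)]
  have "has_bochner_integral M (\<lambda>\<omega>. \<Sum>n\<in>UNIV. f n i * (V \<omega> * ?D n \<omega>)) (\<Sum>n\<in>(UNIV::'n set). f n i * 0)"
    by (intro has_bochner_integral_sum has_bochner_integral_mult_right D1)
  then show "has_bochner_integral M (\<lambda>\<omega>. V \<omega> * \<eta> \<omega>) 0"
    by (simp add: \<eta>_def sum_distrib_left mult_ac)
  have le2: "(\<eta> \<omega>)\<^sup>2 \<le> ?N * C\<^sup>2 * (\<Sum>n\<in>UNIV. (?D n \<omega>)\<^sup>2)" for \<omega>
  proof -
    have "(\<eta> \<omega>)\<^sup>2 \<le> (\<Sum>n\<in>UNIV. (f n i * ?D n \<omega>)\<^sup>2) * ?N"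
      unfolding \<eta>_def by (rule sum_squared_le_sum_of_squares)
    also have "\<dots> \<le> (\<Sum>n\<in>UNIV. C\<^sup>2 * (?D n \<omega>)\<^sup>2) * ?N"
    proof (intro mult_right_mono sum_mono)
      fix n
      have "(f n i)\<^sup>2 \<le> C\<^sup>2" using f_bound[of n i] by (intro abs_le_square_iff[THEN iffD1]) linarith
      then show "(f n i * ?D n \<omega>)\<^sup>2 \<le> C\<^sup>2 * (?D n \<omega>)\<^sup>2"
        by (simp add: power_mult_distrib mult_right_mono)
    qed simp
    finally show ?thesis by (simp add: sum_distrib_left[symmetric] mult_ac)
  qed
  have V2: "V \<omega> * (\<eta> \<omega>)\<^sup>2 \<le> ?N * C\<^sup>2 * (\<Sum>n\<in>UNIV. V \<omega> * (?D n \<omega>)\<^sup>2)" for \<omega>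
    using mult_left_mono[OF le2[of \<omega>] V(3)[of \<omega>]] by (simp add: sum_distrib_left mult_ac)
  have V4: "V \<omega> * \<eta> \<omega> ^ 4 \<le> ?N ^ 3 * C ^ 4 * (\<Sum>n\<in>UNIV. V \<omega> * ?D n \<omega> ^ 4)" for \<omega>
  proof -
    have "\<eta> \<omega> ^ 4 = ((\<eta> \<omega>)\<^sup>2)\<^sup>2" by (simp flip: power_mult)
    also have "\<dots> \<le> (?N * C\<^sup>2 * (\<Sum>n\<in>UNIV. (?D n \<omega>)\<^sup>2))\<^sup>2" by (intro power_mono le2) simp
    also have "\<dots> = (?N * C\<^sup>2)\<^sup>2 * (\<Sum>n\<in>UNIV. (?D n \<omega>)\<^sup>2)\<^sup>2" by (simp add: power_mult_distrib)
    also have "\<dots> \<le> (?N * C\<^sup>2)\<^sup>2 * ((\<Sum>n\<in>UNIV. ((?D n \<omega>)\<^sup>2)\<^sup>2) * ?N)"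
      by (intro mult_left_mono sum_squared_le_sum_of_squares) simp
    also have "\<dots> = ?N ^ 3 * C ^ 4 * (\<Sum>n\<in>UNIV. ?D n \<omega> ^ 4)"
      by (simp add: power_mult_distrib power3_eq_cube power2_eq_square[of ?N] flip: power_mult)
    finally have "\<eta> \<omega> ^ 4 \<le> ?N ^ 3 * C ^ 4 * (\<Sum>n\<in>UNIV. ?D n \<omega> ^ 4)" .
    from mult_left_mono[OF this V(3)[of \<omega>]] show ?thesis by (simp add: sum_distrib_left mult_ac)
  qed
  have I2: "has_bochner_integral M (\<lambda>\<omega>. ?N * C\<^sup>2 * (\<Sum>n\<in>UNIV. V \<omega> * (?D n \<omega>)\<^sup>2))
      (?N * C\<^sup>2 * (\<Sum>n\<in>(UNIV::'n set). expectation V * (t - s)))"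
    by (intro has_bochner_integral_mult_right has_bochner_integral_sum D2)
  have I4: "has_bochner_integral M (\<lambda>\<omega>. ?N ^ 3 * C ^ 4 * (\<Sum>n\<in>UNIV. V \<omega> * ?D n \<omega> ^ 4))
      (?N ^ 3 * C ^ 4 * (\<Sum>n\<in>(UNIV::'n set). expectation V * (3 * (t - s)\<^sup>2)))"
    by (intro has_bochner_integral_mult_right has_bochner_integral_sum D4)
  have abs_le: "norm u \<le> norm v" if "0 \<le> u" "u \<le> v" for u v :: real using that by simp
  show i2: "integrable M (\<lambda>\<omega>. V \<omega> * (\<eta> \<omega>)\<^sup>2)"
    by (rule Bochner_Integration.integrable_bound[OF integrable.intros[OF I2]])
      (measurable, intro AE_I2 abs_le V2 mult_nonneg_nonneg V(3) zero_le_power2)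
  show i4: "integrable M (\<lambda>\<omega>. V \<omega> * \<eta> \<omega> ^ 4)"
    by (rule Bochner_Integration.integrable_bound[OF integrable.intros[OF I4]])
      (measurable, intro AE_I2 abs_le V4 mult_nonneg_nonneg V(3), simp)
  show "expectation (\<lambda>\<omega>. V \<omega> * (\<eta> \<omega>)\<^sup>2) \<le> ?N\<^sup>2 * C\<^sup>2 * (t - s) * expectation V"
    using integral_mono[OF i2 integrable.intros[OF I2] V2] unfolding has_bochner_integral_integral_eq[OF I2]
    by (simp add: power2_eq_square mult_ac)
  show "expectation (\<lambda>\<omega>. V \<omega> * \<eta> \<omega> ^ 4) \<le> 3 * ?N ^ 4 * C ^ 4 * (t - s)\<^sup>2 * expectation V"
    using integral_mono[OF i4 integrable.intros[OF I4] V4] unfolding has_bochner_integral_integral_eq[OF I4]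
    by (simp add: power4_eq_xxxx power3_eq_cube mult_ac)
qed

end

section \<open>One step of the discretisation\<close>

context linear_sde
begin

lemma set_integrable_time:
  fixes g :: "real \<Rightarrow> real"
  assumes "integrable (restrict_space lborel {0..T}) g" "0 \<le> s" "t \<le> T"
  shows "set_integrable lborel {s..t} g"
proof -
  have "set_integrable lborel {0..T} g"
    using assms(1) by (subst (asm) integrable_restrict_space) (auto simp: set_integrable_def)
  then show ?thesis by (rule set_integrable_subset) (use assms in auto)
qed

lemma G_set_integrable:
  assumes "0 \<le> s" "t \<le> T" and \<omega>: "\<omega> \<in> space M"
  shows "set_integrable lborel {s..t} (\<lambda>r. G r \<omega> $ i $ j)"
proof -
  interpret R: finite_measure "restrict_space lborel {0..T}" by (rule finite_measure_time)
  have "integrable (restrict_space lborel {0..T}) (\<lambda>r. G r \<omega> $ i $ j)"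
  proof (rule R.integrable_const_bound)
    show "(\<lambda>r. G r \<omega> $ i $ j) \<in> borel_measurable (restrict_space lborel {0..T})"
      using measurable_time_section[OF G_measurable \<omega>] by simp
    show "AE r in restrict_space lborel {0..T}. norm (G r \<omega> $ i $ j) \<le> C"
      using G_bound \<omega> by (intro AE_I2) (simp add: space_restrict_space)
  qed
  then show ?thesis using assms(1,2) by (rule set_integrable_time)
qed

text \<open>\<open>G\<close> is merely measurable in time, so it is integrated over the step instead
  of being evaluated at \<open>s\<close>. Integration preserves the off-diagonal sign and makes the
  entries proportional to the step.\<close>

lemma G_integral:
  assumes st: "0 \<le> s" "s \<le> t" "t \<le> T" and \<omega>: "\<omega> \<in> space M"
  shows "\<bar>LINT r:{s..t}|lborel. G r \<omega> $ i $ j\<bar> \<le> C * (t - s)"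
    and "i \<noteq> j \<Longrightarrow> 0 \<le> (LINT r:{s..t}|lborel. G r \<omega> $ i $ j)"
proof -
  have "norm (\<integral>r. indicator {s..t} r *\<^sub>R G r \<omega> $ i $ j \<partial>lborel) \<le> (\<integral>r. indicator {s..t} r *\<^sub>R C \<partial>lborel)"
  proof (rule Bochner_Integration.integral_norm_bound_integral)
    show "integrable lborel (\<lambda>r. indicator {s..t} r *\<^sub>R G r \<omega> $ i $ j)"
      using G_set_integrable[OF st(1,3) \<omega>] by (simp add: set_integrable_def)
    show "norm (indicator {s..t} r *\<^sub>R G r \<omega> $ i $ j) \<le> indicator {s..t} r *\<^sub>R C" for r
      using G_bound[of r \<omega> i j] st \<omega> by (auto simp: indicator_def)
    show "integrable lborel (\<lambda>r. indicator {s..t} r *\<^sub>R C)"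
      by (rule integrable_scaleR_left, rule integrable_real_indicator) (use st in simp_all)
  qed
  then show "\<bar>LINT r:{s..t}|lborel. G r \<omega> $ i $ j\<bar> \<le> C * (t - s)"
    using st by (simp add: set_lebesgue_integral_def mult.commute)
  show "0 \<le> (LINT r:{s..t}|lborel. G r \<omega> $ i $ j)" if "i \<noteq> j"
    unfolding set_lebesgue_integral_def
    using G_metzler[OF _ _ \<omega> that] st
    by (intro Bochner_Integration.integral_nonneg) (auto simp: indicator_def)
qed

definition q :: "real \<Rightarrow> real" where
  "q t = (\<Sum>i\<in>UNIV. expectation (\<lambda>\<omega>. (npart (x t \<omega> $ i))\<^sup>2))"

lemma expectation_npart_le_q: "expectation (\<lambda>\<omega>. (npart (x t \<omega> $ i))\<^sup>2) \<le> q t"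
  unfolding q_def by (rule member_le_sum) auto

text \<open>\<open>K\<close> comes from an existence statement, so it and the constants derived from
  it are fixed here, and \<open>refl\<close> supplies the equations in \<open>AE_nonneg\<close>.
  \<open>\<kappa>\<close> is the rate of the mean square increments of \<open>x\<close>: its first
  summand is the drift, quadratic in the step with one factor traded for \<open>T\<close>, and its
  second is the noise.\<close>

context
  fixes K L N \<kappa> :: real
  assumes x_bound: "\<And>t i. 0 \<le> t \<Longrightarrow> t \<le> T \<Longrightarrow> mean_square_le M (\<lambda>\<omega>. x t \<omega> $ i) K"
    and L: "L = real CARD('l)" and N: "N = real CARD('n)"
    and \<kappa>: "\<kappa> = 2 * T * (L\<^sup>2 * C\<^sup>2 * K) + 2 * (N\<^sup>2 * (4 * (C\<^sup>2 * K)))"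
begin

lemma K_nonneg: "0 \<le> K"
  using x_bound[of 0] T_pos mean_square_leD(2) by force

section \<open>Mean square regularity and the two freezing errors\<close>

lemma b_mean_square:
  assumes r: "0 \<le> r" "r \<le> T"
  shows "mean_square_le M (\<lambda>\<omega>. b r \<omega> $ i) (L\<^sup>2 * C\<^sup>2 * K)"
  by (rule mean_square_le_cong_AE[OF mean_square_le_G[OF r x_bound[OF r], folded L]])
    (use b_component_measurable[OF r] b_component_eq[OF r] in auto)

lemma f_x_mean_square:
  assumes y: "mean_square_le M y c"
  shows "mean_square_le M (\<lambda>\<omega>. f n i * y \<omega>) (C\<^sup>2 * c)"
proof (rule mean_square_le_mono[OF mean_square_le_cmult[OF y]])
  have "(f n i)\<^sup>2 \<le> C\<^sup>2" using f_bound[of n i] by (intro abs_le_square_iff[THEN iffD1]) linarith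
  then show "(f n i)\<^sup>2 * c \<le> C\<^sup>2 * c" using mean_square_leD(2)[OF y] by (rule mult_right_mono)
qed

lemma x_increment_mean_square:
  assumes st: "0 \<le> s" "s \<le> t" "t \<le> T"
  shows "mean_square_le M (\<lambda>\<omega>. x t \<omega> $ i - x s \<omega> $ i) (\<kappa> * (t - s))"
proof (rule mean_square_le_mono)
  have D: "mean_square_le M (\<lambda>\<omega>. LINT r:{s..t}|lborel. b r \<omega> $ i) ((t - s)\<^sup>2 * (L\<^sup>2 * C\<^sup>2 * K))"
    using mean_square_le_time_integral[OF b_component(1) st, of i "L\<^sup>2 * C\<^sup>2 * K"] b_mean_square st by simp
  have J: "mean_square_le M (\<lambda>\<omega>. I n t \<omega> $ i - I n s \<omega> $ i) (4 * (C\<^sup>2 * K) * (t - s))" for n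
    using scalar_brownian.mean_square_le_ito[OF w_component ito_component[of n i] st, of "\<lambda>_. 0" "C\<^sup>2 * K"]
      f_x_mean_square[OF x_bound] st by simp
  show "mean_square_le M (\<lambda>\<omega>. x t \<omega> $ i - x s \<omega> $ i)
    (2 * ((t - s)\<^sup>2 * (L\<^sup>2 * C\<^sup>2 * K)) + 2 * (N\<^sup>2 * (4 * (C\<^sup>2 * K) * (t - s))))"
  proof (rule mean_square_le_cong_AE)
    show "mean_square_le M (\<lambda>\<omega>. (LINT r:{s..t}|lborel. b r \<omega> $ i) + (\<Sum>n\<in>UNIV. I n t \<omega> $ i - I n s \<omega> $ i))
      (2 * ((t - s)\<^sup>2 * (L\<^sup>2 * C\<^sup>2 * K)) + 2 * (N\<^sup>2 * (4 * (C\<^sup>2 * K) * (t - s))))"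
      unfolding N by (intro mean_square_le_add D mean_square_le_sum J)
    show "AE \<omega> in M. x t \<omega> $ i - x s \<omega> $ i = (LINT r:{s..t}|lborel. b r \<omega> $ i) + (\<Sum>n\<in>UNIV. I n t \<omega> $ i - I n s \<omega> $ i)"
      by (rule x_increment[OF st])
    show "(\<lambda>\<omega>. x t \<omega> $ i - x s \<omega> $ i) \<in> borel_measurable M"
      using x_component_measurable[of t i] x_component_measurable[of s i] st by simp
  qed
  have "(t - s)\<^sup>2 * (L\<^sup>2 * C\<^sup>2 * K) \<le> T * (t - s) * (L\<^sup>2 * C\<^sup>2 * K)"
    unfolding power2_eq_square[of "t - s"] using st K_nonneg by (intro mult_right_mono) auto
  then show "2 * ((t - s)\<^sup>2 * (L\<^sup>2 * C\<^sup>2 * K)) + 2 * (N\<^sup>2 * (4 * (C\<^sup>2 * K) * (t - s))) \<le> \<kappa> * (t - s)"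
    unfolding \<kappa> by (simp add: algebra_simps)
qed

lemma \<kappa>_nonneg: "0 \<le> \<kappa>"
  unfolding \<kappa> using T_pos K_nonneg by simp

lemma x_increment_mean_square':
  assumes "0 \<le> s" "s \<le> r" "r \<le> t" "t \<le> T"
  shows "mean_square_le M (\<lambda>\<omega>. x r \<omega> $ i - x s \<omega> $ i) (\<kappa> * (t - s))"
  by (rule mean_square_le_mono[OF x_increment_mean_square]) (use assms \<kappa>_nonneg in \<open>auto intro: mult_left_mono\<close>)

text \<open>The integrand minus its value at \<open>s\<close> is \<open>f n i\<close> times an
  increment of \<open>x\<close>, of second moment \<open>O(t - s)\<close>, and the isometry adds
  another factor \<open>t - s\<close>. The stochastic integral and its frozen version are both
  orthogonal to the square integrable past, hence so is their difference.\<close>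

lemma ito_error:
  assumes st: "0 \<le> s" "s \<le> t" "t \<le> T"
  defines "\<epsilon> \<equiv> \<lambda>n i \<omega>. I n t \<omega> $ i - I n s \<omega> $ i - f n i * x s \<omega> $ i * (w t \<omega> $ n - w s \<omega> $ n)"
  shows "mean_square_le M (\<epsilon> n i) (4 * (C\<^sup>2 * (\<kappa> * (t - s))) * (t - s))"
    and "\<And>V. V \<in> borel_measurable (\<F> s) \<Longrightarrow> integrable M (\<lambda>\<omega>. (V \<omega>)\<^sup>2) \<Longrightarrow>
      has_bochner_integral M (\<lambda>\<omega>. V \<omega> * \<epsilon> n i \<omega>) 0"
proof -
  interpret W: scalar_brownian M \<F> "\<lambda>t \<omega>. w t \<omega> $ n" by (rule w_component)
  have sT: "s \<le> T" using st by simp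
  have Y: "(\<lambda>\<omega>. f n i * x s \<omega> $ i) \<in> borel_measurable (\<F> s)" "integrable M (\<lambda>\<omega>. (f n i * x s \<omega> $ i)\<^sup>2)"
    using x_component_adapted[OF st(1) sT] mean_square_leD(3)[OF f_x_mean_square[OF x_bound[OF st(1) sT]]] by auto
  have eq: "f n i * x r \<omega> $ i - f n i * x s \<omega> $ i = f n i * (x r \<omega> $ i - x s \<omega> $ i)" for r \<omega>
    by (simp add: algebra_simps)
  show "mean_square_le M (\<epsilon> n i) (4 * (C\<^sup>2 * (\<kappa> * (t - s))) * (t - s))"
    unfolding \<epsilon>_def
    by (rule W.mean_square_le_ito[OF ito_component st Y])
      (unfold eq, intro f_x_mean_square x_increment_mean_square', use st in auto)
  fix V :: "'a \<Rightarrow> real"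
  assume V: "V \<in> borel_measurable (\<F> s)" "integrable M (\<lambda>\<omega>. (V \<omega>)\<^sup>2)"
  have "mean_square_le M (\<lambda>\<omega>. I n t \<omega> $ i - I n s \<omega> $ i) (4 * (C\<^sup>2 * K) * (t - s))"
    using W.mean_square_le_ito[OF ito_component[of n i] st, of "\<lambda>_. 0" "C\<^sup>2 * K"]
      f_x_mean_square[OF x_bound] st by simp
  from W.ito_integral_increment_mean[OF ito_component[of n i] st V mean_square_leD(3)[OF this]]
  have 1: "has_bochner_integral M (\<lambda>\<omega>. V \<omega> * (I n t \<omega> $ i - I n s \<omega> $ i)) 0" .
  have 2: "has_bochner_integral M (\<lambda>\<omega>. (V \<omega> * (f n i * x s \<omega> $ i)) * (w t \<omega> $ n - w s \<omega> $ n)) 0"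
  proof (rule W.increment_mean[OF st(1,2)])
    show "(\<lambda>\<omega>. V \<omega> * (f n i * x s \<omega> $ i)) \<in> borel_measurable (\<F> s)" using V Y by measurable
    show "integrable M (\<lambda>\<omega>. V \<omega> * (f n i * x s \<omega> $ i))"
      by (intro integrable_mult_square W.adapted_measurable[OF st(1)] V Y)
  qed
  show "has_bochner_integral M (\<lambda>\<omega>. V \<omega> * \<epsilon> n i \<omega>) 0"
    using has_bochner_integral_diff[OF 1 2] by (simp add: \<epsilon>_def algebra_simps)
qed

text \<open>Only \<open>x\<close> is frozen, while \<open>G\<close> keeps its variation in time. The
  time integral contributes \<open>(t - s)\<^sup>2\<close> and the increment of \<open>x\<close> one
  more factor, so the second moment is cubic in the step.\<close>

lemma drift_error:
  assumes st: "0 \<le> s" "s \<le> t" "t \<le> T"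
  defines "d \<equiv> \<lambda>i \<omega>. LINT r:{s..t}|lborel. b r \<omega> $ i - (\<Sum>j\<in>UNIV. G r \<omega> $ i $ j * x s \<omega> $ j)"
  shows "mean_square_le M (d i) ((t - s)\<^sup>2 * (L\<^sup>2 * C\<^sup>2 * (\<kappa> * (t - s))))"
    and "AE \<omega> in M. (LINT r:{s..t}|lborel. b r \<omega> $ i) =
      (\<Sum>j\<in>UNIV. (LINT r:{s..t}|lborel. G r \<omega> $ i $ j) * x s \<omega> $ j) + d i \<omega>"
proof -
  have sT: "s \<le> T" using st by simp
  note [measurable] = b_component(1) G_measurable x_component_measurable[OF st(1) sT]
  \<comment> \<open>Nothing makes \<open>x\<close> jointly measurable in \<open>(t, \<omega>)\<close>, so Fubini is applied to an expression in \<open>b\<close>,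
    \<open>G\<close> and the single variable \<open>x s\<close>.\<close>
  let ?Z = "\<lambda>z. b (fst z) (snd z) $ i - (\<Sum>j\<in>UNIV. G (fst z) (snd z) $ i $ j * x s (snd z) $ j)"
  have Z: "?Z \<in> borel_measurable (time_space M T)" by measurable
  have Zr: "mean_square_le M (\<lambda>\<omega>. ?Z (r, \<omega>)) (L\<^sup>2 * C\<^sup>2 * (\<kappa> * (t - s)))" if r: "s \<le> r" "r \<le> t" for r
  proof -
    have r': "0 \<le> r" "r \<le> T" using r st by auto
    note [measurable] = b_component_measurable[OF r'] G_component_measurable[OF r']
    have "mean_square_le M (\<lambda>\<omega>. \<Sum>j\<in>UNIV. G r \<omega> $ i $ j * (x r \<omega> $ j - x s \<omega> $ j)) (L\<^sup>2 * C\<^sup>2 * (\<kappa> * (t - s)))"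
      by (intro mean_square_le_G[OF r', folded L] x_increment_mean_square'[OF st(1) r st(3)])
    then show ?thesis
    proof (rule mean_square_le_cong_AE)
      show "(\<lambda>\<omega>. ?Z (r, \<omega>)) \<in> borel_measurable M" by simp
      show "AE \<omega> in M. ?Z (r, \<omega>) = (\<Sum>j\<in>UNIV. G r \<omega> $ i $ j * (x r \<omega> $ j - x s \<omega> $ j))"
        using b_component_eq[OF r'] by (intro AE_I2) (simp add: right_diff_distrib sum_subtractf)
    qed
  qed
  show "mean_square_le M (d i) ((t - s)\<^sup>2 * (L\<^sup>2 * C\<^sup>2 * (\<kappa> * (t - s))))"
    using mean_square_le_time_integral[OF Z st Zr] by (simp add: d_def)
  show "AE \<omega> in M. (LINT r:{s..t}|lborel. b r \<omega> $ i) =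
      (\<Sum>j\<in>UNIV. (LINT r:{s..t}|lborel. G r \<omega> $ i $ j) * x s \<omega> $ j) + d i \<omega>"
    using AE_b_integrable AE_space
  proof eventually_elim
    case (elim \<omega>)
    have b: "set_integrable lborel {s..t} (\<lambda>r. b r \<omega> $ i)"
      by (rule set_integrable_time[OF integrable_bounded_linear[OF bounded_linear_vec_nth elim(1)] st(1,3)])
    have Gx: "set_integrable lborel {s..t} (\<lambda>r. G r \<omega> $ i $ j * x s \<omega> $ j)" for j
      using G_set_integrable[OF st(1,3) elim(2)] by (rule set_integrable_mult_left)
    have GS: "set_integrable lborel {s..t} (\<lambda>r. \<Sum>j\<in>UNIV. G r \<omega> $ i $ j * x s \<omega> $ j)"
      using Gx unfolding set_integrable_def scaleR_right.sum by (intro Bochner_Integration.integrable_sum)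
    have "d i \<omega> = (LINT r:{s..t}|lborel. b r \<omega> $ i) - (LINT r:{s..t}|lborel. \<Sum>j\<in>UNIV. G r \<omega> $ i $ j * x s \<omega> $ j)"
      unfolding d_def by (rule set_integral_diff(2)[OF b GS])
    also have "(LINT r:{s..t}|lborel. \<Sum>j\<in>UNIV. G r \<omega> $ i $ j * x s \<omega> $ j) =
      (\<Sum>j\<in>UNIV. LINT r:{s..t}|lborel. G r \<omega> $ i $ j * x s \<omega> $ j)"
      using Gx unfolding set_lebesgue_integral_def set_integrable_def scaleR_right.sum
      by (intro Bochner_Integration.integral_sum)
    finally show ?case by simp
  qed
qed

lemma npart_x:
  assumes t: "0 \<le> t" "t \<le> T"
  shows "(\<lambda>\<omega>. npart (x t \<omega> $ i)) \<in> borel_measurable (\<F> t)"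
    and "mean_square_le M (\<lambda>\<omega>. npart (x t \<omega> $ i)) K"
proof -
  note [measurable] = x_component_adapted[OF t, of i]
  show "(\<lambda>\<omega>. npart (x t \<omega> $ i)) \<in> borel_measurable (\<F> t)" by measurable
  note X = mean_square_leD[OF x_bound[OF t, of i]]
  note [measurable] = X(1)
  have le: "(npart y)\<^sup>2 \<le> y\<^sup>2" for y by (simp add: min_def)
  have i: "integrable M (\<lambda>\<omega>. (npart (x t \<omega> $ i))\<^sup>2)"
    by (rule Bochner_Integration.integrable_bound[OF X(3)]) (use le in auto)
  show "mean_square_le M (\<lambda>\<omega>. npart (x t \<omega> $ i)) K"
  proof (rule mean_square_leI[OF _ i])
    show "(\<integral>\<omega>. (npart (x t \<omega> $ i))\<^sup>2 \<partial>M) \<le> K"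
      using integral_mono[OF i X(3) le] X(4) by simp
  qed measurable
qed

text \<open>Off the diagonal the integrated coefficient is nonnegative and
  \<open>npart (x s \<omega> $ i)\<close> is nonpositive, so a positive component \<open>j\<close>
  pushes the right way and only negative parts remain; on the diagonal the size of \<open>G\<close>
  is enough. In \<open>L + 1\<close> the \<open>L\<close> counts the repeated \<open>i\<close>-th
  square and the 1 is the sum over \<open>j\<close>.\<close>

lemma drift_pointwise:
  fixes i :: 'l
  assumes st: "0 \<le> s" "s \<le> t" "t \<le> T" and \<omega>: "\<omega> \<in> space M"
  defines "g \<equiv> \<Sum>j\<in>UNIV. (LINT r:{s..t}|lborel. G r \<omega> $ i $ j) * x s \<omega> $ j"
  shows "2 * (npart (x s \<omega> $ i) * g) \<le> C * (t - s) * (L + 1) * (\<Sum>j\<in>UNIV. (npart (x s \<omega> $ j))\<^sup>2)"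
    and "g\<^sup>2 \<le> (C * (t - s))\<^sup>2 * L * (\<Sum>j\<in>UNIV. (x s \<omega> $ j)\<^sup>2)"
proof -
  let ?c = "C * (t - s)" and ?G = "\<lambda>j. LINT r:{s..t}|lborel. G r \<omega> $ i $ j" and ?y = "\<lambda>j. x s \<omega> $ j"
  note bound = G_integral(1)[OF st \<omega>, of i] and nonneg = G_integral(2)[OF st \<omega>, of i]
  have c: "0 \<le> ?c" using C_nonneg st by simp
  have summand: "2 * (npart (?y i) * (?G j * ?y j)) \<le> ?c * ((npart (?y i))\<^sup>2 + (npart (?y j))\<^sup>2)" for j
  proof -
    have prod: "2 * (npart (?y i) * npart (?y j)) \<le> (npart (?y i))\<^sup>2 + (npart (?y j))\<^sup>2"
      using zero_le_power2[of "npart (?y i) - npart (?y j)"] unfolding power2_diff by simp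
    show ?thesis
    proof (cases "j = i")
      case True
      have sq: "npart (?y i) * ?y i = (npart (?y i))\<^sup>2" by (simp add: min_def power2_eq_square)
      have "2 * (npart (?y i) * (?G i * ?y i)) = ?G i * (2 * (npart (?y i) * ?y i))"
        by (simp only: mult_ac)
      also have "\<dots> = ?G i * (2 * (npart (?y i))\<^sup>2)" by (simp only: sq)
      also have "\<dots> \<le> ?c * (2 * (npart (?y i))\<^sup>2)"
        using bound[of i] by (intro mult_right_mono) auto
      finally show ?thesis using True by simp
    next
      case False
      have "npart (?y i) * ?y j \<le> npart (?y i) * npart (?y j)"
        by (intro mult_left_mono_neg) auto
      then have "?G j * (2 * (npart (?y i) * ?y j)) \<le> ?G j * ((npart (?y i))\<^sup>2 + (npart (?y j))\<^sup>2)"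
        using prod nonneg[of j] False by (intro mult_left_mono) auto
      also have "\<dots> \<le> ?c * ((npart (?y i))\<^sup>2 + (npart (?y j))\<^sup>2)"
        using bound[of j] by (intro mult_right_mono) auto
      finally show ?thesis by (simp add: mult_ac)
    qed
  qed
  have "2 * (npart (?y i) * g) = (\<Sum>j\<in>UNIV. 2 * (npart (?y i) * (?G j * ?y j)))"
    unfolding g_def by (simp add: sum_distrib_left)
  also have "\<dots> \<le> (\<Sum>j\<in>UNIV. ?c * ((npart (?y i))\<^sup>2 + (npart (?y j))\<^sup>2))"
    by (intro sum_mono summand)
  also have "\<dots> = ?c * (L * (npart (?y i))\<^sup>2 + (\<Sum>j\<in>UNIV. (npart (?y j))\<^sup>2))"
    unfolding L by (simp add: sum_distrib_left[symmetric] sum.distrib)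
  also have "\<dots> \<le> ?c * (L * (\<Sum>j\<in>UNIV. (npart (?y j))\<^sup>2) + (\<Sum>j\<in>UNIV. (npart (?y j))\<^sup>2))"
    unfolding L by (intro mult_left_mono[OF _ c] add_right_mono mult_left_mono member_le_sum) auto
  finally show "2 * (npart (?y i) * g) \<le> ?c * (L + 1) * (\<Sum>j\<in>UNIV. (npart (?y j))\<^sup>2)"
    by (simp add: algebra_simps)
  have "g\<^sup>2 \<le> (\<Sum>j\<in>UNIV. (?G j * ?y j)\<^sup>2) * L"
    unfolding g_def L by (rule sum_squared_le_sum_of_squares)
  also have "\<dots> \<le> (\<Sum>j\<in>UNIV. ?c\<^sup>2 * (?y j)\<^sup>2) * L"
  proof (intro mult_right_mono sum_mono)
    fix j
    have "(?G j)\<^sup>2 \<le> ?c\<^sup>2" using bound[of j] c by (intro abs_le_square_iff[THEN iffD1]) simp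
    then show "(?G j * ?y j)\<^sup>2 \<le> ?c\<^sup>2 * (?y j)\<^sup>2"
      unfolding power_mult_distrib[of "?G j"] by (intro mult_right_mono) auto
  qed (simp add: L)
  finally show "g\<^sup>2 \<le> ?c\<^sup>2 * L * (\<Sum>j\<in>UNIV. (?y j)\<^sup>2)"
    unfolding sum_distrib_left[symmetric] by (simp only: mult_ac)
qed

text \<open>The expectation of \<open>npart_one_step\<close>. Writing the step as
  \<open>\<delta>\<^sup>2\<close> keeps all powers integral: order 2 is one step length, order 3 the
  admissible error.\<close>

lemma npart_step:
  assumes s: "0 \<le> s" and \<delta>: "0 < \<delta>" "\<delta> \<le> 1" and t: "t = s + \<delta>\<^sup>2" "t \<le> T"
  shows "expectation (\<lambda>\<omega>. (npart (x t \<omega> $ i))\<^sup>2) \<le> expectation (\<lambda>\<omega>. (npart (x s \<omega> $ i))\<^sup>2)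
    + (N\<^sup>2 * C\<^sup>2 + C * (L + 1)) * \<delta>\<^sup>2 * q s
    + (3 * N ^ 4 * C ^ 4 * K + K + L\<^sup>2 * C\<^sup>2 * \<kappa> + N\<^sup>2 * C\<^sup>2 * K
       + 6 * (C\<^sup>2 * L\<^sup>2 * K + L\<^sup>2 * C\<^sup>2 * \<kappa> + N\<^sup>2 * (4 * (C\<^sup>2 * \<kappa>)))) * \<delta> ^ 3"
proof -
  have st: "0 \<le> s" "s \<le> t" "t \<le> T" and sT: "s \<le> T" and t0: "0 \<le> t" and h: "t - s = \<delta>\<^sup>2"
    using s t zero_le_power2[of \<delta>] by linarith+
  define a where "a \<omega> = x s \<omega> $ i" for \<omega>
  define \<eta> where "\<eta> \<omega> = (\<Sum>n\<in>UNIV. f n i * (w t \<omega> $ n - w s \<omega> $ n))" for \<omega>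
  define g where "g \<omega> = (\<Sum>j\<in>UNIV. (LINT r:{s..t}|lborel. G r \<omega> $ i $ j) * x s \<omega> $ j)" for \<omega>
  define d where "d \<omega> = (LINT r:{s..t}|lborel. b r \<omega> $ i - (\<Sum>j\<in>UNIV. G r \<omega> $ i $ j * x s \<omega> $ j))" for \<omega>
  define \<epsilon> where "\<epsilon> \<omega> = (\<Sum>n\<in>UNIV. I n t \<omega> $ i - I n s \<omega> $ i - f n i * x s \<omega> $ i * (w t \<omega> $ n - w s \<omega> $ n))" for \<omega>
  define P where "P \<omega> = C * \<delta>\<^sup>2 * (L + 1) * (\<Sum>j\<in>UNIV. (npart (x s \<omega> $ j))\<^sup>2)" for \<omega>
  define Q where "Q \<omega> = (C * \<delta>\<^sup>2)\<^sup>2 * L * (\<Sum>j\<in>UNIV. (x s \<omega> $ j)\<^sup>2)" for \<omega>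
  \<comment> \<open>\<open>V\<close> has mean at most \<open>q s\<close>, so its terms may be of
    first order in the step. \<open>U\<close> has mean bounded only by \<open>K\<close>, so its
    terms must reach \<open>\<delta> ^ 3\<close>. \<open>P\<close> and \<open>Q\<close> divide the
    drift in the same way.\<close>
  define V where "V \<omega> = (npart (a \<omega>))\<^sup>2" for \<omega>
  define U where "U \<omega> = (a \<omega>)\<^sup>2" for \<omega>
  have x_eq: "AE \<omega> in M. x t \<omega> $ i = a \<omega> + a \<omega> * \<eta> \<omega> + (g \<omega> + d \<omega> + \<epsilon> \<omega>)"
    using x_increment[OF st, of i] drift_error(2)[OF st, of i]
  proof eventually_elim
    case (elim \<omega>)
    have "a \<omega> * \<eta> \<omega> = (\<Sum>n\<in>UNIV. f n i * x s \<omega> $ i * (w t \<omega> $ n - w s \<omega> $ n))"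
      unfolding a_def \<eta>_def sum_distrib_left by (simp add: mult_ac)
    then have "a \<omega> * \<eta> \<omega> + \<epsilon> \<omega> = (\<Sum>n\<in>UNIV. I n t \<omega> $ i - I n s \<omega> $ i)"
      unfolding \<epsilon>_def by (simp add: sum_subtractf)
    with elim show ?case unfolding a_def[of \<omega>] g_def d_def by linarith
  qed
  have V_int: "integrable M V" "expectation V \<le> K" "expectation V \<le> q s" "V \<in> borel_measurable (\<F> s)" "0 \<le> V \<omega>" for \<omega>
    using mean_square_leD[OF npart_x(2)[OF s sT, of i]] npart_x(1)[OF s sT, of i] expectation_npart_le_q[of s i]
    unfolding V_def[abs_def] a_def by auto
  have U_int: "integrable M U" "expectation U \<le> K" "U \<in> borel_measurable (\<F> s)" "0 \<le> U \<omega>" for \<omega>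
    using mean_square_leD[OF x_bound[OF s sT, of i]] x_component_adapted[OF s sT, of i]
    unfolding U_def[abs_def] a_def by auto
  have V\<eta>: "integrable M (\<lambda>\<omega>. V \<omega> * \<eta> \<omega>)" "expectation (\<lambda>\<omega>. V \<omega> * \<eta> \<omega>) = 0"
      "integrable M (\<lambda>\<omega>. V \<omega> * (\<eta> \<omega>)\<^sup>2)" "expectation (\<lambda>\<omega>. V \<omega> * (\<eta> \<omega>)\<^sup>2) \<le> N\<^sup>2 * C\<^sup>2 * \<delta>\<^sup>2 * expectation V"
    using noise_moments[OF st(1,2) V_int(4,1,5), of i] unfolding h N[symmetric] \<eta>_def[symmetric]
    by (auto simp: has_bochner_integral_iff)
  have U\<eta>: "integrable M (\<lambda>\<omega>. U \<omega> * (\<eta> \<omega>)\<^sup>2)" "expectation (\<lambda>\<omega>. U \<omega> * (\<eta> \<omega>)\<^sup>2) \<le> N\<^sup>2 * C\<^sup>2 * \<delta>\<^sup>2 * expectation U"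
      "integrable M (\<lambda>\<omega>. U \<omega> * \<eta> \<omega> ^ 4)" "expectation (\<lambda>\<omega>. U \<omega> * \<eta> \<omega> ^ 4) \<le> 3 * N ^ 4 * C ^ 4 * (\<delta>\<^sup>2)\<^sup>2 * expectation U"
    using noise_moments[OF st(1,2) U_int(3,1,4), of i] unfolding h N[symmetric] \<eta>_def[symmetric]
    by auto
  have P_int: "integrable M P" "expectation P = C * \<delta>\<^sup>2 * (L + 1) * q s"
    using mean_square_leD(3)[OF npart_x(2)[OF s sT]] unfolding P_def[abs_def] q_def by auto
  have Q_int: "integrable M Q" "expectation Q \<le> (C * \<delta>\<^sup>2)\<^sup>2 * L * (L * K)"
  proof -
    note X = mean_square_leD(3,4)[OF x_bound[OF s sT]]
    show "integrable M Q" using X unfolding Q_def[abs_def] by auto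
    have "expectation Q = (C * \<delta>\<^sup>2)\<^sup>2 * L * (\<Sum>j\<in>UNIV. expectation (\<lambda>\<omega>. (x s \<omega> $ j)\<^sup>2))"
      using X unfolding Q_def[abs_def] by auto
    also have "\<dots> \<le> (C * \<delta>\<^sup>2)\<^sup>2 * L * (\<Sum>j\<in>(UNIV::'l set). K)"
      using X L by (intro mult_left_mono sum_mono) auto
    finally show "expectation Q \<le> (C * \<delta>\<^sup>2)\<^sup>2 * L * (L * K)" by (simp add: L)
  qed
  have d_ms: "mean_square_le M d ((\<delta>\<^sup>2)\<^sup>2 * (L\<^sup>2 * C\<^sup>2 * (\<kappa> * \<delta>\<^sup>2)))"
    using drift_error(1)[OF st, of i] unfolding h d_def[symmetric] by simp
  note d_int = mean_square_leD[OF d_ms]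
  have \<epsilon>_ms: "mean_square_le M \<epsilon> (N\<^sup>2 * (4 * (C\<^sup>2 * (\<kappa> * \<delta>\<^sup>2)) * \<delta>\<^sup>2))"
    unfolding \<epsilon>_def[abs_def] N using ito_error(1)[OF st, of _ i] unfolding h by (rule mean_square_le_sum)
  note \<epsilon>_int = mean_square_leD[OF \<epsilon>_ms]
  \<comment> \<open>\<open>npart (a \<omega>)\<close> is known at \<open>s\<close>, so each error of
    the stochastic integral is orthogonal to it and the cross term has mean 0.\<close>
  have "has_bochner_integral M (\<lambda>\<omega>. \<Sum>n\<in>UNIV. npart (a \<omega>) *
    (I n t \<omega> $ i - I n s \<omega> $ i - f n i * x s \<omega> $ i * (w t \<omega> $ n - w s \<omega> $ n))) (\<Sum>n\<in>(UNIV::'n set). 0)"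
    using npart_x(1)[OF s sT, of i] mean_square_leD(3)[OF npart_x(2)[OF s sT, of i]] unfolding a_def
    by (intro has_bochner_integral_sum ito_error(2)[OF st])
  then have a\<epsilon>: "integrable M (\<lambda>\<omega>. npart (a \<omega>) * \<epsilon> \<omega>)" "expectation (\<lambda>\<omega>. npart (a \<omega>) * \<epsilon> \<omega>) = 0"
    unfolding \<epsilon>_def sum_distrib_left by (auto simp: has_bochner_integral_iff)
  define \<sigma> where "\<sigma> = 3 * N ^ 4 * C ^ 4 * K"
  define \<gamma> where "\<gamma> = L\<^sup>2 * C\<^sup>2 * \<kappa>"
  define \<tau> where "\<tau> = N\<^sup>2 * C\<^sup>2 * K"
  define \<rho> where "\<rho> = C\<^sup>2 * L\<^sup>2 * K"
  define \<theta> where "\<theta> = N\<^sup>2 * (4 * (C\<^sup>2 * \<kappa>))"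
  have \<delta>_powers: "(\<delta>\<^sup>2)\<^sup>2 = \<delta> ^ 4" "\<delta>\<^sup>2 * \<delta>\<^sup>2 = \<delta> ^ 4" "\<delta> ^ 4 * \<delta>\<^sup>2 = \<delta> ^ 6"
    by (simp_all flip: power_mult power_add)
  have bounds: "expectation (\<lambda>\<omega>. V \<omega> * (\<eta> \<omega>)\<^sup>2) \<le> N\<^sup>2 * C\<^sup>2 * \<delta>\<^sup>2 * q s"
    "expectation (\<lambda>\<omega>. U \<omega> * \<eta> \<omega> ^ 4) \<le> \<sigma> * \<delta> ^ 4"
    "expectation (\<lambda>\<omega>. U \<omega> * (\<eta> \<omega>)\<^sup>2) \<le> \<tau> * \<delta>\<^sup>2"
    "expectation Q \<le> \<rho> * \<delta> ^ 4"
    "expectation (\<lambda>\<omega>. (d \<omega>)\<^sup>2) \<le> \<gamma> * \<delta> ^ 6"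
    "expectation (\<lambda>\<omega>. (\<epsilon> \<omega>)\<^sup>2) \<le> \<theta> * \<delta> ^ 4"
  proof -
    show "expectation (\<lambda>\<omega>. V \<omega> * (\<eta> \<omega>)\<^sup>2) \<le> N\<^sup>2 * C\<^sup>2 * \<delta>\<^sup>2 * q s"
      by (rule order_trans[OF V\<eta>(4) mult_left_mono[OF V_int(3)]]) simp
    have "expectation (\<lambda>\<omega>. U \<omega> * \<eta> \<omega> ^ 4) \<le> 3 * N ^ 4 * C ^ 4 * (\<delta>\<^sup>2)\<^sup>2 * K"
      by (rule order_trans[OF U\<eta>(4) mult_left_mono[OF U_int(2)]]) simp
    also have "\<dots> = \<sigma> * \<delta> ^ 4" unfolding \<sigma>_def \<delta>_powers by (simp only: mult_ac)
    finally show "expectation (\<lambda>\<omega>. U \<omega> * \<eta> \<omega> ^ 4) \<le> \<sigma> * \<delta> ^ 4" .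
    have "expectation (\<lambda>\<omega>. U \<omega> * (\<eta> \<omega>)\<^sup>2) \<le> N\<^sup>2 * C\<^sup>2 * \<delta>\<^sup>2 * K"
      by (rule order_trans[OF U\<eta>(2) mult_left_mono[OF U_int(2)]]) simp
    also have "\<dots> = \<tau> * \<delta>\<^sup>2" unfolding \<tau>_def by (simp only: mult_ac)
    finally show "expectation (\<lambda>\<omega>. U \<omega> * (\<eta> \<omega>)\<^sup>2) \<le> \<tau> * \<delta>\<^sup>2" .
    have "(C * \<delta>\<^sup>2)\<^sup>2 * L * (L * K) = \<rho> * \<delta> ^ 4"
      unfolding \<rho>_def power_mult_distrib \<delta>_powers power2_eq_square[of L] by (simp only: mult_ac)
    with Q_int(2) show "expectation Q \<le> \<rho> * \<delta> ^ 4" by simp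
    have "(\<delta>\<^sup>2)\<^sup>2 * (L\<^sup>2 * C\<^sup>2 * (\<kappa> * \<delta>\<^sup>2)) = \<gamma> * (\<delta> ^ 4 * \<delta>\<^sup>2)"
      unfolding \<gamma>_def \<delta>_powers(1) by (simp only: mult_ac)
    with d_int(4) show "expectation (\<lambda>\<omega>. (d \<omega>)\<^sup>2) \<le> \<gamma> * \<delta> ^ 6" by (simp add: \<delta>_powers)
    have "N\<^sup>2 * (4 * (C\<^sup>2 * (\<kappa> * \<delta>\<^sup>2)) * \<delta>\<^sup>2) = \<theta> * (\<delta>\<^sup>2 * \<delta>\<^sup>2)"
      unfolding \<theta>_def by (simp only: mult_ac)
    with \<epsilon>_int(4) show "expectation (\<lambda>\<omega>. (\<epsilon> \<omega>)\<^sup>2) \<le> \<theta> * \<delta> ^ 4" by (simp add: \<delta>_powers)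
  qed
  \<comment> \<open>The square of \<open>1 + \<eta>\<close> is expanded so that its linear term
    stands apart: it has mean 0, whereas a bound by size would be of order
    \<open>\<delta>\<close>.\<close>
  let ?R = "\<lambda>\<omega>. V \<omega> + 2 * (V \<omega> * \<eta> \<omega>) + V \<omega> * (\<eta> \<omega>)\<^sup>2 + U \<omega> * \<eta> \<omega> ^ 4 + P \<omega> + 2 * (npart (a \<omega>) * \<epsilon> \<omega>)
    + \<delta> ^ 3 * U \<omega> + (1 / \<delta> ^ 3) * (d \<omega>)\<^sup>2 + \<delta> * (U \<omega> * (\<eta> \<omega>)\<^sup>2)
    + 3 * (1 + 1 / \<delta>) * (Q \<omega> + (d \<omega>)\<^sup>2 + (\<epsilon> \<omega>)\<^sup>2)"
  have "AE \<omega> in M. (npart (x t \<omega> $ i))\<^sup>2 \<le> ?R \<omega>"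
    using x_eq AE_space
  proof eventually_elim
    case (elim \<omega>)
    have "2 * (npart (a \<omega>) * g \<omega>) \<le> P \<omega>" "(g \<omega>)\<^sup>2 \<le> Q \<omega>"
      using drift_pointwise[OF st elim(2), of i] unfolding a_def g_def P_def Q_def h by auto
    from npart_one_step[OF \<delta>(1) this, of "\<eta> \<omega>" "d \<omega>" "\<epsilon> \<omega>"]
    have "(npart (x t \<omega> $ i))\<^sup>2 \<le> V \<omega> * (1 + \<eta> \<omega>)\<^sup>2 + U \<omega> * \<eta> \<omega> ^ 4 + P \<omega> + 2 * (npart (a \<omega>) * \<epsilon> \<omega>)
      + (\<delta> ^ 3 * U \<omega> + (d \<omega>)\<^sup>2 / \<delta> ^ 3) + \<delta> * (U \<omega> * (\<eta> \<omega>)\<^sup>2)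
      + (1 + 1 / \<delta>) * (3 * (Q \<omega> + (d \<omega>)\<^sup>2 + (\<epsilon> \<omega>)\<^sup>2))"
      unfolding elim(1) V_def U_def .
    also have "V \<omega> * (1 + \<eta> \<omega>)\<^sup>2 = V \<omega> + 2 * (V \<omega> * \<eta> \<omega>) + V \<omega> * (\<eta> \<omega>)\<^sup>2"
      by (simp add: power2_sum algebra_simps)
    also have "(d \<omega>)\<^sup>2 / \<delta> ^ 3 = (1 / \<delta> ^ 3) * (d \<omega>)\<^sup>2" by simp
    also have "(1 + 1 / \<delta>) * (3 * (Q \<omega> + (d \<omega>)\<^sup>2 + (\<epsilon> \<omega>)\<^sup>2)) = 3 * (1 + 1 / \<delta>) * (Q \<omega> + (d \<omega>)\<^sup>2 + (\<epsilon> \<omega>)\<^sup>2)"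
      by (simp only: mult_ac)
    finally show ?case by (simp only: add.assoc)
  qed
  moreover have R_int: "integrable M ?R"
    using V_int U_int V\<eta> U\<eta> P_int Q_int d_int \<epsilon>_int a\<epsilon> by auto
  ultimately have "expectation (\<lambda>\<omega>. (npart (x t \<omega> $ i))\<^sup>2) \<le> expectation ?R"
    using mean_square_leD(3)[OF npart_x(2)[OF t0 st(3), of i]] by (intro integral_mono_AE)
  also have "expectation ?R = expectation V + expectation (\<lambda>\<omega>. V \<omega> * (\<eta> \<omega>)\<^sup>2) + expectation (\<lambda>\<omega>. U \<omega> * \<eta> \<omega> ^ 4)
    + expectation P + \<delta> ^ 3 * expectation U + (1 / \<delta> ^ 3) * expectation (\<lambda>\<omega>. (d \<omega>)\<^sup>2)
    + \<delta> * expectation (\<lambda>\<omega>. U \<omega> * (\<eta> \<omega>)\<^sup>2)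
    + 3 * (1 + 1 / \<delta>) * (expectation Q + expectation (\<lambda>\<omega>. (d \<omega>)\<^sup>2) + expectation (\<lambda>\<omega>. (\<epsilon> \<omega>)\<^sup>2))"
    using V_int(1) U_int(1) V\<eta> U\<eta> P_int(1) Q_int(1) d_int(3) \<epsilon>_int(3) a\<epsilon> by simp
  also have "\<dots> \<le> expectation V + N\<^sup>2 * C\<^sup>2 * \<delta>\<^sup>2 * q s + \<sigma> * \<delta> ^ 4 + C * \<delta>\<^sup>2 * (L + 1) * q s + \<delta> ^ 3 * K
    + (1 / \<delta> ^ 3) * (\<gamma> * \<delta> ^ 6) + \<delta> * (\<tau> * \<delta>\<^sup>2)
    + 3 * (1 + 1 / \<delta>) * (\<rho> * \<delta> ^ 4 + \<gamma> * \<delta> ^ 6 + \<theta> * \<delta> ^ 4)"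
    using bounds P_int(2) U_int(2) \<delta> by (intro add_mono mult_left_mono order_refl) auto
  also have "\<dots> \<le> expectation V + (N\<^sup>2 * C\<^sup>2 + C * (L + 1)) * \<delta>\<^sup>2 * q s + (\<sigma> + K + \<gamma> + \<tau> + 6 * (\<rho> + \<gamma> + \<theta>)) * \<delta> ^ 3"
  proof -
    have "N\<^sup>2 * C\<^sup>2 * \<delta>\<^sup>2 * q s + C * \<delta>\<^sup>2 * (L + 1) * q s = (N\<^sup>2 * C\<^sup>2 + C * (L + 1)) * \<delta>\<^sup>2 * q s"
      by (simp add: algebra_simps)
    moreover have "0 \<le> \<sigma>" "0 \<le> \<gamma>" "0 \<le> \<rho>" "0 \<le> \<theta>"
      using K_nonneg \<kappa>_nonneg by (auto simp: \<sigma>_def \<gamma>_def \<rho>_def \<theta>_def)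
    note one_step_remainder[OF \<delta> this, of K \<tau>]
    ultimately show ?thesis by linarith
  qed
  finally show ?thesis unfolding V_def a_def \<sigma>_def \<gamma>_def \<tau>_def \<rho>_def \<theta>_def .
qed

section \<open>Vanishing of the mean squared negative part\<close>

lemma q_zero:
  assumes x0: "\<And>i. 0 \<le> x0 $ i" and t: "0 \<le> t" "t \<le> T"
  shows "q t = 0"
proof -
  \<comment> \<open>Summing over the components multiplies both constants of
    \<open>npart_step\<close> by \<open>L\<close>; their maximum serves as the single constant of
    \<open>gronwall_discrete\<close>.\<close>
  define A where "A = L * (N\<^sup>2 * C\<^sup>2 + C * (L + 1))"
  define B where "B = L * (3 * N ^ 4 * C ^ 4 * K + K + L\<^sup>2 * C\<^sup>2 * \<kappa> + N\<^sup>2 * C\<^sup>2 * K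
       + 6 * (C\<^sup>2 * L\<^sup>2 * K + L\<^sup>2 * C\<^sup>2 * \<kappa> + N\<^sup>2 * (4 * (C\<^sup>2 * \<kappa>))))"
  have q_nonneg: "0 \<le> q r" for r unfolding q_def by (intro sum_nonneg) simp
  have A0: "0 \<le> A" using C_nonneg by (simp add: A_def L)
  have "q t \<le> 0"
  proof (rule gronwall_discrete[where q = q and C = "max A B" and t = t and T = T])
    show "0 \<le> max A B" using A0 by simp
    have "expectation (\<lambda>\<omega>. (npart (x 0 \<omega> $ i))\<^sup>2) = 0" for i
    proof (rule integral_eq_zero_AE)
      show "AE \<omega> in M. (npart (x 0 \<omega> $ i))\<^sup>2 = 0"
        using x_initial by eventually_elim (use x0[of i] in simp)
    qed
    then show "q 0 = 0" by (simp add: q_def)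
    fix r h :: real assume r: "0 \<le> r" "0 < h" "h \<le> 1" "r + h \<le> T"
    have sq: "(sqrt h)\<^sup>2 = h" and cube: "sqrt h ^ 3 = h * sqrt h" using r by (auto simp: power3_eq_cube)
    have "q (r + h) \<le> (\<Sum>i\<in>UNIV. expectation (\<lambda>\<omega>. (npart (x r \<omega> $ i))\<^sup>2)
        + (N\<^sup>2 * C\<^sup>2 + C * (L + 1)) * h * q r
        + (3 * N ^ 4 * C ^ 4 * K + K + L\<^sup>2 * C\<^sup>2 * \<kappa> + N\<^sup>2 * C\<^sup>2 * K
       + 6 * (C\<^sup>2 * L\<^sup>2 * K + L\<^sup>2 * C\<^sup>2 * \<kappa> + N\<^sup>2 * (4 * (C\<^sup>2 * \<kappa>)))) * (h * sqrt h))"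
      unfolding q_def[of "r + h"]
      using npart_step[of r "sqrt h" "r + h"] r unfolding sq cube by (intro sum_mono) auto
    also have "\<dots> = q r + A * h * q r + B * (h * sqrt h)"
      unfolding sum.distrib q_def[of r, symmetric] A_def B_def L by simp
    also have "\<dots> \<le> q r + max A B * h * q r + max A B * (h * sqrt h)"
      using r q_nonneg[of r] by (intro add_mono mult_right_mono order_refl) auto
    finally show "q (r + h) \<le> (1 + max A B * h) * q r + max A B * h * sqrt h"
      by (simp add: algebra_simps)
  qed (use t in auto)
  with q_nonneg[of t] show ?thesis by simp
qed

end

lemma AE_nonneg:
  assumes x0: "\<And>i. 0 \<le> x0 $ i" and t: "0 \<le> t" "t \<le> T"
  shows "AE \<omega> in M. \<forall>i. 0 \<le> x t \<omega> $ i"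
proof -
  obtain K where K: "\<And>t i. 0 \<le> t \<Longrightarrow> t \<le> T \<Longrightarrow> mean_square_le M (\<lambda>\<omega>. x t \<omega> $ i) K"
    using x_mean_square by blast
  have "(\<Sum>i\<in>UNIV. expectation (\<lambda>\<omega>. (npart (x t \<omega> $ i))\<^sup>2)) = 0"
    using q_zero[OF K refl refl refl x0 t] unfolding q_def by simp
  then have "expectation (\<lambda>\<omega>. (npart (x t \<omega> $ i))\<^sup>2) = 0" for i
    by (subst (asm) sum_nonneg_eq_0_iff) auto
  moreover have "integrable M (\<lambda>\<omega>. (npart (x t \<omega> $ i))\<^sup>2)" for i
    by (rule mean_square_leD(3)[OF npart_x(2)[OF K refl refl refl t]])
  ultimately have "AE \<omega> in M. (npart (x t \<omega> $ i))\<^sup>2 = 0" for i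
    by (subst (asm) integral_nonneg_eq_0_iff_AE) auto
  then have "AE \<omega> in M. 0 \<le> x t \<omega> $ i" for i
  proof eventually_elim
    fix \<omega> assume "(npart (x t \<omega> $ i))\<^sup>2 = 0"
    then show "0 \<le> x t \<omega> $ i" by (simp add: min_def split: if_splits)
  qed
  then show ?thesis by (simp add: AE_all_countable)
qed

end

section \<open>Positivity\<close>

text \<open>A diagonal factor on the right rescales columns without mixing entries. Hence entry
  \<open>i\<close>, \<open>j\<close> of \<open>B m ** K m\<close> is at most
  \<open>e m * \<bar>B m $ i $ j\<bar>\<close> in absolute value, the very amount subtracted in the
  Metzler hypothesis.\<close>

lemma matrix_mult_diagonal:
  assumes "diagonal_matrix X"
  shows "(B ** X) $ i $ j = B $ i $ j * X $ j $ j"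
proof -
  have "B $ i $ k * X $ k $ j = (if k = j then B $ i $ j * X $ j $ j else 0)" for k
    using assms by (simp add: diagonal_matrix_def)
  then have "(\<Sum>k\<in>UNIV. B $ i $ k * X $ k $ j) = (\<Sum>k\<in>UNIV. if k = j then B $ i $ j * X $ j $ j else 0)"
    by (rule sum.cong[OF refl])
  then show ?thesis by (simp add: matrix_matrix_mult_def)
qed

lemma diagonal_matrix_vector_mult:
  assumes "diagonal_matrix X"
  shows "X *v y = (\<chi> i. X $ i $ i * y $ i)"
proof (rule iffD2[OF vec_eq_iff], rule allI)
  fix i
  have "X $ i $ k * y $ k = (if k = i then X $ i $ i * y $ i else 0)" for k
    using assms by (simp add: diagonal_matrix_def)
  then have "(\<Sum>k\<in>UNIV. X $ i $ k * y $ k) = (\<Sum>k\<in>UNIV. if k = i then X $ i $ i * y $ i else 0)"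
    by (rule sum.cong[OF refl])
  then show "(X *v y) $ i = (\<chi> i. X $ i $ i * y $ i) $ i"
    by (simp add: matrix_vector_mult_def)
qed

lemma sum_matrix_vector_mult:
  fixes X :: "'i \<Rightarrow> real^'l^'k"
  shows "(\<Sum>m\<in>S. X m) *v y = (\<Sum>m\<in>S. X m *v y)"
  by (induction S rule: infinite_finite_induct) (simp_all add: matrix_vector_mult_add_rdistrib)

theorem theorem2:
  fixes M :: "'a measure" and \<F> :: "real \<Rightarrow> 'a measure"
    and w :: "real \<Rightarrow> 'a \<Rightarrow> real^'n"
    and A :: "real^'l^'l" and B :: "'m::finite \<Rightarrow> real^'l^'l" and F :: "'n \<Rightarrow> real^'l^'l"
    and e :: "'m \<Rightarrow> real"
    and T :: real
    and K :: "'m \<Rightarrow> real \<Rightarrow> 'a \<Rightarrow> real^'l^'l"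
    and u :: "'m \<Rightarrow> real \<Rightarrow> 'a \<Rightarrow> real^'l"
    and x :: "real \<Rightarrow> 'a \<Rightarrow> real^'l" and x0 :: "real^'l"
  assumes "prob_space M" and "filtration_on M \<F>" and "brownian_motion M \<F> w"
    and "T > 0"
    and "\<And>m. e m \<ge> 0"
    and "\<And>n. diagonal_matrix (F n)"
    and "metzler (A - (\<Sum>m\<in>UNIV. e m *\<^sub>R \<bar>B m\<bar>))"
    and K_diagonal: "\<And>m t \<omega>. t \<in> {0..T} \<Longrightarrow> \<omega> \<in> space M \<Longrightarrow> diagonal_matrix (K m t \<omega>)"
    and K_bound: "\<And>m t \<omega>. t \<in> {0..T} \<Longrightarrow> \<omega> \<in> space M \<Longrightarrow> \<bar>K m t \<omega>\<bar> \<le> e m *\<^sub>R mat 1"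
    and K_adapted: "\<And>m. measurable_adapted M \<F> T (K m)"
    and control: "\<And>m t \<omega>. t \<in> {0..T} \<Longrightarrow> \<omega> \<in> space M \<Longrightarrow> u m t \<omega> = K m t \<omega> *v x t \<omega>"
    and "regular_coefficient M T (\<lambda>t \<omega> y. (A + (\<Sum>m\<in>UNIV. B m ** K m t \<omega>)) *v y)"
    and "\<And>n. regular_coefficient M T (\<lambda>t \<omega> y. F n *v y)"
    and "square_integrable_process M \<F> T (\<lambda>t \<omega>. A *v x t \<omega> + (\<Sum>m\<in>UNIV. B m *v u m t \<omega>))"
    and "\<And>n. square_integrable_process M \<F> T (\<lambda>t \<omega>. F n *v x t \<omega>)"
    and "ito_equation M \<F> T w
           (\<lambda>t \<omega>. A *v x t \<omega> + (\<Sum>m\<in>UNIV. B m *v u m t \<omega>)) (\<lambda>n t \<omega>. F n *v x t \<omega>) x0 x"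
    and "\<And>i. x0 $ i \<ge> 0"
  shows "AE \<omega> in M. \<forall>t\<in>{0<..T}. \<forall>i. x t \<omega> $ i \<ge> 0"
proof -
  interpret prob_space M by fact
  define G where "G t \<omega> = A + (\<Sum>m\<in>UNIV. B m ** K m t \<omega>)" for t \<omega>
  \<comment> \<open>A crude sum that dominates every entry of the feedback matrix and every diagonal
    noise entry at once.\<close>
  define C where "C = (\<Sum>i\<in>UNIV. \<Sum>j\<in>UNIV. \<bar>A $ i $ j\<bar> + (\<Sum>m\<in>UNIV. e m * \<bar>B m $ i $ j\<bar>)) + (\<Sum>n\<in>UNIV. \<Sum>i\<in>UNIV. \<bar>F n $ i $ i\<bar>)"
  have K_entry: "\<bar>K m t \<omega> $ j $ j\<bar> \<le> e m" if "t \<in> {0..T}" "\<omega> \<in> space M" for m t \<omega> j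
  proof -
    have "\<bar>K m t \<omega>\<bar> $ j $ j \<le> (e m *\<^sub>R mat 1) $ j $ j"
      using K_bound[OF that, of m] unfolding le_matrix_iff by blast
    then show ?thesis by (simp add: abs_matrix_component mat_def)
  qed
  have G_entry: "G t \<omega> $ i $ j = A $ i $ j + (\<Sum>m\<in>UNIV. B m $ i $ j * K m t \<omega> $ j $ j)"
    if "t \<in> {0..T}" "\<omega> \<in> space M" for t \<omega> i j
    using K_diagonal[OF that] by (simp add: G_def matrix_mult_diagonal)
  have BK_le: "\<bar>\<Sum>m\<in>UNIV. B m $ i $ j * K m t \<omega> $ j $ j\<bar> \<le> (\<Sum>m\<in>UNIV. e m * \<bar>B m $ i $ j\<bar>)"
    if "t \<in> {0..T}" "\<omega> \<in> space M" for t \<omega> i j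
  proof (rule order_trans[OF sum_abs sum_mono])
    fix m
    show "\<bar>B m $ i $ j * K m t \<omega> $ j $ j\<bar> \<le> e m * \<bar>B m $ i $ j\<bar>"
      unfolding abs_mult using mult_left_mono[OF K_entry[OF that, of m j], of "\<bar>B m $ i $ j\<bar>"]
      by (simp add: mult.commute)
  qed
  have e_sum_nonneg: "0 \<le> (\<Sum>m\<in>UNIV. e m * \<bar>B m $ i $ j\<bar>)" for i j
    using assms(5) by (intro sum_nonneg) simp
  have C_A: "\<bar>A $ i $ j\<bar> + (\<Sum>m\<in>UNIV. e m * \<bar>B m $ i $ j\<bar>) \<le> C" for i j
  proof -
    have "\<bar>A $ i $ j\<bar> + (\<Sum>m\<in>UNIV. e m * \<bar>B m $ i $ j\<bar>) \<le> (\<Sum>j\<in>UNIV. \<bar>A $ i $ j\<bar> + (\<Sum>m\<in>UNIV. e m * \<bar>B m $ i $ j\<bar>))"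
      using e_sum_nonneg by (intro member_le_sum[of j UNIV "\<lambda>j. \<bar>A $ i $ j\<bar> + (\<Sum>m\<in>UNIV. e m * \<bar>B m $ i $ j\<bar>)"]) auto
    also have "\<dots> \<le> (\<Sum>i\<in>UNIV. \<Sum>j\<in>UNIV. \<bar>A $ i $ j\<bar> + (\<Sum>m\<in>UNIV. e m * \<bar>B m $ i $ j\<bar>))"
      using e_sum_nonneg
      by (intro member_le_sum[of i UNIV "\<lambda>i. \<Sum>j\<in>UNIV. \<bar>A $ i $ j\<bar> + (\<Sum>m\<in>UNIV. e m * \<bar>B m $ i $ j\<bar>)"] sum_nonneg) (auto intro!: add_nonneg_nonneg)
    also have "\<dots> \<le> C" unfolding C_def by (simp add: sum_nonneg)
    finally show ?thesis .
  qed
  have C_F: "\<bar>F n $ i $ i\<bar> \<le> C" for n i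
  proof -
    have "\<bar>F n $ i $ i\<bar> \<le> (\<Sum>i\<in>UNIV. \<bar>F n $ i $ i\<bar>)"
      by (rule member_le_sum[of i UNIV "\<lambda>i. \<bar>F n $ i $ i\<bar>"]) auto
    also have "\<dots> \<le> (\<Sum>n\<in>UNIV. \<Sum>i\<in>UNIV. \<bar>F n $ i $ i\<bar>)"
      by (rule member_le_sum[of n UNIV "\<lambda>n. \<Sum>i\<in>UNIV. \<bar>F n $ i $ i\<bar>"]) (auto intro: sum_nonneg)
    also have "\<dots> \<le> C" unfolding C_def using e_sum_nonneg by (simp add: sum_nonneg add_nonneg_nonneg)
    finally show ?thesis .
  qed
  note ito_eq = assms(16)[unfolded ito_equation_def]
  have x_adapted: "\<And>t. t \<in> {0..T} \<Longrightarrow> x t \<in> borel_measurable (\<F> t)"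
    and x_cont: "AE \<omega> in M. continuous_on {0..T} (\<lambda>t. x t \<omega>)"
    using ito_eq[THEN conjunct1] ito_eq[THEN conjunct2, THEN conjunct1] by simp_all
  obtain I where I: "\<forall>n. has_ito_integral M \<F> T (\<lambda>t \<omega>. w t \<omega> $ n) (\<lambda>t \<omega>. F n *v x t \<omega>) (I n)"
    and x_eq: "\<forall>t\<in>{0..T}. AE \<omega> in M. x t \<omega> =
      x0 + (LINT s:{0..t}|lborel. A *v x s \<omega> + (\<Sum>m\<in>UNIV. B m *v u m s \<omega>)) + (\<Sum>n\<in>UNIV. I n t \<omega>)"
    using ito_eq[THEN conjunct2, THEN conjunct2] by (elim exE conjE)
  interpret linear_sde M \<F> w T x "\<lambda>t \<omega>. A *v x t \<omega> + (\<Sum>m\<in>UNIV. B m *v u m t \<omega>)" G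
    "\<lambda>n i. F n $ i $ i" I x0 C
  proof unfold_locales
    show "filtration_on M \<F>" "brownian_motion M \<F> w" "0 < T" by (rule assms(2-4))+
    show "square_integrable_process M \<F> T (\<lambda>t \<omega>. A *v x t \<omega> + (\<Sum>m\<in>UNIV. B m *v u m t \<omega>))"
      by (rule assms(14))
    show "\<bar>F n $ i $ i\<bar> \<le> C" for n i by (rule C_F)
    \<comment> \<open>Diagonality of \<open>F n\<close> lets the noise act on each component through
      that component alone.\<close>
    show "has_ito_integral M \<F> T (\<lambda>t \<omega>. w t \<omega> $ n) (\<lambda>t \<omega>. \<chi> i. F n $ i $ i * x t \<omega> $ i) (I n)" for n
      using I[THEN spec, of n] unfolding diagonal_matrix_vector_mult[OF assms(6)] .
    show "(\<lambda>z. G (fst z) (snd z) $ i $ j) \<in> borel_measurable (time_space M T)" for i j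
    proof -
      have [measurable]: "(\<lambda>z. K m (fst z) (snd z) $ k $ l) \<in> borel_measurable (time_space M T)" for m k l
        by (rule component_borel_measurable[OF component_borel_measurable[OF measurable_adapted_time_space[OF K_adapted]]])
      have "(\<lambda>z. A $ i $ j + (\<Sum>m\<in>UNIV. \<Sum>k\<in>UNIV. B m $ i $ k * K m (fst z) (snd z) $ k $ j)) \<in> borel_measurable (time_space M T)"
        by measurable
      then show ?thesis by (simp add: G_def matrix_matrix_mult_def)
    qed
    fix t :: real assume t: "0 \<le> t" "t \<le> T"
    then have t': "t \<in> {0..T}" by simp
    show "x t \<in> borel_measurable (\<F> t)" by (rule x_adapted[OF t'])
    show "AE \<omega> in M. x t \<omega> = x0 + (LINT s:{0..t}|lborel. A *v x s \<omega> + (\<Sum>m\<in>UNIV. B m *v u m s \<omega>)) + (\<Sum>n\<in>UNIV. I n t \<omega>)"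
      by (rule bspec[OF x_eq t'])
    fix \<omega> assume \<omega>: "\<omega> \<in> space M"
    show "A *v x t \<omega> + (\<Sum>m\<in>UNIV. B m *v u m t \<omega>) = G t \<omega> *v x t \<omega>"
      using control[OF t' \<omega>]
      by (simp add: G_def matrix_vector_mult_add_rdistrib sum_matrix_vector_mult matrix_vector_mul_assoc)
    fix i j
    show "\<bar>G t \<omega> $ i $ j\<bar> \<le> C"
      using BK_le[OF t' \<omega>, of i j] C_A[of i j] unfolding G_entry[OF t' \<omega>] by linarith
    assume "i \<noteq> j"
    \<comment> \<open>The worst admissible feedback lowers an entry of \<open>A\<close> by
      \<open>e m * \<bar>B m $ i $ j\<bar>\<close> for every \<open>m\<close>, so off the diagonal
      the Metzler matrix of the hypothesis lies below \<open>G\<close>.\<close>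
    then have "0 \<le> A $ i $ j - (\<Sum>m\<in>UNIV. e m * \<bar>B m $ i $ j\<bar>)"
      using assms(7) by (simp add: metzler_def abs_matrix_component)
    then show "0 \<le> G t \<omega> $ i $ j"
      using BK_le[OF t' \<omega>, of i j] unfolding G_entry[OF t' \<omega>] by linarith
  qed
  \<comment> \<open>The null set outside which \<open>x r \<omega>\<close> is nonnegative depends on
    \<open>r\<close>, so only countably many times can be treated at once.\<close>
  have "AE \<omega> in M. \<forall>r\<in>\<rat> \<inter> {0..T}. \<forall>i. 0 \<le> x r \<omega> $ i"
  proof (subst AE_ball_countable)
    show "countable (\<rat> \<inter> {0..T})" by (intro countable_Int1 countable_rat)
    show "\<forall>r\<in>\<rat> \<inter> {0..T}. AE \<omega> in M. \<forall>i. 0 \<le> x r \<omega> $ i"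
    proof
      fix r assume "r \<in> \<rat> \<inter> {0..T}"
      then show "AE \<omega> in M. \<forall>i. 0 \<le> x r \<omega> $ i" by (intro AE_nonneg assms(17)) auto
    qed
  qed
  then show ?thesis
    using x_cont
  proof eventually_elim
    case (elim \<omega>)
    show ?case
    proof (intro ballI allI)
      fix t i assume t: "t \<in> {0<..T}"
      show "0 \<le> x t \<omega> $ i"
      proof (rule continuous_nonneg_from_rationals[of T "\<lambda>t. x t \<omega> $ i"])
        show "continuous_on {0..T} (\<lambda>t. x t \<omega> $ i)"
          by (rule continuous_on_component[OF elim(2)])
      qed (use elim(1) t in auto)
    qed
  qed
qed

end
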